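(* Let $d$ be a positive integer, let $\Theta$ be the vector space of real skew-symmetric $d\times d$ matrices with some fixed norm $\|\cdot\|$, and let $\ell$ be a fixed continuous length function on $G=\mathbb{T}^d$. For each $\theta\in\Theta$ let $(A_\theta,L_\theta)$ be the quantum torus with parameter $\theta$, equipped with the Lip-norm $L_\theta$ defined by $\ell$ and the dual action of $G$. Then for any $\varepsilon>0$ there is a $\delta>0$ such that if $\theta,\psi\in\Theta$ and $\|\theta-\psi\|<\delta$, then $$\operatorname{dist}_q(A_\theta,A_\psi)<\varepsilon .$$
   Context: Order-unit spaces. An order-unit space is a real partially ordered vector space $A$ with a distinguished element $e=e_A$ (the order unit) such that (1) for each $a\in A$ there is $r\in\mathbb{R}$ with $a\le re$; (2) if $a\in A$ and $a\le re$ for all real $r>0$, then $a\le 0$. Its norm is $\|a\|=\inf\{r: -re\le a\le re\}$. A state is an element $\mu$ of the Banach-space dual $A'$ with $\mu(e)=1=\|\mu\|'$; $S(A)$ denotes the set of states, with the $w^*$-topology. For a seminorm $L$ on $A$ put $\rho_L(\mu,\nu)=\sup\{|\mu(a)-\nu(a)|: L(a)\le 1\}$ for $\mu,\nu\in S(A)$. A Lip-norm on $A$ is a seminorm $L$ such that $L(a)=0$ iff $a\in\mathbb{R}e$, and the topology on $S(A)$ from $\rho_L$ is the $w^*$-topology. A compact quantum metric space is a pair $(A,L)$ with $A$ an order-unit space and $L$ a Lip-norm on $A$. Quantum Gromov–Hausdorff distance. For compact quantum metric spaces $(A,L_A)$, $(B,L_B)$, the direct sum $A\oplus B$ is an order-unit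 space with order unit $(e_A,e_B)$ and componentwise order; via the coordinate projections, $S(A)$ and $S(B)$ are viewed as subsets of $S(A\oplus B)$. $\mathcal{M}(L_A,L_B)$ is the set of Lip-norms $L$ on $A\oplus B$ which induce $L_A$ and $L_B$, i.e. $L_A(a)=\inf_{b\in B}L(a,b)$ and $L_B(b)=\inf_{a\in A}L(a,b)$. Then $\operatorname{dist}_q(A,B)=\inf\{\operatorname{dist}_H^{\rho_L}(S(A),S(B)): L\in\mathcal{M}(L_A,L_B)\}$, where $\operatorname{dist}_H^{\rho_L}$ is Hausdorff distance for $\rho_L$. Quantum tori. For $\theta\in\Theta$ let $\sigma_\theta(p,q)=\exp(i\pi\, p\cdot\theta q)$ for $p,q\in\mathbb{Z}^d$. On $C_c(\mathbb{Z}^d)$ (finitely supported complex functions) use the product $(f*g)(p)=\sum_q f(q)g(p-q)\sigma_\theta(q,p)$ and involution $f^*(p)=\overline{f(-p)}$. Let $\pi_\theta$ be the $*$-representation on $\ell^2(\mathbb{Z}^d)$ given by the same formula with $g$ replaced by $\xi\in\ell^2(\mathbb{Z}^d)$, let $\|f\|_\theta=\|\pi_\theta(f)\|$, and let $\bar A_\theta$ be the $C^*$-algebra completion of $C_c(\mathbb{Z}^d)$ for $\|\cdot\|_\theta$. The group $G=\mathbb{T}^d$ (dual of $\mathbb{Z}^d$, with pairing $\langle p,x\rangle$) acts on $\bar A_\theta$ by the extension of $(\alpha_x f)(p)=\langle p,x\rangle f(p)$. A length function on a group $G$ is a function $\ell:G\to[0,\infty)$ with $\ell(xy)\le\ell(x)+\ell(y)$,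 $\ell(x^{-1})=\ell(x)$, and $\ell(x)=0$ iff $x=e_G$. For $a\in\bar A_\theta$ set $L_\theta(a)=\sup\{\|\alpha_x(a)-a\|_\theta/\ell(x): x\ne e_G\}$. $A_\theta$ is the set of $a\in\bar A_\theta$ with $L_\theta(a)<\infty$; as a compact quantum metric space, $(A_\theta,L_\theta)$ means the real order-unit space of self-adjoint elements of $A_\theta$ (order unit $1$, order from the $C^*$-algebra $\bar A_\theta$) with the restriction of $L_\theta$. *)

theory Defs
  imports "HOL-Analysis.Analysis" "HOL-Algebra.Group"
begin

section \<open>Order-unit spaces and compact quantum metric spaces\<close>

text \<open>
  The vector space underlying an order-unit space is a linear subspace (the carrier) of some
  ambient real vector space; the order is only relevant on the carrier.
\<close>

record 'a ou_space = "'a partial_object" +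
  ou_le :: "'a \<Rightarrow> 'a \<Rightarrow> bool"
  ou_unit :: 'a

locale order_unit_space =
  fixes A :: "('a::real_vector, 'm) ou_space_scheme"
  assumes subspace_carrier: "subspace (carrier A)"
    and unit_in_carrier: "ou_unit A \<in> carrier A"
    and le_refl: "a \<in> carrier A \<Longrightarrow> ou_le A a a"
    and le_trans: "a \<in> carrier A \<Longrightarrow> b \<in> carrier A \<Longrightarrow> c \<in> carrier A \<Longrightarrow>
      ou_le A a b \<Longrightarrow> ou_le A b c \<Longrightarrow> ou_le A a c"
    and le_antisym: "a \<in> carrier A \<Longrightarrow> b \<in> carrier A \<Longrightarrow>
      ou_le A a b \<Longrightarrow> ou_le A b a \<Longrightarrow> a = b"
    and le_add: "a \<in> carrier A \<Longrightarrow> b \<in> carrier A \<Longrightarrow> c \<in> carrier A \<Longrightarrow>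
      ou_le A a b \<Longrightarrow> ou_le A (a + c) (b + c)"
    and le_scale: "a \<in> carrier A \<Longrightarrow> b \<in> carrier A \<Longrightarrow> 0 \<le> r \<Longrightarrow>
      ou_le A a b \<Longrightarrow> ou_le A (r *\<^sub>R a) (r *\<^sub>R b)"
    and order_unit: "a \<in> carrier A \<Longrightarrow> \<exists>r. ou_le A a (r *\<^sub>R ou_unit A)"
    and archimedean: "a \<in> carrier A \<Longrightarrow> (\<And>r. 0 < r \<Longrightarrow> ou_le A a (r *\<^sub>R ou_unit A)) \<Longrightarrow>
      ou_le A a 0"

definition ou_norm :: "('a::real_vector, 'm) ou_space_scheme \<Rightarrow> 'a \<Rightarrow> real" where
  "ou_norm A a = Inf {r. ou_le A (- (r *\<^sub>R ou_unit A)) a \<and> ou_le A a (r *\<^sub>R ou_unit A)}"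

text \<open>
  Functionals on the carrier are represented by functions that are \<open>undefined\<close> outside it, so
  that distinct functions are distinct functionals.
\<close>

definition ou_dual :: "('a::real_vector, 'm) ou_space_scheme \<Rightarrow> ('a \<Rightarrow> real) set" where
  "ou_dual A = {\<mu> \<in> extensional (carrier A).
     (\<forall>a\<in>carrier A. \<forall>b\<in>carrier A. \<mu> (a + b) = \<mu> a + \<mu> b) \<and>
     (\<forall>a\<in>carrier A. \<forall>r. \<mu> (r *\<^sub>R a) = r * \<mu> a) \<and>
     (\<exists>C. \<forall>a\<in>carrier A. \<bar>\<mu> a\<bar> \<le> C * ou_norm A a)}"

definition dual_norm :: "('a::real_vector, 'm) ou_space_scheme \<Rightarrow> ('a \<Rightarrow> real) \<Rightarrow> real" where
  "dual_norm A \<mu> = (SUP a\<in>{a \<in> carrier A. ou_norm A a \<le> 1}. \<bar>\<mu> a\<bar>)"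

definition states :: "('a::real_vector, 'm) ou_space_scheme \<Rightarrow> ('a \<Rightarrow> real) set" where
  "states A = {\<mu> \<in> ou_dual A. \<mu> (ou_unit A) = 1 \<and> dual_norm A \<mu> = 1}"

text \<open>The topology of pointwise convergence on the carrier.\<close>

definition weak_star :: "('a::real_vector, 'm) ou_space_scheme \<Rightarrow> ('a \<Rightarrow> real) topology" where
  "weak_star A = subtopology (product_topology (\<lambda>_. euclideanreal) (carrier A)) (states A)"

definition rho :: "('a::real_vector, 'm) ou_space_scheme \<Rightarrow> ('a \<Rightarrow> real) \<Rightarrow>
    ('a \<Rightarrow> real) \<Rightarrow> ('a \<Rightarrow> real) \<Rightarrow> ereal" where
  "rho A L \<mu> \<nu> = (SUP a\<in>{a \<in> carrier A. L a \<le> 1}. ereal \<bar>\<mu> a - \<nu> a\<bar>)"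

text \<open>
  The topology whose open sets contain a \<open>rho\<close>-ball around each of their points. For a general
  seminorm \<open>rho\<close> may take the value \<open>\<infinity>\<close>, so the library's topologies of (real-valued) metric
  spaces do not apply.
\<close>

definition rho_topology ::
    "('a::real_vector, 'm) ou_space_scheme \<Rightarrow> ('a \<Rightarrow> real) \<Rightarrow> ('a \<Rightarrow> real) topology" where
  "rho_topology A L = topology (\<lambda>U. U \<subseteq> states A \<and>
     (\<forall>\<mu>\<in>U. \<exists>r>0. \<forall>\<nu>\<in>states A. rho A L \<mu> \<nu> < ereal r \<longrightarrow> \<nu> \<in> U))"

lemma openin_rho_topology:
  "openin (rho_topology A L) U \<longleftrightarrow> U \<subseteq> states A \<and>
     (\<forall>\<mu>\<in>U. \<exists>r>0. \<forall>\<nu>\<in>states A. rho A L \<mu> \<nu> < ereal r \<longrightarrow> \<nu> \<in> U)"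
proof -
  let ?P = "\<lambda>U. U \<subseteq> states A \<and>
     (\<forall>\<mu>\<in>U. \<exists>r>0. \<forall>\<nu>\<in>states A. rho A L \<mu> \<nu> < ereal r \<longrightarrow> \<nu> \<in> U)"
  have inter: "?P (S \<inter> T)" if S: "?P S" and T: "?P T" for S T
  proof (intro conjI ballI)
    show "S \<inter> T \<subseteq> states A" using S by blast
    fix \<mu> assume \<mu>: "\<mu> \<in> S \<inter> T"
    obtain r where r: "r > 0" "\<forall>\<nu>\<in>states A. rho A L \<mu> \<nu> < ereal r \<longrightarrow> \<nu> \<in> S"
      using S \<mu> by blast
    obtain s where s: "s > 0" "\<forall>\<nu>\<in>states A. rho A L \<mu> \<nu> < ereal s \<longrightarrow> \<nu> \<in> T"
      using T \<mu> by blast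
    show "\<exists>r>0. \<forall>\<nu>\<in>states A. rho A L \<mu> \<nu> < ereal r \<longrightarrow> \<nu> \<in> S \<inter> T"
    proof (intro exI[of _ "min r s"] conjI ballI impI)
      show "0 < min r s" using r s by simp
      fix \<nu> assume "\<nu> \<in> states A" and l: "rho A L \<mu> \<nu> < ereal (min r s)"
      moreover have "rho A L \<mu> \<nu> < ereal r" "rho A L \<mu> \<nu> < ereal s"
        using less_le_trans[OF l, of "ereal r"] less_le_trans[OF l, of "ereal s"] by auto
      ultimately show "\<nu> \<in> S \<inter> T" using r s by blast
    qed
  qed
  have "?P (\<Union>\<K>)" if \<K>: "\<forall>K\<in>\<K>. ?P K" for \<K>
  proof (intro conjI ballI)
    show "\<Union>\<K> \<subseteq> states A" using \<K> by blast
    fix \<mu> assume "\<mu> \<in> \<Union>\<K>"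
    then obtain K where K: "K \<in> \<K>" "\<mu> \<in> K" by blast
    then obtain r where "r > 0" "\<forall>\<nu>\<in>states A. rho A L \<mu> \<nu> < ereal r \<longrightarrow> \<nu> \<in> K"
      using \<K> by blast
    then show "\<exists>r>0. \<forall>\<nu>\<in>states A. rho A L \<mu> \<nu> < ereal r \<longrightarrow> \<nu> \<in> \<Union>\<K>"
      using K by blast
  qed
  then have "istopology ?P"
    unfolding istopology_def using inter by blast
  then show ?thesis
    unfolding rho_topology_def by (simp add: topology_inverse')
qed

definition seminorm_on :: "'a::real_vector set \<Rightarrow> ('a \<Rightarrow> real) \<Rightarrow> bool" where
  "seminorm_on V L \<longleftrightarrow> (\<forall>a\<in>V. 0 \<le> L a) \<and> (\<forall>a\<in>V. \<forall>r. L (r *\<^sub>R a) = \<bar>r\<bar> * L a) \<and>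
     (\<forall>a\<in>V. \<forall>b\<in>V. L (a + b) \<le> L a + L b)"

definition norm_on :: "'a::real_vector set \<Rightarrow> ('a \<Rightarrow> real) \<Rightarrow> bool" where
  "norm_on V N \<longleftrightarrow> seminorm_on V N \<and> (\<forall>a\<in>V. N a = 0 \<longrightarrow> a = 0)"

definition lip_norm :: "('a::real_vector, 'm) ou_space_scheme \<Rightarrow> ('a \<Rightarrow> real) \<Rightarrow> bool" where
  "lip_norm A L \<longleftrightarrow> seminorm_on (carrier A) L \<and>
     (\<forall>a\<in>carrier A. L a = 0 \<longleftrightarrow> (\<exists>r. a = r *\<^sub>R ou_unit A)) \<and>
     rho_topology A L = weak_star A"

definition compact_quantum_metric_space ::
    "('a::real_vector, 'm) ou_space_scheme \<Rightarrow> ('a \<Rightarrow> real) \<Rightarrow> bool" where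
  "compact_quantum_metric_space A L \<longleftrightarrow> order_unit_space A \<and> lip_norm A L"


section \<open>Quantum Gromov--Hausdorff distance\<close>

definition direct_sum ::
    "('a::real_vector, 'm) ou_space_scheme \<Rightarrow> ('b::real_vector, 'n) ou_space_scheme \<Rightarrow>
     ('a \<times> 'b) ou_space" where
  "direct_sum A B = \<lparr>carrier = carrier A \<times> carrier B,
     ou_le = (\<lambda>x y. ou_le A (fst x) (fst y) \<and> ou_le B (snd x) (snd y)),
     ou_unit = (ou_unit A, ou_unit B)\<rparr>"

definition states_fst ::
    "('a::real_vector, 'm) ou_space_scheme \<Rightarrow> ('b::real_vector, 'n) ou_space_scheme \<Rightarrow>
     ('a \<times> 'b \<Rightarrow> real) set" where
  "states_fst A B = (\<lambda>\<mu>. restrict (\<mu> \<circ> fst) (carrier (direct_sum A B))) ` states A"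

definition states_snd ::
    "('a::real_vector, 'm) ou_space_scheme \<Rightarrow> ('b::real_vector, 'n) ou_space_scheme \<Rightarrow>
     ('a \<times> 'b \<Rightarrow> real) set" where
  "states_snd A B = (\<lambda>\<nu>. restrict (\<nu> \<circ> snd) (carrier (direct_sum A B))) ` states B"

definition lip_norms_inducing ::
    "('a::real_vector, 'm) ou_space_scheme \<Rightarrow> ('a \<Rightarrow> real) \<Rightarrow>
     ('b::real_vector, 'n) ou_space_scheme \<Rightarrow> ('b \<Rightarrow> real) \<Rightarrow> ('a \<times> 'b \<Rightarrow> real) set" where
  "lip_norms_inducing A LA B LB = {L. lip_norm (direct_sum A B) L \<and>
     (\<forall>a\<in>carrier A. LA a = (INF b\<in>carrier B. L (a, b))) \<and>
     (\<forall>b\<in>carrier B. LB b = (INF a\<in>carrier A. L (a, b)))}"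

definition hausdorff_dist :: "('s \<Rightarrow> 's \<Rightarrow> ereal) \<Rightarrow> 's set \<Rightarrow> 's set \<Rightarrow> ereal" where
  "hausdorff_dist \<rho> X Y = Inf {ereal r | r. 0 < r \<and>
     (\<forall>x\<in>X. \<exists>y\<in>Y. \<rho> x y < ereal r) \<and> (\<forall>y\<in>Y. \<exists>x\<in>X. \<rho> x y < ereal r)}"

text \<open>Extended-real valued: an infimum over an empty set is \<open>\<infinity>\<close>, not a junk real number.\<close>

definition dist_q ::
    "('a::real_vector, 'm) ou_space_scheme \<Rightarrow> ('a \<Rightarrow> real) \<Rightarrow>
     ('b::real_vector, 'n) ou_space_scheme \<Rightarrow> ('b \<Rightarrow> real) \<Rightarrow> ereal" where
  "dist_q A LA B LB = (INF L\<in>lip_norms_inducing A LA B LB.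
     hausdorff_dist (rho (direct_sum A B) L) (states_fst A B) (states_snd A B))"


section \<open>The Hilbert space of square-summable functions\<close>

typedef 'i ell2 = "{\<xi> :: 'i \<Rightarrow> complex. (\<lambda>p. (cmod (\<xi> p))\<^sup>2) summable_on UNIV}"
  morphisms ell2_apply Abs_ell2
  by (rule exI[of _ "\<lambda>_. 0"]) simp

setup_lifting type_definition_ell2

lemma sq_summable: "(\<lambda>p. (cmod (ell2_apply \<xi> p))\<^sup>2) summable_on UNIV"
  using ell2_apply by blast

lemma sq_summable_add:
  assumes "(\<lambda>p. (cmod (\<xi> p))\<^sup>2) summable_on UNIV" "(\<lambda>p. (cmod (\<eta> p))\<^sup>2) summable_on UNIV"
  shows "(\<lambda>p. (cmod (\<xi> p + \<eta> p))\<^sup>2) summable_on UNIV"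
proof (rule summable_on_comparison_test)
  show "(\<lambda>p. 2 * (cmod (\<xi> p))\<^sup>2 + 2 * (cmod (\<eta> p))\<^sup>2) summable_on UNIV"
    using assms by (intro summable_on_add summable_on_cmult_right)
  fix p
  have "(cmod (\<xi> p + \<eta> p))\<^sup>2 \<le> (cmod (\<xi> p) + cmod (\<eta> p))\<^sup>2"
    by (intro power_mono norm_triangle_ineq norm_ge_zero)
  also have "\<dots> \<le> 2 * (cmod (\<xi> p))\<^sup>2 + 2 * (cmod (\<eta> p))\<^sup>2"
    using zero_le_power2[of "cmod (\<xi> p) - cmod (\<eta> p)"]
    by (simp add: power2_eq_square algebra_simps)
  finally show "(cmod (\<xi> p + \<eta> p))\<^sup>2 \<le> 2 * (cmod (\<xi> p))\<^sup>2 + 2 * (cmod (\<eta> p))\<^sup>2" .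
qed auto

lemma prod_abs_summable:
  assumes "(\<lambda>p. (cmod (\<xi> p))\<^sup>2) summable_on UNIV" "(\<lambda>p. (cmod (\<eta> p))\<^sup>2) summable_on UNIV"
  shows "(\<lambda>p. norm (\<xi> p * cnj (\<eta> p))) summable_on UNIV"
proof (rule summable_on_comparison_test)
  show "(\<lambda>p. (cmod (\<xi> p))\<^sup>2 + (cmod (\<eta> p))\<^sup>2) summable_on UNIV"
    using assms by (intro summable_on_add)
  fix p
  have "2 * (cmod (\<xi> p) * cmod (\<eta> p)) \<le> (cmod (\<xi> p))\<^sup>2 + (cmod (\<eta> p))\<^sup>2"
    using zero_le_power2[of "cmod (\<xi> p) - cmod (\<eta> p)"]
    by (simp add: power2_eq_square algebra_simps)
  moreover have "0 \<le> cmod (\<xi> p) * cmod (\<eta> p)" by simp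
  ultimately show "norm (\<xi> p * cnj (\<eta> p)) \<le> (cmod (\<xi> p))\<^sup>2 + (cmod (\<eta> p))\<^sup>2"
    unfolding norm_mult complex_mod_cnj by linarith
qed auto

definition cinner :: "'i ell2 \<Rightarrow> 'i ell2 \<Rightarrow> complex" where
  "cinner \<xi> \<eta> = (\<Sum>\<^sub>\<infinity>p. ell2_apply \<xi> p * cnj (ell2_apply \<eta> p))"

lemma cinner_summable: "(\<lambda>p. ell2_apply \<xi> p * cnj (ell2_apply \<eta> p)) summable_on UNIV"
  by (rule abs_summable_summable[OF prod_abs_summable[OF sq_summable sq_summable]])

instantiation ell2 :: (type) real_vector
begin

lift_definition zero_ell2 :: "'a ell2" is "\<lambda>_. 0"
  by simp

lift_definition plus_ell2 :: "'a ell2 \<Rightarrow> 'a ell2 \<Rightarrow> 'a ell2" is "\<lambda>\<xi> \<eta> p. \<xi> p + \<eta> p"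
  using sq_summable_add by blast

lift_definition uminus_ell2 :: "'a ell2 \<Rightarrow> 'a ell2" is "\<lambda>\<xi> p. - \<xi> p"
  by simp

lift_definition minus_ell2 :: "'a ell2 \<Rightarrow> 'a ell2 \<Rightarrow> 'a ell2" is "\<lambda>\<xi> \<eta> p. \<xi> p - \<eta> p"
  using sq_summable_add[of _ "\<lambda>p. - _ p"] by simp

lift_definition scaleR_ell2 :: "real \<Rightarrow> 'a ell2 \<Rightarrow> 'a ell2" is "\<lambda>r \<xi> p. of_real r * \<xi> p"
  by (simp add: norm_mult power_mult_distrib summable_on_cmult_right)

instance
  by standard (transfer; simp add: fun_eq_iff algebra_simps)+

end

lemma ell2_apply_simps [simp]:
  "ell2_apply 0 p = 0"
  "ell2_apply (\<xi> + \<eta>) p = ell2_apply \<xi> p + ell2_apply \<eta> p"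
  "ell2_apply (- \<xi>) p = - ell2_apply \<xi> p"
  "ell2_apply (\<xi> - \<eta>) p = ell2_apply \<xi> p - ell2_apply \<eta> p"
  "ell2_apply (r *\<^sub>R \<xi>) p = of_real r * ell2_apply \<xi> p"
  by (transfer, simp)+

lemma ell2_apply_sum [simp]: "ell2_apply (\<Sum>q\<in>S. \<xi> q) p = (\<Sum>q\<in>S. ell2_apply (\<xi> q) p)"
  by (induction S rule: infinite_finite_induct) auto

lemma ell2_eqI: "(\<And>p. ell2_apply \<xi> p = ell2_apply \<eta> p) \<Longrightarrow> \<xi> = \<eta>"
  by (simp add: ell2_apply_inject[symmetric] fun_eq_iff)

lemma cinner_self: "cinner \<xi> \<xi> = of_real (\<Sum>\<^sub>\<infinity>p. (cmod (ell2_apply \<xi> p))\<^sup>2)"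
  unfolding cinner_def complex_norm_square[symmetric]
  by (rule infsumI[OF has_sum_of_real[OF has_sum_infsum[OF sq_summable]]])

instantiation ell2 :: (type) real_inner
begin

definition inner_ell2 :: "'a ell2 \<Rightarrow> 'a ell2 \<Rightarrow> real" where
  "inner_ell2 \<xi> \<eta> = Re (cinner \<xi> \<eta>)"

definition norm_ell2 :: "'a ell2 \<Rightarrow> real" where
  "norm_ell2 \<xi> = sqrt (\<Sum>\<^sub>\<infinity>p. (cmod (ell2_apply \<xi> p))\<^sup>2)"

definition dist_ell2 :: "'a ell2 \<Rightarrow> 'a ell2 \<Rightarrow> real" where
  "dist_ell2 \<xi> \<eta> = norm (\<xi> - \<eta>)"

definition sgn_ell2 :: "'a ell2 \<Rightarrow> 'a ell2" where
  "sgn_ell2 \<xi> = \<xi> /\<^sub>R norm \<xi>"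

definition uniformity_ell2 :: "('a ell2 \<times> 'a ell2) filter" where
  "uniformity_ell2 = (INF e\<in>{0<..}. principal {(\<xi>, \<eta>). dist \<xi> \<eta> < e})"

definition open_ell2 :: "'a ell2 set \<Rightarrow> bool" where
  "open_ell2 U \<longleftrightarrow> (\<forall>\<xi>\<in>U. eventually (\<lambda>(\<xi>', \<eta>). \<xi>' = \<xi> \<longrightarrow> \<eta> \<in> U) uniformity)"

instance
proof
  fix \<xi> \<eta> \<zeta> :: "'a ell2" and r :: real
  show "dist \<xi> \<eta> = norm (\<xi> - \<eta>)" by (rule dist_ell2_def)
  show "sgn \<xi> = \<xi> /\<^sub>R norm \<xi>" by (rule sgn_ell2_def)
  show "uniformity = (INF e\<in>{0<..}. principal {(\<xi>, \<eta>::'a ell2). dist \<xi> \<eta> < e})"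
    by (rule uniformity_ell2_def)
  show "open U \<longleftrightarrow> (\<forall>\<xi>\<in>U. eventually (\<lambda>(\<xi>', \<eta>). \<xi>' = \<xi> \<longrightarrow> \<eta> \<in> U) uniformity)"
    for U :: "'a ell2 set" by (rule open_ell2_def)
  have "cinner \<eta> \<xi> = cnj (cinner \<xi> \<eta>)"
    unfolding cinner_def infsum_cnj[symmetric] by (simp add: mult.commute)
  then show "\<xi> \<bullet> \<eta> = \<eta> \<bullet> \<xi>" by (simp add: inner_ell2_def)
  have "cinner (\<xi> + \<eta>) \<zeta> = cinner \<xi> \<zeta> + cinner \<eta> \<zeta>"
    unfolding cinner_def ell2_apply_simps distrib_right
    by (rule infsum_add[OF cinner_summable cinner_summable])
  then show "(\<xi> + \<eta>) \<bullet> \<zeta> = \<xi> \<bullet> \<zeta> + \<eta> \<bullet> \<zeta>" by (simp add: inner_ell2_def)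
  have "cinner (r *\<^sub>R \<xi>) \<eta> = of_real r * cinner \<xi> \<eta>"
    unfolding cinner_def ell2_apply_simps mult.assoc
    by (rule infsum_cmult_right[OF cinner_summable])
  then show "(r *\<^sub>R \<xi>) \<bullet> \<eta> = r * (\<xi> \<bullet> \<eta>)" by (simp add: inner_ell2_def)
  have self: "\<xi> \<bullet> \<xi> = (\<Sum>\<^sub>\<infinity>p. (cmod (ell2_apply \<xi> p))\<^sup>2)"
    by (simp add: inner_ell2_def cinner_self)
  show "0 \<le> \<xi> \<bullet> \<xi>" unfolding self by (rule infsum_nonneg) simp
  show "norm \<xi> = sqrt (\<xi> \<bullet> \<xi>)" unfolding self norm_ell2_def ..
  show "\<xi> \<bullet> \<xi> = 0 \<longleftrightarrow> \<xi> = 0"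
  proof
    assume "\<xi> \<bullet> \<xi> = 0"
    then have "(cmod (ell2_apply \<xi> p))\<^sup>2 = 0" for p
      unfolding self using nonneg_infsum_le_0D[OF _ sq_summable[of \<xi>], of p] by simp
    then show "\<xi> = 0" by (intro ell2_eqI) simp
  qed (simp add: inner_ell2_def cinner_def)
qed

end

lemma cmod_ell2_apply_le: "cmod (ell2_apply \<xi> p) \<le> norm \<xi>"
proof -
  have "(\<Sum>q\<in>{p}. (cmod (ell2_apply \<xi> q))\<^sup>2) \<le> (\<Sum>\<^sub>\<infinity>q. (cmod (ell2_apply \<xi> q))\<^sup>2)"
    by (rule finite_sum_le_infsum[OF sq_summable]) auto
  then show ?thesis
    unfolding norm_ell2_def by (intro real_le_rsqrt) simp
qed

instance ell2 :: (type) banach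
proof
  fix X :: "nat \<Rightarrow> 'a ell2" assume X: "Cauchy X"
  have "convergent (\<lambda>n. ell2_apply (X n) p)" for p
  proof (rule Cauchy_convergent, rule CauchyI)
    fix e :: real assume "0 < e"
    then obtain M where M: "\<forall>m\<ge>M. \<forall>n\<ge>M. norm (X m - X n) < e"
      using CauchyD[OF X] by blast
    have "norm (ell2_apply (X m) p - ell2_apply (X n) p) < e" if "m \<ge> M" "n \<ge> M" for m n
      using cmod_ell2_apply_le[of "X m - X n" p] M that by fastforce
    then show "\<exists>M. \<forall>m\<ge>M. \<forall>n\<ge>M. norm (ell2_apply (X m) p - ell2_apply (X n) p) < e"
      by blast
  qed
  then obtain \<xi> where \<xi>: "(\<lambda>n. ell2_apply (X n) p) \<longlonglongrightarrow> \<xi> p" for p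
    unfolding convergent_def by metis
  have part: "(\<Sum>p\<in>F. (cmod (ell2_apply (X m) p - \<xi> p))\<^sup>2) \<le> e\<^sup>2"
    if F: "finite F" and e: "0 < e" and M: "\<forall>m\<ge>M. \<forall>n\<ge>M. norm (X m - X n) < e" and m: "m \<ge> M"
    for F e M m
  proof (rule LIMSEQ_le_const2)
    show "(\<lambda>n. \<Sum>p\<in>F. (cmod (ell2_apply (X m) p - ell2_apply (X n) p))\<^sup>2) \<longlonglongrightarrow>
        (\<Sum>p\<in>F. (cmod (ell2_apply (X m) p - \<xi> p))\<^sup>2)"
      by (intro tendsto_intros \<xi>)
    have "(\<Sum>p\<in>F. (cmod (ell2_apply (X m) p - ell2_apply (X n) p))\<^sup>2) \<le> e\<^sup>2" if n: "n \<ge> M" for n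
    proof -
      have "(\<Sum>p\<in>F. (cmod (ell2_apply (X m - X n) p))\<^sup>2) \<le>
          (\<Sum>\<^sub>\<infinity>p. (cmod (ell2_apply (X m - X n) p))\<^sup>2)"
        by (rule finite_sum_le_infsum[OF sq_summable F]) auto
      also have "\<dots> = (norm (X m - X n))\<^sup>2"
        unfolding norm_ell2_def by (simp add: infsum_nonneg)
      also have "\<dots> \<le> e\<^sup>2"
        using M m n by (intro power_mono) (auto intro: less_imp_le)
      finally show ?thesis by simp
    qed
    then show "\<exists>N. \<forall>n\<ge>N. (\<Sum>p\<in>F. (cmod (ell2_apply (X m) p - ell2_apply (X n) p))\<^sup>2) \<le> e\<^sup>2"
      by blast
  qed
  have diff: "(\<lambda>p. (cmod (ell2_apply (X m) p - \<xi> p))\<^sup>2) summable_on UNIV"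
    if "0 < e" "\<forall>m\<ge>M. \<forall>n\<ge>M. norm (X m - X n) < e" "m \<ge> M" for e M m
    by (rule nonneg_bdd_above_summable_on)
      (use part[OF _ that] in \<open>auto intro!: bdd_aboveI[of _ "e\<^sup>2"]\<close>)
  obtain M1 where M1: "\<forall>m\<ge>M1. \<forall>n\<ge>M1. norm (X m - X n) < 1"
    using CauchyD[OF X zero_less_one] by blast
  have "(\<lambda>p. (cmod (ell2_apply (X M1) p + - (ell2_apply (X M1) p - \<xi> p)))\<^sup>2) summable_on UNIV"
    by (rule sq_summable_add[OF sq_summable]) (use diff[OF zero_less_one M1 order_refl] in \<open>simp add: norm_minus_commute\<close>)
  then have "(\<lambda>p. (cmod (\<xi> p))\<^sup>2) summable_on UNIV" by simp
  then obtain \<zeta> where \<zeta>: "ell2_apply \<zeta> = \<xi>"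
    using Abs_ell2_inverse by blast
  have "X \<longlonglongrightarrow> \<zeta>"
  proof (rule LIMSEQ_I)
    fix r :: real assume r: "0 < r"
    then have h: "0 < r / 2" by simp
    obtain M where M: "\<forall>m\<ge>M. \<forall>n\<ge>M. norm (X m - X n) < r / 2"
      using CauchyD[OF X h] by blast
    have "norm (X m - \<zeta>) < r" if m: "m \<ge> M" for m
    proof -
      have "(\<Sum>\<^sub>\<infinity>p. (cmod (ell2_apply (X m - \<zeta>) p))\<^sup>2) \<le> (r / 2)\<^sup>2"
        by (rule infsum_le_finite_sums[OF sq_summable]) (use part[OF _ h M m] in \<open>simp add: \<zeta>\<close>)
      then have "norm (X m - \<zeta>) \<le> r / 2"
        unfolding norm_ell2_def using h by (intro real_le_lsqrt) (auto intro: infsum_nonneg)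
      then show ?thesis using r by simp
    qed
    then show "\<exists>M. \<forall>m\<ge>M. norm (X m - \<zeta>) < r" by blast
  qed
  then show "convergent X" by (rule convergentI)
qed

type_synonym 'i op = "'i ell2 \<Rightarrow>\<^sub>L 'i ell2"

definition is_adjoint :: "'i op \<Rightarrow> 'i op \<Rightarrow> bool" where
  "is_adjoint a b \<longleftrightarrow> (\<forall>\<xi> \<eta>. cinner (a \<xi>) \<eta> = cinner \<xi> (b \<eta>))"

lemma weighted_shift:
  assumes w: "\<And>p. cmod (w p) \<le> C" and \<tau>: "bij \<tau>"
  shows "\<exists>T :: 'i op. \<forall>\<xi> p. ell2_apply (T \<xi>) p = w p * ell2_apply \<xi> (\<tau> p)"
proof -
  have C: "0 \<le> C" using order_trans[OF norm_ge_zero w] .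
  have le: "(cmod (w p * ell2_apply \<xi> (\<tau> p)))\<^sup>2 \<le> C\<^sup>2 * (cmod (ell2_apply \<xi> (\<tau> p)))\<^sup>2" for \<xi> p
    unfolding norm_mult power_mult_distrib by (intro mult_right_mono power_mono w) auto
  have s: "(\<lambda>p. (cmod (ell2_apply \<xi> (\<tau> p)))\<^sup>2) summable_on UNIV" for \<xi>
    using summable_on_reindex_bij_betw[OF \<tau>, of "\<lambda>p. (cmod (ell2_apply \<xi> p))\<^sup>2"] sq_summable
    by blast
  have s': "(\<lambda>p. (cmod (w p * ell2_apply \<xi> (\<tau> p)))\<^sup>2) summable_on UNIV" for \<xi>
    by (rule summable_on_comparison_test[OF summable_on_cmult_right[OF s] le]) simp
  define T where "T \<xi> = Abs_ell2 (\<lambda>p. w p * ell2_apply \<xi> (\<tau> p))" for \<xi>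
  have T: "ell2_apply (T \<xi>) p = w p * ell2_apply \<xi> (\<tau> p)" for \<xi> p
    unfolding T_def using s' by (simp add: Abs_ell2_inverse)
  have "bounded_linear T"
  proof
    show "T (\<xi> + \<eta>) = T \<xi> + T \<eta>" for \<xi> \<eta>
      by (rule ell2_eqI) (simp add: T algebra_simps)
    show "T (r *\<^sub>R \<xi>) = r *\<^sub>R T \<xi>" for r \<xi>
      by (rule ell2_eqI) (simp add: T algebra_simps)
    have "norm (T \<xi>) \<le> norm \<xi> * C" for \<xi>
    proof -
      have "(\<Sum>\<^sub>\<infinity>p. (cmod (ell2_apply (T \<xi>) p))\<^sup>2) \<le>
          (\<Sum>\<^sub>\<infinity>p. C\<^sup>2 * (cmod (ell2_apply \<xi> (\<tau> p)))\<^sup>2)"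
        unfolding T by (rule infsum_mono[OF s' summable_on_cmult_right[OF s] le])
      also have "\<dots> = C\<^sup>2 * (\<Sum>\<^sub>\<infinity>p. (cmod (ell2_apply \<xi> (\<tau> p)))\<^sup>2)"
        by (rule infsum_cmult_right[OF s])
      also have "(\<Sum>\<^sub>\<infinity>p. (cmod (ell2_apply \<xi> (\<tau> p)))\<^sup>2) = (\<Sum>\<^sub>\<infinity>p. (cmod (ell2_apply \<xi> p))\<^sup>2)"
        by (rule infsum_reindex_bij_betw[OF \<tau>])
      finally have "norm (T \<xi>) \<le> sqrt (C\<^sup>2 * (\<Sum>\<^sub>\<infinity>p. (cmod (ell2_apply \<xi> p))\<^sup>2))"
        unfolding norm_ell2_def by (rule real_sqrt_le_mono)
      then show ?thesis using C by (simp add: real_sqrt_mult norm_ell2_def mult.commute)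
    qed
    then show "\<exists>K. \<forall>\<xi>. norm (T \<xi>) \<le> norm \<xi> * K" by blast
  qed
  then show ?thesis using T by (intro exI[of _ "Blinfun T"]) (simp add: bounded_linear_Blinfun_apply)
qed


section \<open>Quantum tori\<close>

text \<open>
  The lattice \<open>\<int>\<^sup>d\<close> is \<^typ>\<open>int^'d\<close>, with \<open>d = CARD('d)\<close>. The torus is the group of vectors of
  unimodular complex numbers under componentwise multiplication.
\<close>

definition skew_matrices :: "(real^'d^'d) set" where
  "skew_matrices = {\<theta>. transpose \<theta> = - \<theta>}"

definition torus :: "(complex^'d) monoid" where
  "torus = \<lparr>carrier = {x. \<forall>i. cmod (x $ i) = 1}, mult = (\<lambda>x y. \<chi> i. x $ i * y $ i), one = (\<chi> i. 1)\<rparr>"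

lemma comm_group_torus: "comm_group (torus :: (complex^'d) monoid)"
proof (rule comm_groupI)
  fix x :: "complex^'d" assume x: "x \<in> carrier torus"
  show "\<exists>y\<in>carrier torus. y \<otimes>\<^bsub>torus\<^esub> x = \<one>\<^bsub>torus\<^esub>"
  proof (intro bexI[of _ "\<chi> i. inverse (x $ i)"])
    have "x $ i \<noteq> 0" for i using x by (metis (mono_tags) mem_Collect_eq norm_zero partial_object.select_convs(1) torus_def zero_neq_one)
    then show "(\<chi> i. inverse (x $ i)) \<otimes>\<^bsub>torus\<^esub> x = \<one>\<^bsub>torus\<^esub>"
      by (simp add: torus_def vec_eq_iff)
  qed (use x in \<open>simp add: torus_def norm_inverse\<close>)
qed (auto simp: torus_def norm_mult vec_eq_iff)

definition length_function :: "('g, 'm) monoid_scheme \<Rightarrow> ('g \<Rightarrow> real) \<Rightarrow> bool" where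
  "length_function G len \<longleftrightarrow>
     (\<forall>x\<in>carrier G. 0 \<le> len x) \<and>
     (\<forall>x\<in>carrier G. \<forall>y\<in>carrier G. len (x \<otimes>\<^bsub>G\<^esub> y) \<le> len x + len y) \<and>
     (\<forall>x\<in>carrier G. len (inv\<^bsub>G\<^esub> x) = len x) \<and>
     (\<forall>x\<in>carrier G. len x = 0 \<longleftrightarrow> x = \<one>\<^bsub>G\<^esub>)"

definition pairing :: "int^'d \<Rightarrow> complex^'d \<Rightarrow> complex" where
  "pairing p x = (\<Prod>i\<in>UNIV. (x $ i) powi (p $ i))"

definition real_vec :: "int^'d \<Rightarrow> real^'d" where
  "real_vec p = (\<chi> i. real_of_int (p $ i))"

definition bichar :: "real^'d^'d \<Rightarrow> int^'d \<Rightarrow> int^'d \<Rightarrow> complex" where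
  "bichar \<theta> p q = exp (\<i> * of_real (pi * (real_vec p \<bullet> (\<theta> *v real_vec q))))"

definition Cc :: "(int^'d \<Rightarrow> complex) set" where
  "Cc = {f. finite {p. f p \<noteq> 0}}"

definition twisted_conv ::
    "real^'d^'d \<Rightarrow> (int^'d \<Rightarrow> complex) \<Rightarrow> (int^'d \<Rightarrow> complex) \<Rightarrow> int^'d \<Rightarrow> complex" where
  "twisted_conv \<theta> f g p = (\<Sum>q | f q \<noteq> 0. f q * g (p - q) * bichar \<theta> q p)"

definition star :: "(int^'d \<Rightarrow> complex) \<Rightarrow> int^'d \<Rightarrow> complex" where
  "star f p = cnj (f (- p))"

definition pi_rep :: "real^'d^'d \<Rightarrow> (int^'d \<Rightarrow> complex) \<Rightarrow> (int^'d) op" where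
  "pi_rep \<theta> f = Blinfun (\<lambda>\<xi>. Abs_ell2 (twisted_conv \<theta> f (ell2_apply \<xi>)))"

lemma cmod_bichar [simp]: "cmod (bichar \<theta> p q) = 1"
  by (simp add: bichar_def)

lemma pi_rep_apply:
  fixes \<theta> :: "real^'d^'d"
  shows "ell2_apply (pi_rep \<theta> f \<xi>) = twisted_conv \<theta> f (ell2_apply \<xi>)"
proof -
  have "\<exists>T :: (int^'d) op. \<forall>\<xi> p. ell2_apply (T \<xi>) p = (f q * bichar \<theta> q p) * ell2_apply \<xi> (p - q)"
    for q
  proof (rule weighted_shift)
    show "cmod (f q * bichar \<theta> q p) \<le> cmod (f q)" for p by (simp add: norm_mult)
    show "bij (\<lambda>p. p - q)" by (rule bijI') (auto intro: exI[of _ "_ + q"])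
  qed
  then obtain T :: "int^'d \<Rightarrow> (int^'d) op" where
    T: "ell2_apply (T q \<xi>) p = f q * bichar \<theta> q p * ell2_apply \<xi> (p - q)" for q \<xi> p
    by metis
  have "(\<lambda>\<xi>. Abs_ell2 (twisted_conv \<theta> f (ell2_apply \<xi>))) = blinfun_apply (\<Sum>q | f q \<noteq> 0. T q)"
  proof
    fix \<xi>
    have "twisted_conv \<theta> f (ell2_apply \<xi>) = ell2_apply ((\<Sum>q | f q \<noteq> 0. T q) \<xi>)"
      by (simp add: fun_eq_iff twisted_conv_def blinfun.sum_left T mult_ac)
    then show "Abs_ell2 (twisted_conv \<theta> f (ell2_apply \<xi>)) = (\<Sum>q | f q \<noteq> 0. T q) \<xi>"
      by (simp add: ell2_apply_inverse)
  qed
  then have "pi_rep \<theta> f = (\<Sum>q | f q \<noteq> 0. T q)"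
    by (simp add: pi_rep_def blinfun_apply_inverse)
  then show ?thesis
    by (simp add: fun_eq_iff twisted_conv_def blinfun.sum_left T mult_ac)
qed

text \<open>
  \<open>pi_rep \<theta>\<close> is an injective \<open>*\<close>-representation of \<open>Cc\<close> with the twisted product and involution,
  so that the norm of \<open>pi_rep \<theta> f\<close> is a norm on \<open>Cc\<close>.
\<close>

lemma bichar_add_left: "bichar \<theta> (p + q) r = bichar \<theta> p r * bichar \<theta> q r"
proof -
  have "real_vec (p + q) = real_vec p + real_vec q"
    by (simp add: real_vec_def vec_eq_iff)
  then show ?thesis
    by (simp add: bichar_def inner_add_left distrib_left exp_add)
qed

lemma bichar_add_right: "bichar \<theta> p (q + r) = bichar \<theta> p q * bichar \<theta> p r"
proof -
  have "real_vec (q + r) = real_vec q + real_vec r"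
    by (simp add: real_vec_def vec_eq_iff)
  then show ?thesis
    by (simp add: bichar_def inner_add_right distrib_left exp_add matrix_vector_right_distrib)
qed

lemma bichar_swap:
  assumes "\<theta> \<in> skew_matrices"
  shows "bichar \<theta> q p = cnj (bichar \<theta> p q)"
proof -
  have "real_vec q \<bullet> (\<theta> *v real_vec p) = (transpose \<theta> *v real_vec q) \<bullet> real_vec p"
    by (simp add: dot_lmul_matrix[symmetric])
  also have "transpose \<theta> *v real_vec q = - (\<theta> *v real_vec q)"
    using assms by (simp add: skew_matrices_def matrix_vector_mult_def vec_eq_iff sum_negf)
  finally have "real_vec q \<bullet> (\<theta> *v real_vec p) = - (real_vec p \<bullet> (\<theta> *v real_vec q))"
    by (simp add: inner_commute)
  then show ?thesis
    by (simp add: bichar_def exp_cnj)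
qed

lemma bichar_mult_swap:
  assumes "\<theta> \<in> skew_matrices"
  shows "bichar \<theta> p q * bichar \<theta> q p = 1"
proof -
  have "bichar \<theta> q p = cnj (bichar \<theta> p q)" by (rule bichar_swap[OF assms])
  then show ?thesis by (simp only: complex_norm_square[symmetric] cmod_bichar) simp
qed

lemma bichar_self:
  assumes "\<theta> \<in> skew_matrices"
  shows "bichar \<theta> p p = 1"
proof -
  have "real_vec p \<bullet> (\<theta> *v real_vec p) = (transpose \<theta> *v real_vec p) \<bullet> real_vec p"
    by (simp add: dot_lmul_matrix[symmetric])
  also have "transpose \<theta> *v real_vec p = - (\<theta> *v real_vec p)"
    using assms by (simp add: skew_matrices_def matrix_vector_mult_def vec_eq_iff sum_negf)
  finally have "real_vec p \<bullet> (\<theta> *v real_vec p) = 0"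
    by (simp add: inner_commute)
  then show ?thesis by (simp add: bichar_def)
qed

lemma bichar_minus_left: "bichar \<theta> (- p) q = cnj (bichar \<theta> p q)"
proof -
  have "real_vec (- p) = - real_vec p"
    by (simp add: real_vec_def vec_eq_iff)
  then show ?thesis
    by (simp add: bichar_def exp_cnj)
qed

lemma twisted_conv_superset:
  assumes "finite S" "{q. f q \<noteq> 0} \<subseteq> S"
  shows "twisted_conv \<theta> f g p = (\<Sum>q\<in>S. f q * g (p - q) * bichar \<theta> q p)"
  unfolding twisted_conv_def
proof (rule sum.mono_neutral_left[OF assms])
  show "\<forall>q\<in>S - {q. f q \<noteq> 0}. f q * g (p - q) * bichar \<theta> q p = 0"
  proof
    fix q assume "q \<in> S - {q. f q \<noteq> 0}"
    then have "f q = 0" by blast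
    then show "f q * g (p - q) * bichar \<theta> q p = 0" by (simp only: mult_zero_left)
  qed
qed

lemma twisted_conv_support:
  "{p. twisted_conv \<theta> f g p \<noteq> 0} \<subseteq> (\<lambda>(q, r). q + r) ` ({q. f q \<noteq> 0} \<times> {r. g r \<noteq> 0})"
proof
  fix p assume "p \<in> {p. twisted_conv \<theta> f g p \<noteq> 0}"
  then have "(\<Sum>q | f q \<noteq> 0. f q * g (p - q) * bichar \<theta> q p) \<noteq> 0"
    by (simp add: twisted_conv_def)
  then obtain q where "f q * g (p - q) * bichar \<theta> q p \<noteq> 0" "f q \<noteq> 0"
    by (rule sum.not_neutral_contains_not_neutral) blast
  then have "q \<in> {q. f q \<noteq> 0}" "p - q \<in> {r. g r \<noteq> 0}" by auto
  moreover have "p = q + (p - q)" by simp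
  ultimately show "p \<in> (\<lambda>(q, r). q + r) ` ({q. f q \<noteq> 0} \<times> {r. g r \<noteq> 0})"
    by (intro image_eqI[of _ _ "(q, p - q)"]) simp_all
qed

lemma twisted_conv_Cc: "f \<in> Cc \<Longrightarrow> g \<in> Cc \<Longrightarrow> twisted_conv \<theta> f g \<in> Cc"
  unfolding Cc_def using finite_subset[OF twisted_conv_support[of \<theta> f g]] by auto

lemma twisted_conv_assoc:
  assumes "\<theta> \<in> skew_matrices" "f \<in> Cc" "g \<in> Cc"
  shows "twisted_conv \<theta> (twisted_conv \<theta> f g) h = twisted_conv \<theta> f (twisted_conv \<theta> g h)"
proof
  fix p
  define F where "F = {q. f q \<noteq> 0}"
  define H where "H = {r. g r \<noteq> 0}"
  define S where "S = (\<lambda>(q, r). q + r) ` (F \<times> H)"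
  have fin: "finite F" "finite H" "finite S"
    using assms by (auto simp: F_def H_def S_def Cc_def)
  have "twisted_conv \<theta> (twisted_conv \<theta> f g) h p =
      (\<Sum>s\<in>S. twisted_conv \<theta> f g s * h (p - s) * bichar \<theta> s p)"
    using twisted_conv_support[of \<theta> f g] fin unfolding S_def F_def H_def
    by (intro twisted_conv_superset) auto
  also have "\<dots> = (\<Sum>s\<in>S. \<Sum>q\<in>F. f q * g (s - q) * bichar \<theta> q s * h (p - s) * bichar \<theta> s p)"
    unfolding twisted_conv_def F_def[symmetric] sum_distrib_right ..
  also have "\<dots> = (\<Sum>q\<in>F. \<Sum>s\<in>S. f q * g (s - q) * bichar \<theta> q s * h (p - s) * bichar \<theta> s p)"
    by (rule sum.swap)
  also have "\<dots> = (\<Sum>q\<in>F. \<Sum>r\<in>H. f q * (g r * h (p - q - r) * bichar \<theta> r (p - q)) * bichar \<theta> q p)"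
  proof (rule sum.cong[OF refl])
    fix q assume q: "q \<in> F"
    have "(\<Sum>s\<in>S. f q * g (s - q) * bichar \<theta> q s * h (p - s) * bichar \<theta> s p) =
        (\<Sum>s\<in>(+) q ` H. f q * g (s - q) * bichar \<theta> q s * h (p - s) * bichar \<theta> s p)"
    proof (rule sum.mono_neutral_right[OF fin(3)])
      show "(+) q ` H \<subseteq> S" using q by (auto simp: S_def)
      show "\<forall>s\<in>S - (+) q ` H. f q * g (s - q) * bichar \<theta> q s * h (p - s) * bichar \<theta> s p = 0"
      proof
        fix s assume s: "s \<in> S - (+) q ` H"
        have "s - q \<notin> H"
        proof
          assume "s - q \<in> H"
          then have "q + (s - q) \<in> (+) q ` H" by (rule imageI)
          then show False using s by simp
        qed
        then show "f q * g (s - q) * bichar \<theta> q s * h (p - s) * bichar \<theta> s p = 0"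
          by (simp add: H_def)
      qed
    qed
    also have "\<dots> = (\<Sum>r\<in>H. f q * g r * bichar \<theta> q (q + r) * h (p - (q + r)) * bichar \<theta> (q + r) p)"
      by (subst sum.reindex) auto
    also have "\<dots> = (\<Sum>r\<in>H. f q * (g r * h (p - q - r) * bichar \<theta> r (p - q)) * bichar \<theta> q p)"
    proof (rule sum.cong[OF refl])
      fix r
      have "bichar \<theta> r p = bichar \<theta> r (p - q) * bichar \<theta> r q"
        using bichar_add_right[of \<theta> r "p - q" q] by simp
      then have "bichar \<theta> q (q + r) * bichar \<theta> (q + r) p =
          bichar \<theta> q q * (bichar \<theta> q r * bichar \<theta> r q) * (bichar \<theta> r (p - q) * bichar \<theta> q p)"
        by (simp add: bichar_add_left bichar_add_right mult_ac)
      then have "bichar \<theta> q (q + r) * bichar \<theta> (q + r) p = bichar \<theta> r (p - q) * bichar \<theta> q p"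
        by (simp add: bichar_mult_swap[OF assms(1)] bichar_self[OF assms(1)])
      then show "f q * g r * bichar \<theta> q (q + r) * h (p - (q + r)) * bichar \<theta> (q + r) p =
          f q * (g r * h (p - q - r) * bichar \<theta> r (p - q)) * bichar \<theta> q p"
        by (simp add: diff_diff_add mult_ac)
    qed
    finally show "(\<Sum>s\<in>S. f q * g (s - q) * bichar \<theta> q s * h (p - s) * bichar \<theta> s p) =
        (\<Sum>r\<in>H. f q * (g r * h (p - q - r) * bichar \<theta> r (p - q)) * bichar \<theta> q p)" .
  qed
  also have "\<dots> = twisted_conv \<theta> f (twisted_conv \<theta> g h) p"
    unfolding twisted_conv_def F_def[symmetric] H_def[symmetric]
    by (simp add: sum_distrib_left sum_distrib_right)
  finally show "twisted_conv \<theta> (twisted_conv \<theta> f g) h p = twisted_conv \<theta> f (twisted_conv \<theta> g h) p" .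
qed

lemma pi_rep_twisted_conv:
  assumes "\<theta> \<in> skew_matrices" "f \<in> Cc" "g \<in> Cc"
  shows "pi_rep \<theta> (twisted_conv \<theta> f g) = pi_rep \<theta> f o\<^sub>L pi_rep \<theta> g"
  by (intro blinfun_eqI ell2_eqI) (simp add: pi_rep_apply twisted_conv_assoc[OF assms])

lemma infsum_finite_sum:
  fixes h :: "'a \<Rightarrow> 'b \<Rightarrow> complex"
  assumes "finite F" "\<And>q. (\<lambda>p. h p q) summable_on UNIV"
  shows "(\<Sum>\<^sub>\<infinity>p. \<Sum>q\<in>F. h p q) = (\<Sum>q\<in>F. \<Sum>\<^sub>\<infinity>p. h p q)"
proof (rule infsumI)
  show "((\<lambda>p. \<Sum>q\<in>F. h p q) has_sum (\<Sum>q\<in>F. \<Sum>\<^sub>\<infinity>p. h p q)) UNIV"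
    using assms(1)
  proof induction
    case (insert q F)
    then show ?case using has_sum_add[OF has_sum_infsum[OF assms(2)[of q]]] by simp
  qed simp
qed

lemma pi_rep_star:
  fixes \<theta> :: "real^'d^'d"
  assumes "\<theta> \<in> skew_matrices" "f \<in> Cc"
  shows "is_adjoint (pi_rep \<theta> f) (pi_rep \<theta> (star f))"
  unfolding is_adjoint_def
proof (intro allI)
  fix \<xi> \<eta> :: "(int^'d) ell2"
  define x where "x = ell2_apply \<xi>"
  define y where "y = ell2_apply \<eta>"
  define F where "F = {q. f q \<noteq> 0}"
  have fin: "finite F" using assms by (simp add: F_def Cc_def)
  have bij: "bij (\<lambda>p. p + q)" for q :: "int^'d"
    by (rule bijI') (auto intro: exI[of _ "_ - q"])
  have sm: "(\<lambda>p. f q * x (p - q) * bichar \<theta> q p * cnj (y p)) summable_on UNIV" for q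
  proof -
    have "twisted_conv \<theta> (\<lambda>r. if r = q then f q else 0) x p = f q * x (p - q) * bichar \<theta> q p" for p
    proof -
      have "twisted_conv \<theta> (\<lambda>r. if r = q then f q else 0) x p =
          (\<Sum>r\<in>{q}. (if r = q then f q else 0) * x (p - r) * bichar \<theta> r p)"
        by (rule twisted_conv_superset) (auto split: if_splits)
      then show ?thesis by simp
    qed
    then show ?thesis
      using cinner_summable[of "pi_rep \<theta> (\<lambda>r. if r = q then f q else 0) \<xi>" \<eta>]
      by (simp add: pi_rep_apply x_def y_def)
  qed
  have re: "f q * x p * bichar \<theta> q (p + q) * cnj (y (p + q)) =
      x p * cnj (star f (- q) * y (p - - q) * bichar \<theta> (- q) p)" for p q
    by (simp add: star_def bichar_minus_left bichar_add_right bichar_self[OF assms(1)])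
  have sm': "(\<lambda>p. x p * cnj (star f (- q) * y (p - - q) * bichar \<theta> (- q) p)) summable_on UNIV" for q
  proof -
    have "(\<lambda>p. f q * x (p + q - q) * bichar \<theta> q (p + q) * cnj (y (p + q))) summable_on UNIV"
      using summable_on_reindex_bij_betw[OF bij[of q],
        of "\<lambda>p. f q * x (p - q) * bichar \<theta> q p * cnj (y p)"] sm[of q] by blast
    then show ?thesis unfolding re[symmetric] add_diff_cancel_right' .
  qed
  have "cinner (pi_rep \<theta> f \<xi>) \<eta> = (\<Sum>\<^sub>\<infinity>p. \<Sum>q\<in>F. f q * x (p - q) * bichar \<theta> q p * cnj (y p))"
    unfolding cinner_def pi_rep_apply twisted_conv_def F_def[symmetric] sum_distrib_right
      x_def y_def ..
  also have "\<dots> = (\<Sum>q\<in>F. \<Sum>\<^sub>\<infinity>p. f q * x (p - q) * bichar \<theta> q p * cnj (y p))"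
    by (rule infsum_finite_sum[OF fin sm])
  also have "\<dots> = (\<Sum>q\<in>F. \<Sum>\<^sub>\<infinity>p. x p * cnj (star f (- q) * y (p - - q) * bichar \<theta> (- q) p))"
  proof (rule sum.cong[OF refl])
    fix q
    have "(\<Sum>\<^sub>\<infinity>p. f q * x (p - q) * bichar \<theta> q p * cnj (y p)) =
        (\<Sum>\<^sub>\<infinity>p. f q * x (p + q - q) * bichar \<theta> q (p + q) * cnj (y (p + q)))"
      by (rule infsum_reindex_bij_betw[OF bij, symmetric])
    then show "(\<Sum>\<^sub>\<infinity>p. f q * x (p - q) * bichar \<theta> q p * cnj (y p)) =
        (\<Sum>\<^sub>\<infinity>p. x p * cnj (star f (- q) * y (p - - q) * bichar \<theta> (- q) p))"
      unfolding re[symmetric] add_diff_cancel_right' .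
  qed
  also have "\<dots> = (\<Sum>\<^sub>\<infinity>p. \<Sum>q\<in>F. x p * cnj (star f (- q) * y (p - - q) * bichar \<theta> (- q) p))"
    by (rule infsum_finite_sum[OF fin sm', symmetric])
  also have "\<dots> = (\<Sum>\<^sub>\<infinity>p. x p * cnj (\<Sum>q\<in>uminus ` F. star f q * y (p - q) * bichar \<theta> q p))"
    by (simp add: sum.reindex sum_distrib_left)
  also have "\<dots> = (\<Sum>\<^sub>\<infinity>p. x p * cnj (twisted_conv \<theta> (star f) y p))"
  proof -
    have "twisted_conv \<theta> (star f) y p = (\<Sum>q\<in>uminus ` F. star f q * y (p - q) * bichar \<theta> q p)" for p
    proof (rule twisted_conv_superset)
      show "{q. star f q \<noteq> 0} \<subseteq> uminus ` F"
      proof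
        fix q assume "q \<in> {q. star f q \<noteq> 0}"
        then have "- q \<in> F" by (simp add: star_def F_def)
        then have "- (- q) \<in> uminus ` F" by (rule imageI)
        then show "q \<in> uminus ` F" by simp
      qed
    qed (simp add: fin)
    then show ?thesis by simp
  qed
  also have "\<dots> = cinner \<xi> (pi_rep \<theta> (star f) \<eta>)"
    unfolding cinner_def pi_rep_apply x_def y_def ..
  finally show "cinner (pi_rep \<theta> f \<xi>) \<eta> = cinner \<xi> (pi_rep \<theta> (star f) \<eta>)" .
qed

lemma inj_on_pi_rep:
  fixes \<theta> :: "real^'d^'d"
  assumes "\<theta> \<in> skew_matrices"
  shows "inj_on (pi_rep \<theta>) Cc"
proof (rule inj_onI)
  fix f g :: "int^'d \<Rightarrow> complex" assume fg: "f \<in> Cc" "g \<in> Cc" and eq: "pi_rep \<theta> f = pi_rep \<theta> g"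
  define \<delta> :: "int^'d \<Rightarrow> complex" where "\<delta> p = (if p = 0 then 1 else 0)" for p
  have "(\<lambda>p. (cmod (\<delta> p))\<^sup>2) summable_on {0}" by simp
  also have "?this \<longleftrightarrow> (\<lambda>p. (cmod (\<delta> p))\<^sup>2) summable_on UNIV"
    by (rule summable_on_cong_neutral) (auto simp: \<delta>_def)
  finally have "(\<lambda>p. (cmod (\<delta> p))\<^sup>2) summable_on UNIV" .
  then obtain \<xi> where \<xi>: "ell2_apply \<xi> = \<delta>" using Abs_ell2_inverse by blast
  have "ell2_apply (pi_rep \<theta> h \<xi>) p = h p" if "h \<in> Cc" for h p
  proof -
    have "twisted_conv \<theta> h \<delta> p = (\<Sum>q\<in>insert p {q. h q \<noteq> 0}. h q * \<delta> (p - q) * bichar \<theta> q p)"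
      using that by (intro twisted_conv_superset) (simp_all add: Cc_def subset_insertI)
    also have "\<dots> = (\<Sum>q\<in>insert p {q. h q \<noteq> 0}. if q = p then h p else 0)"
      by (intro sum.cong[OF refl]) (simp add: \<delta>_def bichar_self[OF assms])
    also have "\<dots> = h p"
    proof (subst sum.delta)
      show "finite (insert p {q. h q \<noteq> 0})" using that by (simp add: Cc_def)
    qed simp
    finally show ?thesis by (simp add: pi_rep_apply \<xi>)
  qed
  from this[OF fg(1)] this[OF fg(2)] show "f = g" unfolding eq by (intro ext) simp
qed

text \<open>
  The completion of \<open>Cc\<close> for the norm of \<open>pi_rep \<theta> f\<close>, realized as the norm closure of the image
  of the representation in the Banach space of bounded operators. Its product is composition and
  its involution the adjoint.
\<close>

definition Abar :: "real^'d^'d \<Rightarrow> (int^'d) op set" where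
  "Abar \<theta> = closure (pi_rep \<theta> ` Cc)"

text \<open>The positive cone \<open>{c\<^sup>* c | c \<in> Abar \<theta>}\<close>; adjoints of bounded operators are unique.\<close>

definition Abar_pos :: "real^'d^'d \<Rightarrow> (int^'d) op set" where
  "Abar_pos \<theta> = {a. \<exists>c\<in>Abar \<theta>. \<exists>c'. is_adjoint c c' \<and> a = c' o\<^sub>L c}"

definition dual_action_Cc :: "complex^'d \<Rightarrow> (int^'d \<Rightarrow> complex) \<Rightarrow> int^'d \<Rightarrow> complex" where
  "dual_action_Cc x f p = pairing p x * f p"

text \<open>
  The extension by continuity to \<open>Abar \<theta>\<close>; \<open>ex1_dual_action\<close> below shows that it exists and is
  unique.
\<close>

definition dual_action :: "real^'d^'d \<Rightarrow> complex^'d \<Rightarrow> (int^'d) op \<Rightarrow> (int^'d) op" where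
  "dual_action \<theta> x = (THE T. T \<in> extensional (Abar \<theta>) \<and> continuous_on (Abar \<theta>) T \<and>
     (\<forall>f\<in>Cc. T (pi_rep \<theta> f) = pi_rep \<theta> (dual_action_Cc x f)))"

lemma cmod_pairing: "x \<in> carrier torus \<Longrightarrow> cmod (pairing p x) = 1"
  by (simp add: pairing_def torus_def norm_power_int flip: prod_norm)

lemma pairing_diff:
  assumes "x \<in> carrier torus"
  shows "pairing p x * cnj (pairing (p - q) x) = pairing q x"
proof -
  have x: "x $ i \<noteq> 0" for i
    using assms by (auto simp: torus_def dest: spec[of _ i])
  have "pairing p x = pairing (p - q) x * pairing q x"
    unfolding pairing_def prod.distrib[symmetric]
    by (intro prod.cong) (auto simp: x simp flip: power_int_add)
  then show ?thesis
    using complex_norm_square[of "pairing (p - q) x"] cmod_pairing[OF assms, of "p - q"]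
    by (simp add: mult_ac)
qed

lemma ex1_dual_action:
  fixes x :: "complex^'d" and \<theta> :: "real^'d^'d"
  assumes "x \<in> carrier torus"
  shows "\<exists>!T. T \<in> extensional (Abar \<theta>) \<and> continuous_on (Abar \<theta>) T \<and>
     (\<forall>f\<in>Cc. T (pi_rep \<theta> f) = pi_rep \<theta> (dual_action_Cc x f))"
proof (rule ex_ex1I)
  have "\<exists>U :: (int^'d) op. \<forall>\<xi> p. ell2_apply (U \<xi>) p = pairing p x * ell2_apply \<xi> (id p)"
    by (rule weighted_shift[of _ 1]) (simp_all add: cmod_pairing[OF assms] bij_id[unfolded id_def])
  then obtain U :: "(int^'d) op" where
    U: "ell2_apply (U \<xi>) p = pairing p x * ell2_apply \<xi> p" for \<xi> p by auto
  have "\<exists>U :: (int^'d) op. \<forall>\<xi> p. ell2_apply (U \<xi>) p = cnj (pairing p x) * ell2_apply \<xi> (id p)"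
    by (rule weighted_shift[of _ 1]) (simp_all add: cmod_pairing[OF assms] bij_id[unfolded id_def])
  then obtain V :: "(int^'d) op" where
    V: "ell2_apply (V \<xi>) p = cnj (pairing p x) * ell2_apply \<xi> p" for \<xi> p by auto
  define K where "K = restrict (\<lambda>a. U o\<^sub>L (a o\<^sub>L V)) (Abar \<theta>)"
  have cont: "continuous_on (Abar \<theta>) (\<lambda>a. U o\<^sub>L (a o\<^sub>L V))"
    by (intro continuous_intros)
  have "continuous_on (Abar \<theta>) K"
    using cont by (rule continuous_on_eq) (simp add: K_def)
  moreover have "K (pi_rep \<theta> f) = pi_rep \<theta> (dual_action_Cc x f)" if "f \<in> Cc" for f
  proof -
    have "U o\<^sub>L (pi_rep \<theta> f o\<^sub>L V) = pi_rep \<theta> (dual_action_Cc x f)"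
    proof (intro blinfun_eqI ell2_eqI)
      fix \<xi> p
      have nz: "pairing q x \<noteq> 0" for q using cmod_pairing[OF assms, of q] by auto
      have "ell2_apply ((U o\<^sub>L (pi_rep \<theta> f o\<^sub>L V)) \<xi>) p =
          (\<Sum>q | f q \<noteq> 0. (pairing p x * cnj (pairing (p - q) x)) * f q * ell2_apply \<xi> (p - q) * bichar \<theta> q p)"
        by (simp add: U pi_rep_apply twisted_conv_def V sum_distrib_left mult_ac)
      then show "ell2_apply ((U o\<^sub>L (pi_rep \<theta> f o\<^sub>L V)) \<xi>) p =
          ell2_apply (pi_rep \<theta> (dual_action_Cc x f) \<xi>) p"
        unfolding pairing_diff[OF assms]
        by (simp add: pi_rep_apply twisted_conv_def dual_action_Cc_def nz)
    qed
    moreover have "pi_rep \<theta> f \<in> Abar \<theta>"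
      unfolding Abar_def by (rule subsetD[OF closure_subset imageI[OF that]])
    ultimately show ?thesis by (simp add: K_def)
  qed
  ultimately show "\<exists>T. T \<in> extensional (Abar \<theta>) \<and> continuous_on (Abar \<theta>) T \<and>
     (\<forall>f\<in>Cc. T (pi_rep \<theta> f) = pi_rep \<theta> (dual_action_Cc x f))"
    by (intro exI[of _ K]) (simp add: K_def)
next
  fix T T' assume T: "T \<in> extensional (Abar \<theta>) \<and> continuous_on (Abar \<theta>) T \<and>
     (\<forall>f\<in>Cc. T (pi_rep \<theta> f) = pi_rep \<theta> (dual_action_Cc x f))"
   and T': "T' \<in> extensional (Abar \<theta>) \<and> continuous_on (Abar \<theta>) T' \<and>
     (\<forall>f\<in>Cc. T' (pi_rep \<theta> f) = pi_rep \<theta> (dual_action_Cc x f))"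
  have "T a - T' a = 0" if "a \<in> Abar \<theta>" for a
  proof (rule continuous_constant_on_closure[of "pi_rep \<theta> ` Cc" "\<lambda>a. T a - T' a"])
    show "continuous_on (closure (pi_rep \<theta> ` Cc)) (\<lambda>a. T a - T' a)"
      using T T' unfolding Abar_def by (intro continuous_on_diff) auto
    show "T a - T' a = 0" if "a \<in> pi_rep \<theta> ` Cc" for a using T T' that by auto
    show "a \<in> closure (pi_rep \<theta> ` Cc)" using that by (simp add: Abar_def)
  qed
  then have "T a = T' a" if "a \<in> Abar \<theta>" for a using that by simp
  then show "T = T'"
    by (rule extensionalityI[OF conjunct1[OF T] conjunct1[OF T']])
qed

text \<open>
  The seminorm may be infinite on \<open>Abar \<theta>\<close>; it is finite on the carrier of \<open>qtorus\<close>, which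
  consists of self-adjoint elements only.
\<close>

definition qtorus_seminorm ::
    "(complex^'d \<Rightarrow> real) \<Rightarrow> real^'d^'d \<Rightarrow> (int^'d) op \<Rightarrow> ereal" where
  "qtorus_seminorm len \<theta> a =
     (SUP x\<in>carrier torus - {\<one>\<^bsub>torus\<^esub>}. ereal (norm (dual_action \<theta> x a - a) / len x))"

definition qtorus :: "(complex^'d \<Rightarrow> real) \<Rightarrow> real^'d^'d \<Rightarrow> (int^'d) op ou_space" where
  "qtorus len \<theta> = \<lparr>
     carrier = {a \<in> Abar \<theta>. is_adjoint a a \<and> qtorus_seminorm len \<theta> a < \<infinity>},
     ou_le = (\<lambda>a b. b - a \<in> Abar_pos \<theta>),
     ou_unit = id_blinfun\<rparr>"

definition qtorus_lip :: "(complex^'d \<Rightarrow> real) \<Rightarrow> real^'d^'d \<Rightarrow> (int^'d) op \<Rightarrow> real" where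
  "qtorus_lip len \<theta> a = real_of_ereal (qtorus_seminorm len \<theta> a)"

end

theory Submission
  imports Defs
begin

text \<open>
  Let \<open>\<Delta> = \<psi> - \<theta>\<close> and let \<open>h\<close> be a finitely supported real function on the lattice with
  \<open>\<Sum>h\<^sup>2 = 1\<close>. Multiplying Fourier coefficients by \<open>g r = \<Sum>\<^sub>s h s h (s - r) cnj (bichar \<Delta> r s)\<close> is a
  unital contraction from the quantum torus of \<open>\<theta>\<close> to that of \<open>\<psi>\<close> which commutes with the dual
  actions, because \<open>bichar \<Delta> p q * g (p - q)\<close> is a positive definite kernel. Going to \<open>\<psi>\<close> and back
  multiplies the coefficients by \<open>\<bar>g\<bar>\<^sup>2\<close>, the Fourier transform of a probability density on the
  torus; that density is concentrated near the identity as soon as \<open>\<bar>g\<bar>\<close> is close to 1 at the basis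
  vectors, which holds for the normalized indicator of a large box and small \<open>\<Delta>\<close>, uniformly in
  \<open>\<theta>\<close>. So both round trips are close to the identity relative to the Lip-norms, and these
  contractions give a bridge between the two quantum tori.
\<close>

subsection \<open>Lip-norms from precompactness and bounds on the quantum distance\<close>

text \<open>The obstacle is that the two tori are different operator algebras, and the identity on
  Fourier coefficients comes with no norm bound. In the point basis an element of the torus of
  \<theta> has the matrix \<open>fourier_coeff a (p - q) * bichar \<theta> p q\<close>, so passing
  to \<psi> is entrywise multiplication by \<open>bichar \<Delta> p q\<close>. The extra factor
  \<open>g (p - q)\<close> turns this kernel into a Gram matrix with diagonal
  \<open>\<Sum>h\<^sup>2 = 1\<close>, and such a Schur multiplier is a contraction. Finite support
  of \<open>g\<close> keeps everything elementary: the map is defined at once on all operators, and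
  integrals over the torus become finite averages over roots of unity. About the length function
  only continuity is known near the identity; bounding it by a small constant plus a multiple of the
  squared distance to the identity reduces its average to the frequencies 0 and the basis vectors,
  which is why only \<open>\<bar>g\<bar>\<close> at basis vectors matters. The case
  \<open>\<psi> = \<theta>\<close> has a second use: the round trip then approximates the identity
  by maps that see finitely many frequencies, and this yields both the kernel of the Lip-seminorm
  and the total boundedness of its unit ball modulo scalars.\<close>

definition order_norm :: "('a::real_vector, 'm) ou_space_scheme \<Rightarrow> ('a \<Rightarrow> real) \<Rightarrow> bool" where
  "order_norm A n \<longleftrightarrow> subspace (carrier A) \<and> ou_unit A \<in> carrier A \<and>
     seminorm_on (carrier A) n \<and> n (ou_unit A) = 1 \<and>
     (\<forall>a\<in>carrier A. \<forall>r. ou_le A (- (r *\<^sub>R ou_unit A)) a \<and> ou_le A a (r *\<^sub>R ou_unit A) \<longrightarrow> n a \<le> r) \<and>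
     (\<forall>a\<in>carrier A. \<forall>r>n a. ou_le A (- (r *\<^sub>R ou_unit A)) a \<and> ou_le A a (r *\<^sub>R ou_unit A))"

lemma seminorm_onD:
  assumes "seminorm_on V L"
  shows "a \<in> V \<Longrightarrow> 0 \<le> L a" "a \<in> V \<Longrightarrow> L (r *\<^sub>R a) = \<bar>r\<bar> * L a"
    "a \<in> V \<Longrightarrow> b \<in> V \<Longrightarrow> L (a + b) \<le> L a + L b"
  using assms by (auto simp: seminorm_on_def)

lemma seminorm_on_uminus: "seminorm_on V L \<Longrightarrow> a \<in> V \<Longrightarrow> L (- a) = L a"
  using seminorm_onD(2)[of V L a "- 1"] by simp

lemma seminorm_on_diff:
  assumes "seminorm_on V L" "subspace V" "a \<in> V" "b \<in> V"
  shows "L (a - b) \<le> L a + L b"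
  using seminorm_onD(3)[OF assms(1,3), of "- b"] assms seminorm_on_uminus[OF assms(1,4)]
  by (simp add: subspace_neg)

lemma seminorm_on_minus_commute:
  assumes "seminorm_on V L" "subspace V" "a \<in> V" "b \<in> V"
  shows "L (a - b) = L (b - a)"
  using seminorm_on_uminus[OF assms(1) subspace_diff[OF assms(2,3,4)]] by simp

lemma order_normD:
  assumes "order_norm A n"
  shows "subspace (carrier A)" "ou_unit A \<in> carrier A" "seminorm_on (carrier A) n" "n (ou_unit A) = 1"
    "a \<in> carrier A \<Longrightarrow> ou_le A (- (r *\<^sub>R ou_unit A)) a \<Longrightarrow> ou_le A a (r *\<^sub>R ou_unit A) \<Longrightarrow> n a \<le> r"
    "a \<in> carrier A \<Longrightarrow> n a < r \<Longrightarrow> ou_le A (- (r *\<^sub>R ou_unit A)) a"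
    "a \<in> carrier A \<Longrightarrow> n a < r \<Longrightarrow> ou_le A a (r *\<^sub>R ou_unit A)"
  using assms by (simp_all add: order_norm_def)

text \<open>The set in the infimum contains every \<open>r > n a\<close> and nothing below
  \<open>n a\<close>; whether it contains \<open>n a\<close> itself does not affect the
  infimum.\<close>

lemma ou_norm_eq:
  assumes "order_norm A n" "a \<in> carrier A"
  shows "ou_norm A a = n a"
proof -
  let ?S = "{r. ou_le A (- (r *\<^sub>R ou_unit A)) a \<and> ou_le A a (r *\<^sub>R ou_unit A)}"
  have l: "n a \<le> r" if "r \<in> ?S" for r
    using order_normD(5)[OF assms] that by blast
  have u: "r \<in> ?S" if "n a < r" for r
    using order_normD(6,7)[OF assms that] by blast
  have ne: "?S \<noteq> {}" using u[of "n a + 1"] by auto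
  have bdd: "bdd_below ?S" by (rule bdd_belowI[of _ "n a"]) (rule l)
  show ?thesis unfolding ou_norm_def
  proof (rule antisym)
    show "Inf ?S \<le> n a"
      by (rule field_le_epsilon, rule cInf_lower[OF _ bdd], rule u) simp
    show "n a \<le> Inf ?S" by (rule cInf_greatest[OF ne l])
  qed
qed

lemma linear_on_carrier:
  assumes "\<mu> \<in> states A"
  shows "a \<in> carrier A \<Longrightarrow> b \<in> carrier A \<Longrightarrow> \<mu> (a + b) = \<mu> a + \<mu> b"
    "a \<in> carrier A \<Longrightarrow> \<mu> (r *\<^sub>R a) = r * \<mu> a" "\<mu> (ou_unit A) = 1"
  using assms by (auto simp: states_def ou_dual_def)

lemma state_diff:
  assumes "\<mu> \<in> states A" "subspace (carrier A)" "a \<in> carrier A" "b \<in> carrier A"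
  shows "\<mu> (a - b) = \<mu> a - \<mu> b"
  using linear_on_carrier(1)[OF assms(1,3), of "(-1) *\<^sub>R b"] linear_on_carrier(2)[OF assms(1,4), of "-1"]
    assms by (simp add: subspace_neg)

lemma state_le:
  assumes A: "order_norm A n" and \<mu>: "\<mu> \<in> states A" and a: "a \<in> carrier A"
  shows "\<bar>\<mu> a\<bar> \<le> n a"
proof -
  note D = order_normD[OF A]
  let ?S = "{a \<in> carrier A. ou_norm A a \<le> 1}"
  obtain C where C: "\<And>a. a \<in> carrier A \<Longrightarrow> \<bar>\<mu> a\<bar> \<le> C * n a"
  proof -
    have "\<exists>C. \<forall>a\<in>carrier A. \<bar>\<mu> a\<bar> \<le> C * ou_norm A a"
      using \<mu> by (simp add: states_def ou_dual_def)
    then show thesis using that ou_norm_eq[OF A] by auto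
  qed
  \<comment> \<open>\<open>dual_norm\<close> is a supremum of reals, which bounds single values only
    if the set is bounded above; the constant of continuity provides that.\<close>
  have bdd: "bdd_above ((\<lambda>a. \<bar>\<mu> a\<bar>) ` ?S)"
  proof (rule bdd_aboveI2)
    fix b assume "b \<in> ?S"
    then have b: "b \<in> carrier A" "n b \<le> 1" using ou_norm_eq[OF A] by auto
    have "\<bar>\<mu> b\<bar> \<le> C * n b" by (rule C[OF b(1)])
    also have "\<dots> \<le> \<bar>C\<bar> * n b"
      using seminorm_onD(1)[OF D(3) b(1)] by (intro mult_right_mono) auto
    also have "\<dots> \<le> \<bar>C\<bar>" using b(2) by (simp add: mult_left_le)
    finally show "\<bar>\<mu> b\<bar> \<le> \<bar>C\<bar>" .
  qed
  have le1: "\<bar>\<mu> b\<bar> \<le> 1" if "b \<in> carrier A" "n b \<le> 1" for b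
  proof -
    have "\<bar>\<mu> b\<bar> \<le> dual_norm A \<mu>"
      unfolding dual_norm_def using that ou_norm_eq[OF A] by (intro cSUP_upper[OF _ bdd]) auto
    then show ?thesis using \<mu> by (simp add: states_def)
  qed
  show ?thesis
  proof (cases "n a = 0")
    \<comment> \<open>Normalizing is impossible here, but the constant \<open>C\<close> already
      forces \<open>\<mu> a = 0\<close>.\<close>
    case True then show ?thesis using C[OF a] by simp
  next
    case False
    then have p: "n a > 0" using seminorm_onD(1)[OF D(3) a] by simp
    have "\<bar>\<mu> ((1 / n a) *\<^sub>R a)\<bar> \<le> 1"
      using p a D(1) by (intro le1) (auto simp: subspace_scale seminorm_onD(2)[OF D(3) a])
    then show ?thesis using p linear_on_carrier(2)[OF \<mu> a, of "1 / n a"]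
      by (simp add: abs_mult divide_le_eq)
  qed
qed

text \<open>The bound by \<open>n\<close> makes the dual norm at most 1, and the unit, which has
  norm 1, attains it.\<close>

lemma statesI:
  assumes A: "order_norm A n" and ext: "\<mu> \<in> extensional (carrier A)"
    and add: "\<And>a b. a \<in> carrier A \<Longrightarrow> b \<in> carrier A \<Longrightarrow> \<mu> (a + b) = \<mu> a + \<mu> b"
    and scale: "\<And>a r. a \<in> carrier A \<Longrightarrow> \<mu> (r *\<^sub>R a) = r * \<mu> a"
    and le: "\<And>a. a \<in> carrier A \<Longrightarrow> \<bar>\<mu> a\<bar> \<le> n a" and one: "\<mu> (ou_unit A) = 1"
  shows "\<mu> \<in> states A"
proof -
  note D = order_normD[OF A]
  let ?S = "{a \<in> carrier A. ou_norm A a \<le> 1}"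
  have eS: "ou_unit A \<in> ?S" using D ou_norm_eq[OF A] by simp
  have "dual_norm A \<mu> = 1" unfolding dual_norm_def
  proof (rule cSup_eq_maximum)
    show "1 \<in> (\<lambda>a. \<bar>\<mu> a\<bar>) ` ?S" using eS one by force
    show "x \<le> 1" if "x \<in> (\<lambda>a. \<bar>\<mu> a\<bar>) ` ?S" for x
      using that le ou_norm_eq[OF A] by force
  qed
  moreover have "\<exists>C. \<forall>a\<in>carrier A. \<bar>\<mu> a\<bar> \<le> C * ou_norm A a"
    using le ou_norm_eq[OF A] by (intro exI[of _ 1]) auto
  ultimately show ?thesis
    using ext add scale one by (auto simp: states_def ou_dual_def)
qed

lemma order_norm_direct_sum:
  assumes A: "order_norm A nA" and B: "order_norm B nB"
  shows "order_norm (direct_sum A B) (\<lambda>(a, b). max (nA a) (nB b))"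
proof -
  note a = order_normD[OF A] and b = order_normD[OF B]
  note sa = seminorm_onD[OF a(3)] and sb = seminorm_onD[OF b(3)]
  have "seminorm_on (carrier A \<times> carrier B) (\<lambda>(a, b). max (nA a) (nB b))"
    unfolding seminorm_on_def
  proof (intro conjI ballI allI)
    show "(case r *\<^sub>R x of (a, b) \<Rightarrow> max (nA a) (nB b)) = \<bar>r\<bar> * (case x of (a, b) \<Rightarrow> max (nA a) (nB b))"
      if "x \<in> carrier A \<times> carrier B" for x r
      using that sa(2) sb(2) by (cases x) (simp add: max_def mult_le_cancel_left)
  next
    show "(case x + y of (a, b) \<Rightarrow> max (nA a) (nB b)) \<le>
        (case x of (a, b) \<Rightarrow> max (nA a) (nB b)) + (case y of (a, b) \<Rightarrow> max (nA a) (nB b))"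
      if "x \<in> carrier A \<times> carrier B" "y \<in> carrier A \<times> carrier B" for x y
      using that sa(3)[of "fst x" "fst y"] sb(3)[of "snd x" "snd y"] by (cases x; cases y) fastforce
  qed (use sa(1) sb(1) in \<open>auto intro: max.coboundedI1\<close>)
  then show ?thesis unfolding order_norm_def using a b
    by (auto simp: direct_sum_def subspace_Times)
qed

text \<open>The centres range over the whole carrier and not over the unit ball of \<open>L\<close>.
  This eases the construction of nets in a direct sum, where pairs of net points may violate the
  bridge inequality.\<close>

definition lip_precompact ::
    "('a::real_vector, 'm) ou_space_scheme \<Rightarrow> ('a \<Rightarrow> real) \<Rightarrow> ('a \<Rightarrow> real) \<Rightarrow> bool" where
  "lip_precompact A n L \<longleftrightarrow> (\<forall>\<eta>>0. \<exists>F. finite F \<and> F \<subseteq> carrier A \<and>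
     (\<forall>a\<in>carrier A. L a \<le> 1 \<longrightarrow> (\<exists>f\<in>F. \<exists>t. n (a - (f + t *\<^sub>R ou_unit A)) < \<eta>)))"

lemma openin_weak_star_ball:
  assumes "finite F" "F \<subseteq> carrier A" "\<mu> \<in> states A"
  shows "openin (weak_star A) {\<nu> \<in> states A. \<forall>f\<in>F. \<bar>\<mu> f - \<nu> f\<bar> < \<epsilon>}"
proof -
  let ?P = "product_topology (\<lambda>_. euclideanreal) (carrier A)"
  have "openin ?P {\<nu> \<in> topspace ?P. \<bar>\<mu> f - \<nu> f\<bar> < \<epsilon>}" if "f \<in> F" for f
  proof -
    have "continuous_map ?P euclideanreal (\<lambda>\<nu>. \<nu> f)"
      using that assms by (intro continuous_map_product_projection) auto
    then have "openin ?P {\<nu> \<in> topspace ?P. \<nu> f \<in> {\<mu> f - \<epsilon><..<\<mu> f + \<epsilon>}}"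
      by (rule openin_continuous_map_preimage) simp
    then show ?thesis by (simp add: abs_diff_less_iff abs_less_iff conj_ac algebra_simps)
  qed
  then have "openin ?P ((\<Inter>f\<in>F. {\<nu> \<in> topspace ?P. \<bar>\<mu> f - \<nu> f\<bar> < \<epsilon>}) \<inter> topspace ?P)"
    by (intro openin_INT assms(1))
  moreover have "states A \<subseteq> topspace ?P"
    by (auto simp: states_def ou_dual_def PiE_def)
  ultimately show ?thesis
    unfolding weak_star_def openin_subtopology by (intro exI conjI) (assumption, blast)
qed

text \<open>
  If \<open>{L \<le> 1}\<close> is totally bounded modulo scalars, finitely many elements control \<open>rho\<close> up to any
  given error, because states agree on scalars.
\<close>

lemma lip_normI:
  assumes A: "order_norm A n" and L: "seminorm_on (carrier A) L"
    and ker: "\<And>a. a \<in> carrier A \<Longrightarrow> L a = 0 \<longleftrightarrow> (\<exists>r. a = r *\<^sub>R ou_unit A)"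
    and pc: "lip_precompact A n L"
  shows "lip_norm A L"
proof -
  note D = order_normD[OF A]
  note sn = seminorm_onD[OF L]
  have rhoD: "\<bar>\<mu> a - \<nu> a\<bar> \<le> r * (L a + 1)"
    if st: "\<mu> \<in> states A" "\<nu> \<in> states A" and r: "rho A L \<mu> \<nu> < ereal r" and a: "a \<in> carrier A"
    for \<mu> \<nu> r a
  proof -
    \<comment> \<open>Dividing by \<open>L a + 1\<close> instead of \<open>L a\<close> also covers
      the scalars, where \<open>L a = 0\<close>.\<close>
    define c where "c = 1 / (L a + 1)"
    have c: "0 < c" using sn(1)[OF a] by (simp add: c_def)
    have ca: "c *\<^sub>R a \<in> carrier A" using D(1) a by (simp add: subspace_scale)
    have "L (c *\<^sub>R a) \<le> 1"
      using c sn(1)[OF a] by (simp add: sn(2)[OF a] c_def)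
    then have "ereal \<bar>\<mu> (c *\<^sub>R a) - \<nu> (c *\<^sub>R a)\<bar> \<le> rho A L \<mu> \<nu>"
      unfolding rho_def using ca by (intro SUP_upper) auto
    then have "ereal \<bar>\<mu> (c *\<^sub>R a) - \<nu> (c *\<^sub>R a)\<bar> < ereal r" using r by (rule le_less_trans)
    then have "\<bar>c * (\<mu> a - \<nu> a)\<bar> < r"
      by (simp add: linear_on_carrier(2)[OF st(1) a] linear_on_carrier(2)[OF st(2) a] right_diff_distrib)
    then show ?thesis using c sn(1)[OF a] by (simp add: abs_mult c_def field_simps)
  qed
  \<comment> \<open>A basic weak-star neighbourhood restricts finitely many coordinates, and the
    variation of each is bounded by a multiple of \<open>rho\<close>.\<close>
  have "openin (rho_topology A L) U" if U: "openin (weak_star A) U" for U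
  proof -
    obtain V where V: "openin (product_topology (\<lambda>_. euclideanreal) (carrier A)) V" "U = V \<inter> states A"
      using U by (auto simp: weak_star_def openin_subtopology)
    have "\<exists>r>0. \<forall>\<nu>\<in>states A. rho A L \<mu> \<nu> < ereal r \<longrightarrow> \<nu> \<in> U" if \<mu>: "\<mu> \<in> U" for \<mu>
    proof -
      obtain X where X: "finite {i \<in> carrier A. X i \<noteq> UNIV}" "\<And>i. i \<in> carrier A \<Longrightarrow> open (X i)"
        "\<mu> \<in> Pi\<^sub>E (carrier A) X" "Pi\<^sub>E (carrier A) X \<subseteq> V"
        using V \<mu> by (auto simp: openin_product_topology_alt)
      define F where "F = {i \<in> carrier A. X i \<noteq> UNIV}"
      have "\<exists>e>0. ball (\<mu> i) e \<subseteq> X i" if "i \<in> F" for i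
        using X that by (auto simp: F_def open_contains_ball PiE_def)
      then obtain e where e: "\<And>i. i \<in> F \<Longrightarrow> e i > 0 \<and> ball (\<mu> i) (e i) \<subseteq> X i" by metis
      define r where "r = Min (insert 1 ((\<lambda>i. e i / (L i + 1)) ` F))"
      have fin: "finite F" using X by (simp add: F_def)
      have FA: "i \<in> carrier A" if "i \<in> F" for i using that by (simp add: F_def)
      have pos: "0 < e i / (L i + 1)" if "i \<in> F" for i
        using sn(1)[OF FA[OF that]] e[OF that] by simp
      have r0: "0 < r" unfolding r_def using fin pos by (subst Min_gr_iff) auto
      have r1: "r * (L i + 1) \<le> e i" if "i \<in> F" for i
      proof -
        have "r \<le> e i / (L i + 1)" unfolding r_def using fin that by (intro Min_le) auto
        then show ?thesis using sn(1)[OF FA[OF that]] by (simp add: field_simps)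
      qed
      \<comment> \<open>\<open>rhoD\<close> ends in a non-strict inequality while the balls are
        open, hence half the radius.\<close>
      have r2: "0 < r / 2" "r / 2 < r" using r0 by auto
      show ?thesis
      proof (intro exI[of _ "r / 2"] conjI ballI impI r2)
        fix \<nu> assume \<nu>: "\<nu> \<in> states A" "rho A L \<mu> \<nu> < ereal (r / 2)"
        have ms: "\<mu> \<in> states A" using \<mu> V by simp
        have "\<nu> i \<in> X i" if i: "i \<in> carrier A" for i
        proof (cases "i \<in> F")
          case True
          have "\<bar>\<mu> i - \<nu> i\<bar> \<le> r / 2 * (L i + 1)" by (rule rhoD[OF ms \<nu> i])
          also have "\<dots> < r * (L i + 1)" using r2 sn(1)[OF i] by (intro mult_strict_right_mono) auto
          also have "\<dots> \<le> e i" by (rule r1[OF True])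
          finally have "\<nu> i \<in> ball (\<mu> i) (e i)" by (simp add: dist_real_def)
          then show ?thesis using e[OF True] by blast
        qed (use i in \<open>auto simp: F_def\<close>)
        moreover have "\<nu> \<in> extensional (carrier A)" using \<nu> by (simp add: states_def ou_dual_def)
        ultimately show "\<nu> \<in> U" using X(4) V \<nu> by (auto simp: PiE_def Pi_def)
      qed
    qed
    then show ?thesis using V by (auto simp: openin_rho_topology)
  qed
  moreover have "openin (weak_star A) U" if U: "openin (rho_topology A L) U" for U
  proof (subst openin_subopen, intro ballI)
    fix \<mu> assume \<mu>: "\<mu> \<in> U"
    have US: "U \<subseteq> states A" using U by (simp add: openin_rho_topology)
    obtain r where r: "r > 0" "\<And>\<nu>. \<nu> \<in> states A \<Longrightarrow> rho A L \<mu> \<nu> < ereal r \<Longrightarrow> \<nu> \<in> U"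
      using U \<mu> by (auto simp: openin_rho_topology)
    \<comment> \<open>Replacing \<open>a\<close> by a net point costs \<open>r / 6\<close> for each
      of the two states, and on the net they differ by less than \<open>r / 3\<close>. The total
      \<open>2 * r / 3\<close> is strictly below \<open>r\<close>.\<close>
    have "r / 6 > 0" using r by simp
    then obtain F where F: "finite F" "F \<subseteq> carrier A"
      and net: "\<And>a. a \<in> carrier A \<Longrightarrow> L a \<le> 1 \<Longrightarrow> \<exists>f\<in>F. \<exists>t. n (a - (f + t *\<^sub>R ou_unit A)) < r / 6"
      using pc unfolding lip_precompact_def by meson
    define W where "W = {\<nu> \<in> states A. \<forall>f\<in>F. \<bar>\<mu> f - \<nu> f\<bar> < r / 3}"
    have ms: "\<mu> \<in> states A" using \<mu> US by blast
    have "\<nu> \<in> U" if \<nu>: "\<nu> \<in> W" for \<nu>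
    proof (rule r(2))
      show ns: "\<nu> \<in> states A" using \<nu> by (simp add: W_def)
      have "rho A L \<mu> \<nu> \<le> ereal (2 * r / 3)" unfolding rho_def
      proof (rule SUP_least)
        fix a assume "a \<in> {a \<in> carrier A. L a \<le> 1}"
        then have a: "a \<in> carrier A" "L a \<le> 1" by auto
        obtain f t where f: "f \<in> F" "n (a - (f + t *\<^sub>R ou_unit A)) < r / 6" using net[OF a] by blast
        have fc: "f \<in> carrier A" using f F by blast
        have tc: "t *\<^sub>R ou_unit A \<in> carrier A" using D by (simp add: subspace_scale)
        have fac: "f + t *\<^sub>R ou_unit A \<in> carrier A" "a - (f + t *\<^sub>R ou_unit A) \<in> carrier A"
          using D(1) fc tc a by (auto simp: subspace_add subspace_diff)
        have s: "\<bar>\<omega> a - \<omega> f - t\<bar> < r / 6" if \<omega>: "\<omega> \<in> states A" for \<omega>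
          using state_le[OF A \<omega> fac(2)] f(2)
          by (simp add: state_diff[OF \<omega> D(1) a(1) fac(1)] linear_on_carrier(1)[OF \<omega> fc tc]
              linear_on_carrier(2)[OF \<omega> D(2)] linear_on_carrier(3)[OF \<omega>] diff_diff_eq)
        have "\<bar>\<mu> f - \<nu> f\<bar> < r / 3" using \<nu> f by (simp add: W_def)
        then have "\<bar>\<mu> a - \<nu> a\<bar> \<le> 2 * r / 3" using s[OF ms] s[OF ns] by linarith
        then show "ereal \<bar>\<mu> a - \<nu> a\<bar> \<le> ereal (2 * r / 3)" by simp
      qed
      also have "\<dots> < ereal r" using r by simp
      finally show "rho A L \<mu> \<nu> < ereal r" .
    qed
    moreover have "\<mu> \<in> W" using ms r by (simp add: W_def)
    moreover have "openin (weak_star A) W" unfolding W_def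
      by (rule openin_weak_star_ball[OF F ms])
    ultimately show "\<exists>T. openin (weak_star A) T \<and> \<mu> \<in> T \<and> T \<subseteq> U" by blast
  qed
  ultimately have "rho_topology A L = weak_star A" by (metis topology_eq)
  then show ?thesis using L ker by (simp add: lip_norm_def)
qed

text \<open>Linearity, unitality and the norm bound pull states back to states, since
  \<open>states\<close> is phrased by norm and value at the unit. The last clause makes the bridge
  induce the given seminorms.\<close>

definition lip_contraction ::
    "('a::real_vector, 'm) ou_space_scheme \<Rightarrow> ('a \<Rightarrow> real) \<Rightarrow> ('a \<Rightarrow> real) \<Rightarrow>
     ('b::real_vector, 'n) ou_space_scheme \<Rightarrow> ('b \<Rightarrow> real) \<Rightarrow> ('b \<Rightarrow> real) \<Rightarrow> ('a \<Rightarrow> 'b) \<Rightarrow> bool" where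
  "lip_contraction A nA LA B nB LB \<Phi> \<longleftrightarrow> (\<forall>a\<in>carrier A. \<Phi> a \<in> carrier B) \<and>
     (\<forall>a\<in>carrier A. \<forall>b\<in>carrier A. \<Phi> (a + b) = \<Phi> a + \<Phi> b) \<and>
     (\<forall>a\<in>carrier A. \<forall>r. \<Phi> (r *\<^sub>R a) = r *\<^sub>R \<Phi> a) \<and> \<Phi> (ou_unit A) = ou_unit B \<and>
     (\<forall>a\<in>carrier A. nB (\<Phi> a) \<le> nA a) \<and> (\<forall>a\<in>carrier A. LB (\<Phi> a) \<le> LA a)"

lemma lip_contractionD:
  assumes "lip_contraction A nA LA B nB LB \<Phi>"
  shows "a \<in> carrier A \<Longrightarrow> \<Phi> a \<in> carrier B"
    "a \<in> carrier A \<Longrightarrow> b \<in> carrier A \<Longrightarrow> \<Phi> (a + b) = \<Phi> a + \<Phi> b"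
    "a \<in> carrier A \<Longrightarrow> \<Phi> (r *\<^sub>R a) = r *\<^sub>R \<Phi> a" "\<Phi> (ou_unit A) = ou_unit B"
    "a \<in> carrier A \<Longrightarrow> nB (\<Phi> a) \<le> nA a" "a \<in> carrier A \<Longrightarrow> LB (\<Phi> a) \<le> LA a"
  using assms by (simp_all add: lip_contraction_def)

lemma state_comp_lip_contraction:
  assumes A: "order_norm A nA" and B: "order_norm B nB"
    and \<Phi>: "lip_contraction A nA LA B nB LB \<Phi>" and \<nu>: "\<nu> \<in> states B"
  shows "restrict (\<nu> \<circ> \<Phi>) (carrier A) \<in> states A"
proof (rule statesI[OF A])
  note D = order_normD[OF A] and F = lip_contractionD[OF \<Phi>] and N = linear_on_carrier[OF \<nu>]
  show "restrict (\<nu> \<circ> \<Phi>) (carrier A) (a + b) =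
      restrict (\<nu> \<circ> \<Phi>) (carrier A) a + restrict (\<nu> \<circ> \<Phi>) (carrier A) b"
    if "a \<in> carrier A" "b \<in> carrier A" for a b
    using that D(1) by (simp add: subspace_add F N)
  show "restrict (\<nu> \<circ> \<Phi>) (carrier A) (r *\<^sub>R a) = r * restrict (\<nu> \<circ> \<Phi>) (carrier A) a"
    if "a \<in> carrier A" for a r
    using that D(1) by (simp add: subspace_scale F N)
  show "\<bar>restrict (\<nu> \<circ> \<Phi>) (carrier A) a\<bar> \<le> nA a" if "a \<in> carrier A" for a
    using that order_trans[OF state_le[OF B \<nu> F(1)] F(5)] by simp
qed (use order_normD[OF A] lip_contractionD[OF \<Phi>] linear_on_carrier[OF \<nu>] in simp_all)

lemma seminorm_on_max:
  assumes "seminorm_on V L" "seminorm_on V M"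
  shows "seminorm_on V (\<lambda>a. max (L a) (M a))"
  unfolding seminorm_on_def
proof (intro conjI ballI allI)
  show "max (L (r *\<^sub>R a)) (M (r *\<^sub>R a)) = \<bar>r\<bar> * max (L a) (M a)" if "a \<in> V" for a r
    using that seminorm_onD(2)[OF assms(1)] seminorm_onD(2)[OF assms(2)]
    by (simp add: max_def mult_le_cancel_left)
  show "max (L (a + b)) (M (a + b)) \<le> max (L a) (M a) + max (L b) (M b)"
    if "a \<in> V" "b \<in> V" for a b
    using seminorm_onD(3)[OF assms(1) that] seminorm_onD(3)[OF assms(2) that] by fastforce
qed (use seminorm_onD(1)[OF assms(1)] in \<open>auto intro: max.coboundedI1\<close>)

lemma seminorm_on_comp:
  assumes "seminorm_on V L" "\<And>x. x \<in> W \<Longrightarrow> T x \<in> V"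
    "\<And>x y. x \<in> W \<Longrightarrow> y \<in> W \<Longrightarrow> T (x + y) = T x + T y"
    "\<And>x r. x \<in> W \<Longrightarrow> T (r *\<^sub>R x) = r *\<^sub>R T x" "0 \<le> c"
  shows "seminorm_on W (\<lambda>x. c * L (T x))"
  unfolding seminorm_on_def
  using assms(2-5) seminorm_onD[OF assms(1)]
  by (auto simp: mult_left_mono simp flip: distrib_left)

lemma ereal_SUP_abs_le:
  "(\<And>x. x \<in> X \<Longrightarrow> \<bar>f x\<bar> \<le> C) \<Longrightarrow> (SUP x\<in>X. ereal \<bar>f x\<bar>) \<le> ereal C"
  by (rule SUP_least) simp

text \<open>
  The Lip-norm on the direct sum is the maximum of the two given ones and the bridge
  \<open>max (nA (a - \<Psi> b)) (nB (b - \<Phi> a)) / e\<close>; states are moved across by composition with \<open>\<Phi>\<close> and \<open>\<Psi>\<close>.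
\<close>

lemma dist_q_le:
  assumes A: "order_norm A nA" and B: "order_norm B nB"
    and LA: "seminorm_on (carrier A) LA" and LB: "seminorm_on (carrier B) LB"
    and kA: "\<And>a. a \<in> carrier A \<Longrightarrow> LA a = 0 \<longleftrightarrow> (\<exists>r. a = r *\<^sub>R ou_unit A)"
    and kB: "\<And>b. b \<in> carrier B \<Longrightarrow> LB b = 0 \<longleftrightarrow> (\<exists>r. b = r *\<^sub>R ou_unit B)"
    and pA: "lip_precompact A nA LA" and pB: "lip_precompact B nB LB"
    and \<Phi>: "lip_contraction A nA LA B nB LB \<Phi>" and \<Psi>: "lip_contraction B nB LB A nA LA \<Psi>"
    and e: "0 < e"
    and \<Psi>\<Phi>: "\<And>a. a \<in> carrier A \<Longrightarrow> nA (a - \<Psi> (\<Phi> a)) \<le> e * LA a"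
    and \<Phi>\<Psi>: "\<And>b. b \<in> carrier B \<Longrightarrow> nB (b - \<Phi> (\<Psi> b)) \<le> e * LB b"
  shows "dist_q A LA B LB \<le> ereal (2 * e)"
proof -
  note DA = order_normD[OF A] and DB = order_normD[OF B]
  note sA = seminorm_onD[OF LA] and sB = seminorm_onD[OF LB]
  note nA = seminorm_onD[OF DA(3)] and nB = seminorm_onD[OF DB(3)]
  note F = lip_contractionD[OF \<Phi>] and G = lip_contractionD[OF \<Psi>]
  let ?S = "direct_sum A B"
  have cS: "carrier ?S = carrier A \<times> carrier B" and uS: "ou_unit ?S = (ou_unit A, ou_unit B)"
    by (simp_all add: direct_sum_def)
  note S = order_norm_direct_sum[OF A B]
  define gap where "gap = (\<lambda>x. max (nA (fst x - \<Psi> (snd x))) (nB (snd x - \<Phi> (fst x))))"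
  define L where "L x = max (max (LA (fst x)) (LB (snd x))) (1 / e * gap x)" for x
  have sL: "seminorm_on (carrier ?S) L"
  proof -
    have "seminorm_on (carrier ?S) (\<lambda>x. 1 * LA (fst x))"
      by (rule seminorm_on_comp[OF LA]) (auto simp: cS)
    moreover have "seminorm_on (carrier ?S) (\<lambda>x. 1 * LB (snd x))"
      by (rule seminorm_on_comp[OF LB]) (auto simp: cS)
    moreover have "seminorm_on (carrier ?S) (\<lambda>x. 1 * nA (fst x - \<Psi> (snd x)))"
      by (rule seminorm_on_comp[OF DA(3)]) (auto simp: cS G subspace_diff[OF DA(1)] scaleR_diff_right)
    moreover have "seminorm_on (carrier ?S) (\<lambda>x. 1 * nB (snd x - \<Phi> (fst x)))"
      by (rule seminorm_on_comp[OF DB(3)]) (auto simp: cS F subspace_diff[OF DB(1)] scaleR_diff_right)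
    ultimately have p: "seminorm_on (carrier ?S) (\<lambda>x. max (LA (fst x)) (LB (snd x)))"
      "seminorm_on (carrier ?S) gap"
      unfolding gap_def by (simp_all add: seminorm_on_max)
    have "seminorm_on (carrier ?S) (\<lambda>x. 1 / e * gap (id x))"
      by (rule seminorm_on_comp[OF p(2)]) (use e in auto)
    then have "seminorm_on (carrier ?S) (\<lambda>x. 1 / e * gap x)" by simp
    then show ?thesis unfolding L_def by (intro seminorm_on_max p)
  qed
  have LD: "LA a \<le> L (a, b)" "LB b \<le> L (a, b)" "nA (a - \<Psi> b) \<le> e * L (a, b)"
    "nB (b - \<Phi> a) \<le> e * L (a, b)" for a b
  proof -
    have "gap (a, b) / e \<le> L (a, b)" by (simp add: L_def)
    then have "gap (a, b) \<le> e * L (a, b)" using e by (simp add: field_simps)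
    then show "nA (a - \<Psi> b) \<le> e * L (a, b)" "nB (b - \<Phi> a) \<le> e * L (a, b)" by (simp_all add: gap_def)
  qed (simp_all add: L_def)
  have LI: "L (a, b) \<le> C" if "LA a \<le> C" "LB b \<le> C" "nA (a - \<Psi> b) \<le> e * C" "nB (b - \<Phi> a) \<le> e * C"
    for a b C using that e by (simp add: L_def gap_def field_simps)
  have ker: "L x = 0 \<longleftrightarrow> (\<exists>r. x = r *\<^sub>R ou_unit ?S)" if x: "x \<in> carrier ?S" for x
  proof
    obtain a b where ab: "x = (a, b)" "a \<in> carrier A" "b \<in> carrier B" using x by (auto simp: cS)
    assume L0: "L x = 0"
    then have "LA a = 0" "LB b = 0" using LD(1)[of a b] LD(2)[of b a] sA(1)[OF ab(2)] sB(1)[OF ab(3)] by (simp_all add: ab(1))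
    then obtain s t where st: "a = s *\<^sub>R ou_unit A" "b = t *\<^sub>R ou_unit B" using kA kB ab by blast
    \<comment> \<open>As \<Phi> is unital, \<open>b - \<Phi> a\<close> is \<open>t - s\<close> times
      the unit, so a vanishing bridge identifies the two scalars.\<close>
    have "\<bar>t - s\<bar> = nB (b - \<Phi> a)"
      using nB(2)[OF DB(2), of "t - s"] by (simp add: st F DA DB scaleR_diff_left)
    then have "\<bar>t - s\<bar> \<le> 0" using LD(4)[of b a] L0 ab(1) by simp
    then show "\<exists>r. x = r *\<^sub>R ou_unit ?S" by (intro exI[of _ s]) (simp add: ab(1) st uS)
  next
    assume "\<exists>r. x = r *\<^sub>R ou_unit ?S"
    then obtain r where r: "x = (r *\<^sub>R ou_unit A, r *\<^sub>R ou_unit B)" by (auto simp: uS)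
    have c: "r *\<^sub>R ou_unit A \<in> carrier A" "r *\<^sub>R ou_unit B \<in> carrier B"
      using DA DB by (simp_all add: subspace_scale)
    have "nA 0 = 0" "nB 0 = 0" using nA(2)[OF DA(2), of 0] nB(2)[OF DB(2), of 0] by simp_all
    moreover have "LA (r *\<^sub>R ou_unit A) = 0" "LB (r *\<^sub>R ou_unit B) = 0" using kA[OF c(1)] kB[OF c(2)] by auto
    ultimately have "L x \<le> 0" unfolding r by (intro LI) (simp_all add: F G DA DB)
    then show "L x = 0" using seminorm_onD(1)[OF sL x] by simp
  qed
  have pS: "lip_precompact ?S (\<lambda>(a, b). max (nA a) (nB b)) L"
    unfolding lip_precompact_def
  proof (intro allI impI)
    fix \<eta> :: real assume \<eta>: "\<eta> > 0"
    then have h: "\<eta> / 2 > 0" by simp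
    obtain X where X: "finite X" "X \<subseteq> carrier A"
      and Xn: "\<And>a. a \<in> carrier A \<Longrightarrow> LA a \<le> 1 \<Longrightarrow> \<exists>f\<in>X. \<exists>t. nA (a - (f + t *\<^sub>R ou_unit A)) < \<eta> / 2"
      using pA h unfolding lip_precompact_def by meson
    obtain Y where Y: "finite Y" "Y \<subseteq> carrier B"
      and Yn: "\<And>b. b \<in> carrier B \<Longrightarrow> LB b \<le> 1 \<Longrightarrow> \<exists>g\<in>Y. \<exists>t. nB (b - (g + t *\<^sub>R ou_unit B)) < \<eta> / 2"
      using pB h unfolding lip_precompact_def by meson
    \<comment> \<open>The nets of \<open>A\<close> and \<open>B\<close> come with independent
      scalars \<open>s\<close> and \<open>t\<close>, while the direct sum offers only one. The
      bridge confines \<open>s - t\<close> to a bounded interval, and a finite grid \<open>T\<close>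
      of it is absorbed into the net. \<open>R\<close> adds up the bridge bound \<open>e\<close>,
      two net errors \<open>\<eta> / 2\<close> and the gaps \<open>g - \<Phi> f\<close> between net
      points.\<close>
    define R where "R = e + \<eta> + (\<Sum>f\<in>X. \<Sum>g\<in>Y. nB (g - \<Phi> f))"
    have "compact {-R..R}" by simp
    then obtain T where T: "finite T" "{-R..R} \<subseteq> (\<Union>t\<in>T. ball t (\<eta> / 2))"
      using h unfolding compact_eq_totally_bounded by blast
    define Z where "Z = (\<lambda>(f, g, t). (f + t *\<^sub>R ou_unit A, g)) ` (X \<times> Y \<times> T)"
    have "finite Z" using X Y T by (simp add: Z_def)
    moreover have "Z \<subseteq> carrier ?S"
      using X Y DA by (auto simp: Z_def cS intro!: subspace_add subspace_scale)
    moreover have "\<exists>f\<in>Z. \<exists>t. (\<lambda>(a, b). max (nA a) (nB b)) (x - (f + t *\<^sub>R ou_unit ?S)) < \<eta>"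
      if x: "x \<in> carrier ?S" and L1: "L x \<le> 1" for x
    proof -
      obtain a b where ab: "x = (a, b)" "a \<in> carrier A" "b \<in> carrier B" using x by (auto simp: cS)
      have ab1: "LA a \<le> 1" "LB b \<le> 1" using LD(1)[of a b] LD(2)[of b a] L1 ab(1) by auto
      obtain f s where f: "f \<in> X" "nA (a - (f + s *\<^sub>R ou_unit A)) < \<eta> / 2" using Xn ab ab1 by blast
      obtain g t where g: "g \<in> Y" "nB (b - (g + t *\<^sub>R ou_unit B)) < \<eta> / 2" using Yn ab ab1 by blast
      have c: "f \<in> carrier A" "g \<in> carrier B" "\<And>r. r *\<^sub>R ou_unit A \<in> carrier A" "\<And>r. r *\<^sub>R ou_unit B \<in> carrier B"
        using f g X Y DA DB by (auto simp: subspace_scale)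
      note cl = subspace_add[OF DA(1)] subspace_diff[OF DA(1)] subspace_add[OF DB(1)] subspace_diff[OF DB(1)] F(1)
      have "\<bar>s - t\<bar> = nB ((s - t) *\<^sub>R ou_unit B)" using nB(2)[OF DB(2)] DB(4) by simp
      also have "(s - t) *\<^sub>R ou_unit B = (b - (g + t *\<^sub>R ou_unit B)) + ((\<Phi> (f + s *\<^sub>R ou_unit A) - \<Phi> a) + ((g - \<Phi> f) - (b - \<Phi> a)))"
        using c DA by (simp add: F scaleR_diff_left algebra_simps)
      also have "nB \<dots> \<le> nB (b - (g + t *\<^sub>R ou_unit B)) + (nB (\<Phi> (f + s *\<^sub>R ou_unit A) - \<Phi> a) + (nB (g - \<Phi> f) + nB (b - \<Phi> a)))"
        using c ab by (intro order_trans[OF nB(3)] add_mono order_refl seminorm_on_diff[OF DB(3,1)] cl) auto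
      also have "nB (\<Phi> (f + s *\<^sub>R ou_unit A) - \<Phi> a) = nB (\<Phi> (a - (f + s *\<^sub>R ou_unit A)))"
      proof -
        have "\<Phi> a = \<Phi> (a - (f + s *\<^sub>R ou_unit A)) + \<Phi> (f + s *\<^sub>R ou_unit A)"
          using F(2)[of "a - (f + s *\<^sub>R ou_unit A)" "f + s *\<^sub>R ou_unit A"] c ab cl by simp
        then show ?thesis using seminorm_on_minus_commute[OF DB(3,1)] c ab cl by (metis add_diff_cancel_right')
      qed
      also have "\<dots> \<le> nA (a - (f + s *\<^sub>R ou_unit A))" using c ab by (intro F(5) cl)
      also have "nB (b - \<Phi> a) \<le> e" using LD(4)[of b a] L1 e ab(1) by (simp add: mult_left_le order_trans)
      also have "nB (g - \<Phi> f) \<le> (\<Sum>f\<in>X. \<Sum>g\<in>Y. nB (g - \<Phi> f))"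
      proof -
        have nn: "0 \<le> nB (g' - \<Phi> f')" if "f' \<in> X" "g' \<in> Y" for f' g'
          using that X Y by (intro nB(1) cl) auto
        have "nB (g - \<Phi> f) \<le> (\<Sum>g\<in>Y. nB (g - \<Phi> f))"
          using f g Y nn by (intro member_le_sum) auto
        also have "\<dots> \<le> (\<Sum>f\<in>X. \<Sum>g\<in>Y. nB (g - \<Phi> f))"
          using f nn X by (intro member_le_sum[of f X "\<lambda>f. \<Sum>g\<in>Y. nB (g - \<Phi> f)"]) (auto intro: sum_nonneg)
        finally show ?thesis .
      qed
      finally have "\<bar>s - t\<bar> \<le> R" using f g by (simp add: R_def)
      then have "s - t \<in> {-R..R}" by auto
      then obtain u where u: "u \<in> T" "\<bar>s - t - u\<bar> < \<eta> / 2" using T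
        by (fastforce simp: dist_real_def abs_minus_commute)
      \<comment> \<open>The shift by \<open>t\<close> is common to both components; \<open>u\<close>
        corrects the first one, as \<open>s\<close> is within \<open>\<eta> / 2\<close> of
        \<open>u + t\<close>.\<close>
      have "(f + u *\<^sub>R ou_unit A, g) \<in> Z" using f g u unfolding Z_def by (intro image_eqI[where x = "(f, g, u)"]) auto
      moreover have "nA (a - (f + (u + t) *\<^sub>R ou_unit A)) < \<eta>"
      proof -
        have "a - (f + (u + t) *\<^sub>R ou_unit A) = (a - (f + s *\<^sub>R ou_unit A)) + (s - t - u) *\<^sub>R ou_unit A"
          by (simp add: algebra_simps)
        also have "nA \<dots> \<le> nA (a - (f + s *\<^sub>R ou_unit A)) + nA ((s - t - u) *\<^sub>R ou_unit A)"
          using c ab by (intro nA(3) cl) auto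
        also have "\<dots> < \<eta>" using f u nA(2)[OF DA(2)] DA(4) by simp
        finally show ?thesis .
      qed
      ultimately show ?thesis
        using g \<eta> by (intro bexI[of _ "(f + u *\<^sub>R ou_unit A, g)"] exI[of _ t])
          (auto simp: ab(1) uS scaleR_add_left add.assoc)
    qed
    ultimately show "\<exists>F. finite F \<and> F \<subseteq> carrier ?S \<and> (\<forall>a\<in>carrier ?S. L a \<le> 1 \<longrightarrow>
        (\<exists>f\<in>F. \<exists>t. (\<lambda>(a, b). max (nA a) (nB b)) (a - (f + t *\<^sub>R ou_unit ?S)) < \<eta>))" by blast
  qed
  \<comment> \<open>\<open>hausdorff_dist\<close> compares strictly, so the bound \<open>e\<close>
    is weakened to \<open>2 * e\<close>.\<close>
  have rho_le: "rho ?S L (restrict (\<mu> \<circ> fst) (carrier ?S)) (restrict (\<nu> \<circ> snd) (carrier ?S)) < ereal (2 * e)"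
    if "\<And>a b. a \<in> carrier A \<Longrightarrow> b \<in> carrier B \<Longrightarrow> L (a, b) \<le> 1 \<Longrightarrow> \<bar>\<mu> a - \<nu> b\<bar> \<le> e" for \<mu> \<nu>
  proof -
    have "rho ?S L (restrict (\<mu> \<circ> fst) (carrier ?S)) (restrict (\<nu> \<circ> snd) (carrier ?S)) \<le> ereal e"
      unfolding rho_def by (rule ereal_SUP_abs_le) (use that in \<open>auto simp: cS\<close>)
    also have "\<dots> < ereal (2 * e)" using e by simp
    finally show ?thesis .
  qed
  have z: "nA 0 = 0" "nB 0 = 0" using nA(2)[OF DA(2), of 0] nB(2)[OF DB(2), of 0] by simp_all
  have "L \<in> lip_norms_inducing A LA B LB"
    unfolding lip_norms_inducing_def
  proof (intro CollectI conjI ballI)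
    show "lip_norm ?S L" by (rule lip_normI[OF S sL ker pS])
    show "LA a = (INF b\<in>carrier B. L (a, b))" if a: "a \<in> carrier A" for a
    proof (rule cInf_eq_minimum[symmetric])
      \<comment> \<open>The infimum is attained at \<open>\<Phi> a\<close>: one bridge term
        vanishes, the round trip estimate bounds the other by \<open>e * LA a\<close>, and \<Phi>
        does not increase the Lip-seminorm.\<close>
      have "L (a, \<Phi> a) = LA a"
        using a F \<Psi>\<Phi>[OF a] z e sA(1)[OF a] by (intro antisym LD LI) auto
      then show "LA a \<in> (\<lambda>b. L (a, b)) ` carrier B" using F(1)[OF a] by force
    qed (use LD in auto)
    show "LB b = (INF a\<in>carrier A. L (a, b))" if b: "b \<in> carrier B" for b
    proof (rule cInf_eq_minimum[symmetric])
      have "L (\<Psi> b, b) = LB b"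
        using b G \<Phi>\<Psi>[OF b] z e sB(1)[OF b] by (intro antisym LD LI) auto
      then show "LB b \<in> (\<lambda>a. L (a, b)) ` carrier A" using G(1)[OF b] by force
    qed (use LD in auto)
  qed
  then have "dist_q A LA B LB \<le> hausdorff_dist (rho ?S L) (states_fst A B) (states_snd A B)"
    unfolding dist_q_def by (rule INF_lower)
  also have "\<dots> \<le> ereal (2 * e)"
    unfolding hausdorff_dist_def
  proof (rule Inf_lower, intro CollectI exI[of _ "2 * e"] conjI refl ballI)
    show "0 < 2 * e" using e by simp
    fix x assume "x \<in> states_fst A B"
    then obtain \<mu> where \<mu>: "\<mu> \<in> states A" "x = restrict (\<mu> \<circ> fst) (carrier ?S)" by (auto simp: states_fst_def)
    \<comment> \<open>The partner of \<mu> is its pullback along \<Psi>. The two differ on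
      \<open>(a, b)\<close> by \<open>\<mu> (a - \<Psi> b)\<close>, which the bridge
      controls.\<close>
    have "rho ?S L x (restrict (restrict (\<mu> \<circ> \<Psi>) (carrier B) \<circ> snd) (carrier ?S)) < ereal (2 * e)"
      unfolding \<mu>(2)
    proof (rule rho_le)
      fix a b assume ab: "a \<in> carrier A" "b \<in> carrier B" "L (a, b) \<le> 1"
      have "\<bar>\<mu> (a - \<Psi> b)\<bar> \<le> nA (a - \<Psi> b)" using ab G DA by (intro state_le[OF A \<mu>(1)] subspace_diff) auto
      also have "\<dots> \<le> e" using LD(3)[of a b] ab e by (simp add: mult_left_le order_trans)
      finally show "\<bar>\<mu> a - restrict (\<mu> \<circ> \<Psi>) (carrier B) b\<bar> \<le> e"
        using ab by (simp add: state_diff[OF \<mu>(1) DA(1) ab(1) G(1)])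
    qed
    then show "\<exists>y\<in>states_snd A B. rho ?S L x y < ereal (2 * e)"
      using state_comp_lip_contraction[OF B A \<Psi> \<mu>(1)] unfolding states_snd_def by blast
  next
    fix y assume "y \<in> states_snd A B"
    then obtain \<nu> where \<nu>: "\<nu> \<in> states B" "y = restrict (\<nu> \<circ> snd) (carrier ?S)" by (auto simp: states_snd_def)
    have "rho ?S L (restrict (restrict (\<nu> \<circ> \<Phi>) (carrier A) \<circ> fst) (carrier ?S)) y < ereal (2 * e)"
      unfolding \<nu>(2)
    proof (rule rho_le)
      fix a b assume ab: "a \<in> carrier A" "b \<in> carrier B" "L (a, b) \<le> 1"
      have "\<bar>\<nu> (b - \<Phi> a)\<bar> \<le> nB (b - \<Phi> a)" using ab F DB by (intro state_le[OF B \<nu>(1)] subspace_diff) auto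
      also have "\<dots> \<le> e" using LD(4)[of b a] ab e by (simp add: mult_left_le order_trans)
      finally show "\<bar>restrict (\<nu> \<circ> \<Phi>) (carrier A) a - \<nu> b\<bar> \<le> e"
        using ab by (simp add: state_diff[OF \<nu>(1) DB(1) ab(2) F(1)] abs_minus_commute)
    qed
    then show "\<exists>x\<in>states_fst A B. rho ?S L x y < ereal (2 * e)"
      using state_comp_lip_contraction[OF A B \<Phi> \<nu>(1)] unfolding states_fst_def by blast
  qed
  finally show ?thesis .
qed

subsection \<open>Twisted convolution operators and Fourier coefficients\<close>

lemma ell2_apply_Abs_ell2:
  assumes "finite {p. x p \<noteq> 0}"
  shows "ell2_apply (Abs_ell2 x) = x"
proof -
  have "(\<lambda>p. (cmod (x p))\<^sup>2) summable_on {p. x p \<noteq> 0}" using assms by simp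
  also have "?this \<longleftrightarrow> (\<lambda>p. (cmod (x p))\<^sup>2) summable_on UNIV"
    by (rule summable_on_cong_neutral) auto
  finally show ?thesis by (simp add: Abs_ell2_inverse)
qed

lemma norm_ell2_sq: "(norm \<xi>)\<^sup>2 = (\<Sum>\<^sub>\<infinity>p. (cmod (ell2_apply \<xi> p))\<^sup>2)"
  by (simp add: norm_ell2_def infsum_nonneg)

lemma norm_ell2_fs:
  assumes "finite P" "\<And>p. p \<notin> P \<Longrightarrow> ell2_apply \<xi> p = 0"
  shows "(norm \<xi>)\<^sup>2 = (\<Sum>p\<in>P. (cmod (ell2_apply \<xi> p))\<^sup>2)"
proof -
  have "(\<Sum>\<^sub>\<infinity>p. (cmod (ell2_apply \<xi> p))\<^sup>2) = (\<Sum>\<^sub>\<infinity>p\<in>P. (cmod (ell2_apply \<xi> p))\<^sup>2)"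
    by (rule infsum_cong_neutral) (use assms in auto)
  then show ?thesis using assms(1) by (simp add: norm_ell2_sq)
qed

lemma cinner_fs:
  assumes "finite P" "\<And>p. p \<notin> P \<Longrightarrow> ell2_apply \<eta> p = 0"
  shows "cinner \<xi> \<eta> = (\<Sum>p\<in>P. ell2_apply \<xi> p * cnj (ell2_apply \<eta> p))"
proof -
  have "cinner \<xi> \<eta> = (\<Sum>\<^sub>\<infinity>p\<in>P. ell2_apply \<xi> p * cnj (ell2_apply \<eta> p))"
    unfolding cinner_def by (rule infsum_cong_neutral) (use assms in auto)
  then show ?thesis using assms(1) by simp
qed

text \<open>The truncation of \<xi> to a finite set is orthogonal to the remainder, so the squared
  error is the tail of the norm series.\<close>

lemma fs_dense:
  fixes \<xi> :: "'i ell2"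
  assumes "0 < e"
  shows "\<exists>x. finite {p. x p \<noteq> 0} \<and> norm (\<xi> - Abs_ell2 x) < e"
proof -
  let ?s = "\<lambda>p. (cmod (ell2_apply \<xi> p))\<^sup>2"
  have "(?s has_sum (norm \<xi>)\<^sup>2) UNIV"
    unfolding norm_ell2_sq by (rule has_sum_infsum[OF sq_summable])
  then have "\<forall>\<^sub>F F in finite_subsets_at_top UNIV. dist (sum ?s F) ((norm \<xi>)\<^sup>2) < e\<^sup>2"
    unfolding has_sum_def using assms by (intro tendstoD) auto
  then obtain F where F: "finite F" "dist (sum ?s F) ((norm \<xi>)\<^sup>2) < e\<^sup>2"
    unfolding eventually_finite_subsets_at_top by blast
  define x where "x p = (if p \<in> F then ell2_apply \<xi> p else 0)" for p
  have fin: "finite {p. x p \<noteq> 0}" by (rule finite_subset[OF _ F(1)]) (auto simp: x_def)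
  note ax = ell2_apply_Abs_ell2[OF fin]
  have sF: "(norm (Abs_ell2 x))\<^sup>2 = sum ?s F"
    by (subst norm_ell2_fs[OF F(1)]) (auto simp: ax x_def)
  have "inner \<xi> (Abs_ell2 x) = sum ?s F"
    unfolding inner_ell2_def by (subst cinner_fs[OF F(1)]) (auto simp: ax x_def simp flip: complex_norm_square)
  then have "(norm (\<xi> - Abs_ell2 x))\<^sup>2 = (norm \<xi>)\<^sup>2 - sum ?s F"
    using sF by (simp add: power2_norm_eq_inner inner_diff_left inner_diff_right inner_commute)
  also have "\<dots> < e\<^sup>2" using F(2) by (simp add: dist_real_def abs_minus_commute)
  finally have "norm (\<xi> - Abs_ell2 x) < e" by (rule power2_less_imp_less) (use assms in simp)
  then show ?thesis using fin by blast
qed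

text \<open>By density the operator norm may be tested on finitely supported vectors, which turns
  the later contraction estimate into one on finite sums.\<close>

lemma norm_op_le:
  fixes T :: "'i op"
  assumes "0 \<le> C" "\<And>x. finite {p. x p \<noteq> 0} \<Longrightarrow> norm (T (Abs_ell2 x)) \<le> C * norm (Abs_ell2 x)"
  shows "norm T \<le> C"
proof (rule norm_blinfun_bound[OF assms(1)])
  fix \<xi>
  let ?X = "Abs_ell2 ` {x :: 'i \<Rightarrow> complex. finite {p. x p \<noteq> 0}}"
  have "closed {\<xi>. norm (T \<xi>) \<le> C * norm \<xi>}"
    by (intro closed_Collect_le continuous_intros)
  then have "closure ?X \<subseteq> {\<xi>. norm (T \<xi>) \<le> C * norm \<xi>}"
    by (intro closure_minimal) (use assms(2) in auto)
  moreover have "\<xi> \<in> closure ?X"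
    unfolding closure_approachable
  proof (intro allI impI)
    fix e :: real assume "0 < e"
    then obtain x where "finite {p. x p \<noteq> 0}" "norm (\<xi> - Abs_ell2 x) < e" using fs_dense by blast
    then show "\<exists>y\<in>?X. dist y \<xi> < e"
      by (intro bexI[of _ "Abs_ell2 x"]) (simp_all add: dist_norm norm_minus_commute)
  qed
  ultimately show "norm (T \<xi>) \<le> C * norm \<xi>" by blast
qed

lemma pi_rep_superset:
  assumes "finite S" "{q. f q \<noteq> 0} \<subseteq> S"
  shows "ell2_apply (pi_rep \<theta> f \<xi>) p = (\<Sum>q\<in>S. f q * ell2_apply \<xi> (p - q) * bichar \<theta> q p)"
  by (simp add: pi_rep_apply twisted_conv_superset[OF assms])

lemma pi_rep_add:
  assumes "f \<in> Cc" "g \<in> Cc"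
  shows "pi_rep \<theta> (\<lambda>p. f p + g p) = pi_rep \<theta> f + pi_rep \<theta> g"
proof (intro blinfun_eqI ell2_eqI)
  fix \<xi> p
  let ?S = "{q. f q \<noteq> 0} \<union> {q. g q \<noteq> 0}"
  have S: "finite ?S" using assms by (simp add: Cc_def)
  have s: "{q. f q \<noteq> 0} \<subseteq> ?S" "{q. g q \<noteq> 0} \<subseteq> ?S" "{q. f q + g q \<noteq> 0} \<subseteq> ?S" by auto
  show "ell2_apply (pi_rep \<theta> (\<lambda>p. f p + g p) \<xi>) p = ell2_apply ((pi_rep \<theta> f + pi_rep \<theta> g) \<xi>) p"
    by (simp add: blinfun.add_left pi_rep_superset[OF S s(1)] pi_rep_superset[OF S s(2)]
        pi_rep_superset[OF S s(3)] distrib_right sum.distrib)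
qed

lemma pi_rep_scaleR:
  assumes "f \<in> Cc"
  shows "pi_rep \<theta> (\<lambda>p. of_real r * f p) = r *\<^sub>R pi_rep \<theta> f"
proof (intro blinfun_eqI ell2_eqI)
  fix \<xi> p
  let ?S = "{q. f q \<noteq> 0}"
  have S: "finite ?S" using assms by (simp add: Cc_def)
  have s: "{q. of_real r * f q \<noteq> 0} \<subseteq> ?S" by auto
  show "ell2_apply (pi_rep \<theta> (\<lambda>p. of_real r * f p) \<xi>) p = ell2_apply ((r *\<^sub>R pi_rep \<theta> f) \<xi>) p"
    by (simp add: blinfun.scaleR_left pi_rep_superset[OF S s] pi_rep_superset[OF S order_refl]
        sum_distrib_left mult_ac)
qed

lemma pi_rep_diff:
  assumes "f \<in> Cc" "g \<in> Cc"
  shows "pi_rep \<theta> (\<lambda>p. f p - g p) = pi_rep \<theta> f - pi_rep \<theta> g"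
proof -
  have m: "(\<lambda>p. - g p) \<in> Cc" using assms by (simp add: Cc_def)
  have "pi_rep \<theta> (\<lambda>p. - g p) = - pi_rep \<theta> g"
    using pi_rep_scaleR[OF assms(2), of \<theta> "-1"] by simp
  then show ?thesis using pi_rep_add[OF assms(1) m, of \<theta>] by simp
qed

lemma Cc_0 [simp]: "(\<lambda>_. 0) \<in> Cc"
  by (simp add: Cc_def)

lemma Cc_add: "f \<in> Cc \<Longrightarrow> g \<in> Cc \<Longrightarrow> (\<lambda>p. f p + g p) \<in> Cc"
  unfolding Cc_def mem_Collect_eq
  by (erule (1) rev_finite_subset[OF finite_UnI]) auto

lemma Cc_mult1: "f \<in> Cc \<Longrightarrow> (\<lambda>p. f p * g p) \<in> Cc"
  unfolding Cc_def mem_Collect_eq by (erule rev_finite_subset) auto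

lemma Cc_mult2: "f \<in> Cc \<Longrightarrow> (\<lambda>p. g p * f p) \<in> Cc"
  unfolding Cc_def mem_Collect_eq by (erule rev_finite_subset) auto

lemma pi_rep_0: "pi_rep \<theta> (\<lambda>_. 0) = 0"
  using pi_rep_scaleR[OF Cc_0, of \<theta> 0] by simp

lemma Cc_sum: "(\<And>i. i \<in> I \<Longrightarrow> f i \<in> Cc) \<Longrightarrow> (\<lambda>p. \<Sum>i\<in>I. f i p) \<in> Cc"
  by (induction I rule: infinite_finite_induct) (auto intro: Cc_add)

lemma pi_rep_sum:
  "(\<And>i. i \<in> I \<Longrightarrow> f i \<in> Cc) \<Longrightarrow> pi_rep \<theta> (\<lambda>p. \<Sum>i\<in>I. f i p) = (\<Sum>i\<in>I. pi_rep \<theta> (f i))"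
  by (induction I rule: infinite_finite_induct) (auto simp: pi_rep_0 pi_rep_add Cc_sum)

text \<open>A single frequency acts as a translation of the lattice followed by a weight of modulus
  \<open>cmod c\<close>.\<close>

lemma norm_pi_rep_single:
  fixes \<theta> :: "real^'d^'d"
  shows "norm (pi_rep \<theta> (\<lambda>r. if r = q then c else 0)) \<le> cmod c"
proof (rule norm_blinfun_bound)
  fix \<xi> :: "(int^'d) ell2"
  let ?f = "\<lambda>r. if r = q then c else 0"
  have bij: "bij (\<lambda>p :: int^'d. p - q)" by (rule bijI') (auto intro: exI[of _ "_ + q"])
  have s: "{r. ?f r \<noteq> 0} \<subseteq> {q}" by auto
  have "cmod (ell2_apply (pi_rep \<theta> ?f \<xi>) p) = cmod c * cmod (ell2_apply \<xi> (p - q))" for p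
    by (subst pi_rep_superset[OF _ s]) (simp_all add: norm_mult)
  then have "(norm (pi_rep \<theta> ?f \<xi>))\<^sup>2 = (\<Sum>\<^sub>\<infinity>p. (cmod c)\<^sup>2 * (cmod (ell2_apply \<xi> (p - q)))\<^sup>2)"
    by (simp add: norm_ell2_sq power_mult_distrib)
  also have "\<dots> = (cmod c)\<^sup>2 * (\<Sum>\<^sub>\<infinity>p. (cmod (ell2_apply \<xi> (p - q)))\<^sup>2)"
    using summable_on_reindex_bij_betw[OF bij, of "\<lambda>p. (cmod (ell2_apply \<xi> p))\<^sup>2"] sq_summable
    by (intro infsum_cmult_right) blast
  also have "(\<Sum>\<^sub>\<infinity>p. (cmod (ell2_apply \<xi> (p - q)))\<^sup>2) = (norm \<xi>)\<^sup>2"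
    unfolding norm_ell2_sq by (rule infsum_reindex_bij_betw[OF bij])
  finally have "(norm (pi_rep \<theta> ?f \<xi>))\<^sup>2 = (cmod c * norm \<xi>)\<^sup>2" by (simp add: power_mult_distrib)
  then show "norm (pi_rep \<theta> ?f \<xi>) \<le> cmod c * norm \<xi>"
    using power2_eq_imp_eq[of "norm (pi_rep \<theta> ?f \<xi>)" "cmod c * norm \<xi>"] by simp
qed simp

lemma norm_pi_rep_le:
  assumes "finite S" "{q. f q \<noteq> 0} \<subseteq> S"
  shows "norm (pi_rep \<theta> f) \<le> (\<Sum>q\<in>S. cmod (f q))"
proof -
  let ?g = "\<lambda>q r. if r = q then f q else 0"
  have "f = (\<lambda>p. \<Sum>q\<in>S. ?g q p)" using assms by (auto simp: fun_eq_iff)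
  then have "pi_rep \<theta> f = pi_rep \<theta> (\<lambda>p. \<Sum>q\<in>S. ?g q p)" by (rule arg_cong)
  also have "\<dots> = (\<Sum>q\<in>S. pi_rep \<theta> (?g q))"
  proof (rule pi_rep_sum)
    show "?g q \<in> Cc" for q unfolding Cc_def by (simp add: finite_subset[of _ "{q}"])
  qed
  finally show ?thesis
    by (simp only:) (rule sum_norm_le[OF norm_pi_rep_single])
qed

section \<open>Matrix entries and Fourier coefficients\<close>

definition point_vec :: "int^'d \<Rightarrow> (int^'d) ell2" where
  "point_vec q = Abs_ell2 (\<lambda>p. if p = q then 1 else 0)"

lemma ell2_apply_point_vec [simp]: "ell2_apply (point_vec q) p = (if p = q then 1 else 0)"
  unfolding point_vec_def by (subst ell2_apply_Abs_ell2) auto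

lemma norm_point_vec: "norm (point_vec q) = 1"
proof -
  have "(norm (point_vec q))\<^sup>2 = 1" by (subst norm_ell2_fs[of "{q}"]) auto
  then show ?thesis using power2_eq_imp_eq[of "norm (point_vec q)" 1] by simp
qed

text \<open>The column at the origin, where the cocycle is trivial. It exists for every bounded
  operator and does not mention \<theta>, so it can pass between tori with different
  parameters.\<close>

definition fourier_coeff :: "(int^'d) op \<Rightarrow> int^'d \<Rightarrow> complex" where
  "fourier_coeff a p = ell2_apply (a (point_vec 0)) p"

lemma fourier_coeff_simps [simp]:
  "fourier_coeff (a + b) p = fourier_coeff a p + fourier_coeff b p"
  "fourier_coeff (a - b) p = fourier_coeff a p - fourier_coeff b p"
  "fourier_coeff (r *\<^sub>R a) p = of_real r * fourier_coeff a p"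
  "fourier_coeff id_blinfun p = (if p = 0 then 1 else 0)"
  by (simp_all add: fourier_coeff_def blinfun.add_left blinfun.diff_left blinfun.scaleR_left)

lemma cmod_fourier_coeff_le: "cmod (fourier_coeff a p) \<le> norm a"
  using order_trans[OF cmod_ell2_apply_le[of "a (point_vec 0)" p] norm_blinfun[of a "point_vec 0"]]
  by (simp add: fourier_coeff_def norm_point_vec)

lemma bichar_0 [simp]: "bichar \<theta> 0 p = 1" "bichar \<theta> p 0 = 1"
  by (simp_all add: bichar_def real_vec_def inner_vec_def matrix_vector_mult_def)

lemma bichar_diff_left: "bichar \<theta> (p - q) r = bichar \<theta> p r * cnj (bichar \<theta> q r)"
  using bichar_add_left[of \<theta> p "- q" r] by (simp add: bichar_minus_left)

lemma bichar_minus_right: "bichar \<theta> p (- q) = cnj (bichar \<theta> p q)"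
proof -
  have "bichar \<theta> p (- q) * bichar \<theta> p q = 1"
    using bichar_add_right[of \<theta> p "- q" q] by simp
  moreover have "cnj (bichar \<theta> p q) * bichar \<theta> p q = 1"
    using complex_norm_square[of "bichar \<theta> p q"] by (simp add: mult.commute)
  ultimately show ?thesis by (metis mult_cancel_right mult_zero_right zero_neq_one)
qed

lemma bichar_diff_right: "bichar \<theta> p (q - r) = bichar \<theta> p q * cnj (bichar \<theta> p r)"
  using bichar_add_right[of \<theta> p q "- r"] by (simp add: bichar_minus_right)

lemma bichar_diff_self:
  assumes "\<theta> \<in> skew_matrices"
  shows "bichar \<theta> (p - q) p = bichar \<theta> p q"
  using bichar_swap[OF assms, of q p] by (simp add: bichar_diff_left bichar_self[OF assms])

text \<open>Only the frequency \<open>p - q\<close> leads from \<open>q\<close> to \<open>p\<close>,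
  and skew symmetry reduces \<open>bichar \<theta> (p - q) p\<close> to
  \<open>bichar \<theta> p q\<close>. This is the matrix on which the Schur multipliers act.\<close>

lemma pi_rep_point_vec:
  assumes "\<theta> \<in> skew_matrices" "f \<in> Cc"
  shows "ell2_apply (pi_rep \<theta> f (point_vec q)) p = f (p - q) * bichar \<theta> p q"
proof -
  let ?S = "insert (p - q) {r. f r \<noteq> 0}"
  have "finite ?S" using assms by (simp add: Cc_def)
  then have "ell2_apply (pi_rep \<theta> f (point_vec q)) p =
      (\<Sum>r\<in>?S. f r * (if p - r = q then 1 else 0) * bichar \<theta> r p)"
    by (subst pi_rep_superset[of ?S]) auto
  also have "\<dots> = (\<Sum>r\<in>?S. if r = p - q then f r * bichar \<theta> r p else 0)"
    by (rule sum.cong) (auto simp: algebra_simps)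
  also have "\<dots> = f (p - q) * bichar \<theta> (p - q) p"
    using \<open>finite ?S\<close> by (subst sum.delta) auto
  finally show ?thesis by (simp add: bichar_diff_self[OF assms(1)])
qed

lemma fourier_coeff_pi_rep:
  assumes "\<theta> \<in> skew_matrices" "f \<in> Cc"
  shows "fourier_coeff (pi_rep \<theta> f) = f"
  by (rule ext) (simp add: fourier_coeff_def pi_rep_point_vec[OF assms])

lemma pi_rep_in_Abar: "f \<in> Cc \<Longrightarrow> pi_rep \<theta> f \<in> Abar \<theta>"
  unfolding Abar_def by (rule subsetD[OF closure_subset imageI])

text \<open>Closed properties pass from the dense image of \<open>Cc\<close> to its closure; this
  replaces explicit limits.\<close>

lemma Abar_induct [consumes 1, case_names closed pi_rep]:
  assumes "a \<in> Abar \<theta>" "closed {a. P a}" "\<And>f. f \<in> Cc \<Longrightarrow> P (pi_rep \<theta> f)"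
  shows "P a"
  using closure_minimal[of "pi_rep \<theta> ` Cc" "{a. P a}"] assms by (auto simp: Abar_def)

lemma Abar_approx:
  assumes "a \<in> Abar \<theta>" "0 < e"
  obtains f where "f \<in> Cc" "norm (a - pi_rep \<theta> f) < e"
proof -
  obtain b where "b \<in> pi_rep \<theta> ` Cc" "dist b a < e"
    using assms unfolding Abar_def closure_approachable by blast
  then show thesis using that by (auto simp: dist_norm norm_minus_commute)
qed

lemma closed_Abar: "closed (Abar \<theta>)"
  by (simp add: Abar_def)

lemma closure_of_subspace:
  fixes V :: "'a::real_normed_vector set"
  assumes "subspace V"
  shows "subspace (closure V)"
proof (rule subspaceI)
  show "0 \<in> closure V" using subspace_0[OF assms] closure_subset by blast
  show "x + y \<in> closure V" if xy: "x \<in> closure V" "y \<in> closure V" for x y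
  proof -
    obtain f g where "\<forall>n :: nat. f n \<in> V" "f \<longlonglongrightarrow> x" "\<forall>n :: nat. g n \<in> V" "g \<longlonglongrightarrow> y"
      using xy unfolding closure_sequential by blast
    then show ?thesis
      unfolding closure_sequential using subspace_add[OF assms]
      by (intro exI[of _ "\<lambda>n. f n + g n"]) (auto intro: tendsto_add)
  qed
  show "c *\<^sub>R x \<in> closure V" if xy: "x \<in> closure V" for c x
  proof -
    obtain f where "\<forall>n :: nat. f n \<in> V" "f \<longlonglongrightarrow> x"
      using xy unfolding closure_sequential by blast
    then show ?thesis
      unfolding closure_sequential using subspace_scale[OF assms]
      by (intro exI[of _ "\<lambda>n. c *\<^sub>R f n"]) (auto intro: tendsto_scaleR)
  qed
qed

lemma subspace_Abar: "subspace (Abar \<theta>)"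
proof -
  have "subspace (pi_rep \<theta> ` Cc)"
  proof (rule subspaceI)
    show "0 \<in> pi_rep \<theta> ` Cc" using pi_rep_0 by (metis Cc_0 imageI)
    show "x + y \<in> pi_rep \<theta> ` Cc" if "x \<in> pi_rep \<theta> ` Cc" "y \<in> pi_rep \<theta> ` Cc" for x y
      using that by (auto simp: Cc_add simp flip: pi_rep_add)
    show "c *\<^sub>R x \<in> pi_rep \<theta> ` Cc" if "x \<in> pi_rep \<theta> ` Cc" for x c
      using that by (auto simp: Cc_mult2 simp flip: pi_rep_scaleR)
  qed
  then show ?thesis unfolding Abar_def by (rule closure_of_subspace)
qed

lemma pi_rep_unit:
  assumes "\<theta> \<in> skew_matrices"
  shows "pi_rep \<theta> (\<lambda>p. if p = 0 then 1 else 0) = id_blinfun"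
proof (intro blinfun_eqI ell2_eqI)
  fix \<xi> p
  show "ell2_apply (pi_rep \<theta> (\<lambda>p. if p = 0 then 1 else 0) \<xi>) p = ell2_apply (id_blinfun \<xi>) p"
    by (subst pi_rep_superset[of "{0}"]) auto
qed

lemma id_in_Abar: "\<theta> \<in> skew_matrices \<Longrightarrow> id_blinfun \<in> Abar \<theta>"
  using pi_rep_in_Abar[of "\<lambda>p. if p = 0 then 1 else 0" \<theta>] by (simp add: pi_rep_unit Cc_def)

lemma bounded_linear_ell2_apply: "bounded_linear (\<lambda>\<xi>. ell2_apply \<xi> p)"
  by (rule bounded_linear_intro[of _ 1]) (simp_all add: cmod_ell2_apply_le scaleR_conv_of_real)

lemma bounded_linear_fourier_coeff: "bounded_linear (\<lambda>a. fourier_coeff a p)"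
  by (rule bounded_linear_intro[of _ 1]) (simp_all add: cmod_fourier_coeff_le scaleR_conv_of_real)

text \<open>Both sides are continuous in \<open>a\<close>, and on the image of \<open>Cc\<close>
  this is the formula for the matrix entries.\<close>

lemma Abar_entry:
  assumes "\<theta> \<in> skew_matrices" "a \<in> Abar \<theta>"
  shows "ell2_apply (a (point_vec q)) p = fourier_coeff a (p - q) * bichar \<theta> p q"
  using assms(2)
proof (induction rule: Abar_induct)
  case closed
  have "continuous_on UNIV (\<lambda>a :: (int^'a) op. ell2_apply (a (point_vec q)) p)"
    by (intro bounded_linear.continuous_on[OF bounded_linear_ell2_apply] continuous_intros)
  then show ?case
    by (intro closed_Collect_eq continuous_intros bounded_linear.continuous_on[OF bounded_linear_fourier_coeff])
next
  case (pi_rep f)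
  then show ?case using assms by (simp add: pi_rep_point_vec fourier_coeff_pi_rep)
qed

text \<open>Self-adjointness equates the entry at \<open>(p, 0)\<close> with the conjugate of the
  entry at \<open>(0, p)\<close>, and the cocycle is trivial at both places.\<close>

lemma star_fourier_coeff:
  assumes "\<theta> \<in> skew_matrices" "a \<in> Abar \<theta>" "is_adjoint a a"
  shows "star (fourier_coeff a) = fourier_coeff a"
proof
  fix p
  have "cinner (a (point_vec 0)) (point_vec p) = fourier_coeff a p"
    by (subst cinner_fs[of "{p}"]) (auto simp: fourier_coeff_def)
  moreover have "cinner (point_vec 0) (a (point_vec p)) = cnj (ell2_apply (a (point_vec p)) 0)"
  proof -
    have "cinner (point_vec 0) (a (point_vec p)) = cnj (cinner (a (point_vec p)) (point_vec 0))"
      unfolding cinner_def infsum_cnj[symmetric] by (simp add: mult.commute)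
    also have "cinner (a (point_vec p)) (point_vec 0) = ell2_apply (a (point_vec p)) 0"
      by (subst cinner_fs[of "{0}"]) auto
    finally show ?thesis .
  qed
  ultimately show "star (fourier_coeff a) p = fourier_coeff a p"
    using assms by (simp add: is_adjoint_def star_def Abar_entry)
qed

subsection \<open>Transfer between quantum tori\<close>

text \<open>An autocorrelation of \<open>h\<close> twisted by the cocycle of \<Delta>. For
  \<open>\<Delta> = 0\<close> and the normalized indicator of a box these are the coefficients of a
  Fejer kernel.\<close>

definition correl :: "(int^'d \<Rightarrow> real) \<Rightarrow> real^'d^'d \<Rightarrow> int^'d \<Rightarrow> complex" where
  "correl h \<Delta> r = (\<Sum>s | h s \<noteq> 0. of_real (h s * h (s - r)) * cnj (bichar \<Delta> r s))"

definition unit_mass :: "(int^'d \<Rightarrow> real) \<Rightarrow> bool" where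
  "unit_mass h \<longleftrightarrow> finite {s. h s \<noteq> 0} \<and> (\<Sum>s | h s \<noteq> 0. (h s)\<^sup>2) = 1"

lemma correl_Cc:
  assumes "unit_mass h"
  shows "correl h \<Delta> \<in> Cc"
proof -
  let ?H = "{s. h s \<noteq> 0}"
  have "{r. correl h \<Delta> r \<noteq> 0} \<subseteq> (\<lambda>(s, t). s - t) ` (?H \<times> ?H)"
  proof
    fix r assume "r \<in> {r. correl h \<Delta> r \<noteq> 0}"
    then obtain s where "of_real (h s * h (s - r)) * cnj (bichar \<Delta> r s) \<noteq> 0"
      unfolding correl_def mem_Collect_eq by (rule sum.not_neutral_contains_not_neutral)
    then have "(s, s - r) \<in> ?H \<times> ?H" by auto
    then show "r \<in> (\<lambda>(s, t). s - t) ` (?H \<times> ?H)" by (rule rev_image_eqI) simp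
  qed
  moreover have "finite (?H \<times> ?H)" using assms by (simp add: unit_mass_def)
  ultimately show ?thesis unfolding Cc_def by (auto intro: finite_subset)
qed

lemma correl_0:
  assumes "unit_mass h"
  shows "correl h \<Delta> 0 = 1"
proof -
  have "correl h \<Delta> 0 = of_real (\<Sum>s | h s \<noteq> 0. (h s)\<^sup>2)"
    by (simp add: correl_def power2_eq_square)
  also have "(\<Sum>s | h s \<noteq> 0. (h s)\<^sup>2) = 1" using assms by (simp add: unit_mass_def)
  finally show ?thesis by simp
qed

text \<open>It makes the way back from \<psi> to \<theta> multiply by the conjugate, so that the
  round trip has a nonnegative multiplier.\<close>

lemma correl_uminus_matrix: "correl h (- \<Delta>) r = cnj (correl h \<Delta> r)"
proof -
  have "bichar (- \<Delta>) p q = cnj (bichar \<Delta> p q)" for p q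
  proof -
    have "(- \<Delta>) *v x = - (\<Delta> *v x)" for x
      by (simp add: matrix_vector_mult_def vec_eq_iff sum_negf)
    then show ?thesis by (simp add: bichar_def exp_cnj)
  qed
  then show ?thesis by (simp add: correl_def)
qed

text \<open>Shifting \<open>s\<close> by \<open>r\<close> swaps the two factors of \<open>h\<close>
  and leaves the twist alone, because \<open>bichar \<Delta> r r = 1\<close>. This symmetry lets the
  transfer preserve self-adjointness.\<close>

lemma correl_minus:
  assumes "\<Delta> \<in> skew_matrices" "unit_mass h"
  shows "correl h \<Delta> (- r) = cnj (correl h \<Delta> r)"
proof -
  let ?H = "{s. h s \<noteq> 0}"
  have fin: "finite ?H" using assms by (simp add: unit_mass_def)
  have b: "bichar \<Delta> r (s + r) = bichar \<Delta> r s" for s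
    by (simp add: bichar_add_right bichar_self[OF assms(1)])
  have "correl h \<Delta> (- r) = (\<Sum>s\<in>?H. of_real (h s * h (s + r)) * bichar \<Delta> r s)"
    by (simp add: correl_def bichar_minus_left)
  also have "\<dots> = (\<Sum>s\<in>?H. of_real (h s * h (s - r)) * bichar \<Delta> r s)"
    by (rule sum.reindex_bij_witness_not_neutral[of "{s \<in> ?H. h (s + r) = 0}" "{s \<in> ?H. h (s - r) = 0}"
          _ "\<lambda>s. s - r" "\<lambda>s. s + r"]) (use fin b in \<open>auto simp: mult.commute\<close>)
  finally show ?thesis by (simp add: correl_def)
qed

lemma bichar_mult_cnj: "bichar \<theta> p q * cnj (bichar \<theta> p q) = 1" "bichar \<theta> p q * (cnj (bichar \<theta> p q) * z) = z"
proof -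
  show "bichar \<theta> p q * cnj (bichar \<theta> p q) = 1"
    using complex_norm_square[of "bichar \<theta> p q"] by simp
  then show "bichar \<theta> p q * (cnj (bichar \<theta> p q) * z) = z" by (simp flip: mult.assoc)
qed

text \<open>Here the kernel is seen to be positive definite:
  \<open>bichar \<Delta> (p - q) t\<close> is \<open>bichar \<Delta> p t\<close> times the conjugate
  of \<open>bichar \<Delta> q t\<close>, so the left side is a Gram matrix in \<open>p\<close> and
  \<open>q\<close>. The substitution is \<open>s = p - t\<close>.\<close>

lemma sum_shift_eq_correl:
  assumes \<Delta>: "\<Delta> \<in> skew_matrices" and fin: "finite T"
    and T: "\<And>s. h s \<noteq> 0 \<Longrightarrow> p - s \<in> T"
  shows "(\<Sum>t\<in>T. of_real (h (p - t) * h (q - t)) * bichar \<Delta> (p - q) t) =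
    bichar \<Delta> p q * correl h \<Delta> (p - q)"
proof -
  let ?H = "{s. h s \<noteq> 0}"
  have "?H \<subseteq> (\<lambda>t. p - t) ` T"
  proof
    fix s assume "s \<in> ?H" then show "s \<in> (\<lambda>t. p - t) ` T" using T[of s] by (intro image_eqI[of _ _ "p - s"]) auto
  qed
  then have finH: "finite ?H" using fin finite_surj by blast
  have b: "bichar \<Delta> p q * (z * cnj (bichar \<Delta> (p - q) (p - t))) = z * bichar \<Delta> (p - q) t" for t z
  proof -
    have "bichar \<Delta> p q * (z * cnj (bichar \<Delta> (p - q) (p - t))) =
        bichar \<Delta> p q * (cnj (bichar \<Delta> p q) * (z * bichar \<Delta> (p - q) t))"
      by (simp add: bichar_diff_right bichar_diff_self[OF \<Delta>])
    then show ?thesis by (simp only: bichar_mult_cnj)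
  qed
  have e: "p - t - (p - q) = q - t" for t by simp
  have "(\<Sum>t\<in>T. of_real (h (p - t) * h (q - t)) * bichar \<Delta> (p - q) t) =
      (\<Sum>s\<in>?H. bichar \<Delta> p q * (of_real (h s * h (s - (p - q))) * cnj (bichar \<Delta> (p - q) s)))"
    by (rule sum.reindex_bij_witness_not_neutral[of "{t \<in> T. h (p - t) = 0}" "{}"
          _ "\<lambda>s. p - s" "\<lambda>t. p - t"])
      (use fin finH T in \<open>simp_all add: b e\<close>)
  then show ?thesis by (simp add: correl_def sum_distrib_left)
qed

lemma inner_pi_rep:
  assumes \<theta>: "\<theta> \<in> skew_matrices" and f: "f \<in> Cc" and P: "finite P"
    and x: "\<And>p. p \<notin> P \<Longrightarrow> x p = 0" and y: "\<And>p. p \<notin> P \<Longrightarrow> y p = 0"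
  shows "inner (pi_rep \<theta> f (Abs_ell2 x)) (Abs_ell2 y) =
    Re (\<Sum>p\<in>P. \<Sum>q\<in>P. f (p - q) * x q * bichar \<theta> p q * cnj (y p))"
proof -
  have ax: "ell2_apply (Abs_ell2 x) = x" by (rule ell2_apply_Abs_ell2) (use x P in \<open>blast intro: finite_subset\<close>)
  have ay: "ell2_apply (Abs_ell2 y) = y" by (rule ell2_apply_Abs_ell2) (use y P in \<open>blast intro: finite_subset\<close>)
  have fin: "finite {r. f r \<noteq> 0}" using f by (simp add: Cc_def)
  have b: "bichar \<theta> p (p - r) = bichar \<theta> r p" for p r
    using bichar_diff_self[OF \<theta>, of p "p - r"] by simp
  have "twisted_conv \<theta> f x p = (\<Sum>q\<in>P. f (p - q) * x q * bichar \<theta> p q)" for p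
    unfolding twisted_conv_def
    by (rule sum.reindex_bij_witness_not_neutral[of "{r. f r \<noteq> 0 \<and> x (p - r) = 0}"
          "{q \<in> P. f (p - q) = 0 \<or> x q = 0}" _ "\<lambda>q. p - q" "\<lambda>r. p - r"])
      (use fin P x in \<open>auto simp: b\<close>)
  then show ?thesis
    unfolding inner_ell2_def
    by (subst cinner_fs[OF P]) (auto simp: ay y pi_rep_apply ax sum_distrib_right)
qed

lemma bichar_add_matrix: "bichar (\<theta> + \<psi>) p q = bichar \<theta> p q * bichar \<psi> p q"
  by (simp add: bichar_def matrix_vector_mult_add_rdistrib inner_add_right distrib_left exp_add)

lemma subspace_skew: "subspace skew_matrices"
proof (rule subspaceI)
  show "0 \<in> skew_matrices" by (simp add: skew_matrices_def transpose_def vec_eq_iff)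
  have t: "transpose (x + y) = transpose x + transpose y" for x y :: "real^'d^'d"
    by (simp add: transpose_def vec_eq_iff)
  show "x + y \<in> skew_matrices" if "x \<in> skew_matrices" "y \<in> skew_matrices" for x y :: "real^'d^'d"
    using that by (simp add: skew_matrices_def t)
  have t': "transpose (c *\<^sub>R x) = c *\<^sub>R transpose x" for c and x :: "real^'d^'d"
    by (simp add: transpose_def vec_eq_iff)
  show "c *\<^sub>R x \<in> skew_matrices" if "x \<in> skew_matrices" for c and x :: "real^'d^'d"
    using that by (simp add: skew_matrices_def t')
qed

lemmas skew_diff = subspace_diff[OF subspace_skew]

text \<open>
  With the diagonal operators \<open>D\<^sub>t x q = h (q - t) cnj (bichar \<Delta> q t) x q\<close>, the operator on the left
  is \<open>\<Sum>\<^sub>t D\<^sub>t\<^sup>* (pi_rep \<theta> f) D\<^sub>t\<close>, while \<open>\<Sum>\<^sub>t D\<^sub>t\<^sup>* D\<^sub>t = 1\<close>.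
\<close>

lemma norm_pi_rep_correl_le:
  fixes \<theta> \<Delta> :: "real^'d^'d"
  assumes \<theta>: "\<theta> \<in> skew_matrices" and \<Delta>: "\<Delta> \<in> skew_matrices" and f: "f \<in> Cc" and h: "unit_mass h"
  shows "norm (pi_rep (\<theta> + \<Delta>) (\<lambda>p. correl h \<Delta> p * f p)) \<le> norm (pi_rep \<theta> f)"
proof (rule norm_op_le)
  fix x :: "int^'d \<Rightarrow> complex" assume fx: "finite {p. x p \<noteq> 0}"
  let ?T = "pi_rep (\<theta> + \<Delta>) (\<lambda>p. correl h \<Delta> p * f p)"
  let ?H = "{s. h s \<noteq> 0}"
  have \<psi>: "\<theta> + \<Delta> \<in> skew_matrices" by (rule subspace_add[OF subspace_skew \<theta> \<Delta>])
  have gf: "(\<lambda>p. correl h \<Delta> p * f p) \<in> Cc" by (rule Cc_mult2[OF f])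
  \<comment> \<open>Pairing the image of \<open>x\<close> with itself, a finitely supported vector
    again, keeps all sums over one finite set \<open>P\<close>.\<close>
  define y where "y = ell2_apply (?T (Abs_ell2 x))"
  have "y \<in> Cc"
    using twisted_conv_Cc[OF gf, of x "\<theta> + \<Delta>"] fx by (simp add: y_def pi_rep_apply ell2_apply_Abs_ell2 Cc_def)
  then have fy: "finite {p. y p \<noteq> 0}" by (simp add: Cc_def)
  have Ty: "?T (Abs_ell2 x) = Abs_ell2 y" by (simp add: y_def ell2_apply_inverse)
  define P where "P = {p. x p \<noteq> 0} \<union> {p. y p \<noteq> 0}"
  have P: "finite P" using fx fy by (simp add: P_def)
  have Px: "x p = 0" and Py: "y p = 0" if "p \<notin> P" for p using that by (auto simp: P_def)
  \<comment> \<open>\<open>T\<close> contains every \<open>t\<close> for which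
    \<open>h (p - t)\<close> is nonzero at some \<open>p\<close> in \<open>P\<close>; for other
    \<open>t\<close> the operator \<open>D t\<close> kills all vectors supported in
    \<open>P\<close>.\<close>
  define T where "T = (\<lambda>(p, s). p - s) ` (P \<times> ?H)"
  have finH: "finite ?H" using h by (simp add: unit_mass_def)
  have T: "finite T" "\<And>p s. p \<in> P \<Longrightarrow> h s \<noteq> 0 \<Longrightarrow> p - s \<in> T"
    using P finH by (auto simp: T_def)
  define D where "D t z q = of_real (h (q - t)) * cnj (bichar \<Delta> q t) * z q" for t q and z :: "int^'d \<Rightarrow> complex"
  have D0: "D t z p = 0" if "z p = 0" for t z p using that by (simp add: D_def)
  have sq: "(\<Sum>t\<in>T. (norm (Abs_ell2 (D t z)))\<^sup>2) = (norm (Abs_ell2 z))\<^sup>2" if z: "\<And>p. p \<notin> P \<Longrightarrow> z p = 0" for z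
  proof -
    have az: "ell2_apply (Abs_ell2 z) = z"
      by (rule ell2_apply_Abs_ell2, rule finite_subset[OF _ P], rule subsetI, rule ccontr) (simp add: z)
    have aD: "ell2_apply (Abs_ell2 (D t z)) = D t z" for t
      by (rule ell2_apply_Abs_ell2, rule finite_subset[OF _ P], rule subsetI, rule ccontr) (simp add: D0 z)
    have h1: "(\<Sum>t\<in>T. (h (p - t))\<^sup>2) = 1" if p: "p \<in> P" for p
    proof -
      have "(\<Sum>t\<in>T. (h (p - t))\<^sup>2) = (\<Sum>s\<in>?H. (h s)\<^sup>2)"
        by (rule sum.reindex_bij_witness_not_neutral[of "{t \<in> T. h (p - t) = 0}" "{}"
          _ "\<lambda>s. p - s" "\<lambda>t. p - t"]) (use T finH p in auto)
      then show ?thesis using h by (simp add: unit_mass_def)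
    qed
    have "(norm (Abs_ell2 (D t z)))\<^sup>2 = (\<Sum>p\<in>P. (h (p - t))\<^sup>2 * (cmod (z p))\<^sup>2)" for t
      by (subst norm_ell2_fs[OF P]) (use D0 z aD in \<open>auto simp: D_def norm_mult power_mult_distrib\<close>)
    then have "(\<Sum>t\<in>T. (norm (Abs_ell2 (D t z)))\<^sup>2) = (\<Sum>p\<in>P. \<Sum>t\<in>T. (h (p - t))\<^sup>2 * (cmod (z p))\<^sup>2)"
      by (simp only:) (rule sum.swap)
    also have "\<dots> = (\<Sum>p\<in>P. (cmod (z p))\<^sup>2)"
      by (simp add: h1 flip: sum_distrib_right)
    also have "\<dots> = (norm (Abs_ell2 z))\<^sup>2"
      by (subst norm_ell2_fs[OF P]) (use z az in auto)
    finally show ?thesis .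
  qed
  have "(norm (?T (Abs_ell2 x)))\<^sup>2 = inner (?T (Abs_ell2 x)) (Abs_ell2 y)"
    by (simp add: Ty power2_norm_eq_inner)
  also have "\<dots> = Re (\<Sum>p\<in>P. \<Sum>q\<in>P. correl h \<Delta> (p - q) * f (p - q) * x q * bichar (\<theta> + \<Delta>) p q * cnj (y p))"
    by (rule inner_pi_rep[OF \<psi> gf P Px Py])
  also have "\<dots> = Re (\<Sum>p\<in>P. \<Sum>q\<in>P. \<Sum>t\<in>T. f (p - q) * D t x q * bichar \<theta> p q * cnj (D t y p))"
  proof (intro arg_cong[where f = Re] sum.cong refl)
    fix p q assume p: "p \<in> P"
    have "(\<Sum>t\<in>T. f (p - q) * D t x q * bichar \<theta> p q * cnj (D t y p)) =
        (\<Sum>t\<in>T. f (p - q) * x q * bichar \<theta> p q * cnj (y p) * (of_real (h (p - t) * h (q - t)) * bichar \<Delta> (p - q) t))"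
      by (rule sum.cong) (simp_all add: D_def bichar_diff_left)
    also have "\<dots> = f (p - q) * x q * bichar \<theta> p q * cnj (y p) * (bichar \<Delta> p q * correl h \<Delta> (p - q))"
      unfolding sum_distrib_left[symmetric] by (subst sum_shift_eq_correl[OF \<Delta> T(1) T(2)[OF p]]) auto
    finally show "correl h \<Delta> (p - q) * f (p - q) * x q * bichar (\<theta> + \<Delta>) p q * cnj (y p) =
        (\<Sum>t\<in>T. f (p - q) * D t x q * bichar \<theta> p q * cnj (D t y p))"
      by (simp add: bichar_add_matrix mult_ac)
  qed
  also have "\<dots> = (\<Sum>t\<in>T. Re (\<Sum>p\<in>P. \<Sum>q\<in>P. f (p - q) * D t x q * bichar \<theta> p q * cnj (D t y p)))"
    unfolding Re_sum[symmetric] by (simp add: sum.swap[of _ T])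
  also have "\<dots> = (\<Sum>t\<in>T. inner (pi_rep \<theta> f (Abs_ell2 (D t x))) (Abs_ell2 (D t y)))"
    by (intro sum.cong refl inner_pi_rep[OF \<theta> f P, symmetric] D0 Px Py)
  also have "\<dots> \<le> (\<Sum>t\<in>T. norm (pi_rep \<theta> f) * (norm (Abs_ell2 (D t x)) * norm (Abs_ell2 (D t y))))"
  proof (rule sum_mono)
    fix t
    have "inner (pi_rep \<theta> f (Abs_ell2 (D t x))) (Abs_ell2 (D t y)) \<le>
        norm (pi_rep \<theta> f (Abs_ell2 (D t x))) * norm (Abs_ell2 (D t y))" by (rule norm_cauchy_schwarz)
    also have "\<dots> \<le> norm (pi_rep \<theta> f) * norm (Abs_ell2 (D t x)) * norm (Abs_ell2 (D t y))"
      by (intro mult_right_mono norm_blinfun) simp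
    finally show "inner (pi_rep \<theta> f (Abs_ell2 (D t x))) (Abs_ell2 (D t y)) \<le>
        norm (pi_rep \<theta> f) * (norm (Abs_ell2 (D t x)) * norm (Abs_ell2 (D t y)))" by (simp add: mult.assoc)
  qed
  \<comment> \<open>Cauchy-Schwarz over \<open>t\<close>: by \<open>sq\<close> the squared norms of
    the pieces add up to those of \<open>x\<close> and \<open>y\<close>, so the decomposition costs
    no constant.\<close>
  also have "\<dots> \<le> norm (pi_rep \<theta> f) * (norm (Abs_ell2 x) * norm (Abs_ell2 y))"
    unfolding sum_distrib_left[symmetric]
  proof (intro mult_left_mono)
    have "(\<Sum>t\<in>T. norm (Abs_ell2 (D t x)) * norm (Abs_ell2 (D t y)))\<^sup>2 \<le> (norm (Abs_ell2 x) * norm (Abs_ell2 y))\<^sup>2"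
      using Cauchy_Schwarz_ineq_sum[of "\<lambda>t. norm (Abs_ell2 (D t x))" "\<lambda>t. norm (Abs_ell2 (D t y))" T]
      by (simp add: sq Px Py power_mult_distrib)
    then show "(\<Sum>t\<in>T. norm (Abs_ell2 (D t x)) * norm (Abs_ell2 (D t y))) \<le> norm (Abs_ell2 x) * norm (Abs_ell2 y)"
      by (rule power2_le_imp_le) simp
  qed simp
  finally have "norm (Abs_ell2 y) * norm (Abs_ell2 y) \<le> (norm (pi_rep \<theta> f) * norm (Abs_ell2 x)) * norm (Abs_ell2 y)"
    by (simp add: Ty power2_eq_square mult.assoc)
  then have "norm (Abs_ell2 y) \<le> norm (pi_rep \<theta> f) * norm (Abs_ell2 x)"
    by (cases "norm (Abs_ell2 y) = 0") (simp_all add: mult_le_cancel_right)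
  then show "norm (?T (Abs_ell2 x)) \<le> norm (pi_rep \<theta> f) * norm (Abs_ell2 x)" by (simp add: Ty)
qed simp

text \<open>Since \<open>correl h\<close> has finite support, the symbol is finitely supported for
  every bounded operator \<open>a\<close>, and no extension by continuity is involved.\<close>

definition transfer :: "(int^'d \<Rightarrow> real) \<Rightarrow> real^'d^'d \<Rightarrow> real^'d^'d \<Rightarrow> (int^'d) op \<Rightarrow> (int^'d) op" where
  "transfer h \<theta> \<psi> a = pi_rep \<psi> (\<lambda>p. correl h (\<psi> - \<theta>) p * fourier_coeff a p)"

lemma transfer_Cc: "unit_mass h \<Longrightarrow> (\<lambda>p. correl h \<Delta> p * fourier_coeff a p) \<in> Cc"
  by (rule Cc_mult1[OF correl_Cc])

lemma transfer_add: "unit_mass h \<Longrightarrow> transfer h \<theta> \<psi> (a + b) = transfer h \<theta> \<psi> a + transfer h \<theta> \<psi> b"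
  by (simp add: transfer_def distrib_left pi_rep_add transfer_Cc)

lemma transfer_diff: "unit_mass h \<Longrightarrow> transfer h \<theta> \<psi> (a - b) = transfer h \<theta> \<psi> a - transfer h \<theta> \<psi> b"
  by (simp add: transfer_def right_diff_distrib pi_rep_diff transfer_Cc)

lemma transfer_scaleR: "unit_mass h \<Longrightarrow> transfer h \<theta> \<psi> (r *\<^sub>R a) = r *\<^sub>R transfer h \<theta> \<psi> a"
  by (simp add: transfer_def mult.left_commute pi_rep_scaleR transfer_Cc)

lemma transfer_unit:
  assumes "unit_mass h" "\<psi> \<in> skew_matrices"
  shows "transfer h \<theta> \<psi> id_blinfun = id_blinfun"
proof -
  have "(\<lambda>p. correl h (\<psi> - \<theta>) p * fourier_coeff id_blinfun p) = (\<lambda>p. if p = 0 then 1 else 0)"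
    using correl_0[OF assms(1)] by (auto simp: fun_eq_iff)
  then show ?thesis by (simp add: transfer_def pi_rep_unit[OF assms(2)])
qed

lemma fourier_coeff_transfer:
  "unit_mass h \<Longrightarrow> \<psi> \<in> skew_matrices \<Longrightarrow>
    fourier_coeff (transfer h \<theta> \<psi> a) p = correl h (\<psi> - \<theta>) p * fourier_coeff a p"
  by (simp add: transfer_def fourier_coeff_pi_rep transfer_Cc)

lemma transfer_in_Abar: "unit_mass h \<Longrightarrow> transfer h \<theta> \<psi> a \<in> Abar \<psi>"
  by (simp add: transfer_def pi_rep_in_Abar transfer_Cc)

text \<open>A crude bound by a finite sum of coefficients. It serves for continuity, which then
  extends the contraction estimate from \<open>Cc\<close> to the completion.\<close>

lemma bounded_linear_transfer:
  assumes "unit_mass h"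
  shows "bounded_linear (transfer h \<theta> \<psi>)"
proof (rule bounded_linear_intro)
  let ?g = "correl h (\<psi> - \<theta>)"
  let ?S = "{p. ?g p \<noteq> 0}"
  have S: "finite ?S" using correl_Cc[OF assms] by (simp add: Cc_def)
  fix a
  have "norm (transfer h \<theta> \<psi> a) \<le> (\<Sum>p\<in>?S. cmod (?g p * fourier_coeff a p))"
    unfolding transfer_def by (rule norm_pi_rep_le[OF S]) auto
  also have "\<dots> \<le> (\<Sum>p\<in>?S. norm a * cmod (?g p))"
    by (intro sum_mono) (simp add: norm_mult cmod_fourier_coeff_le mult.commute mult_left_mono)
  finally show "norm (transfer h \<theta> \<psi> a) \<le> norm a * (\<Sum>p\<in>?S. cmod (?g p))"
    by (simp add: sum_distrib_left)
qed (simp_all add: transfer_add transfer_scaleR assms)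

lemma norm_transfer_le:
  assumes "unit_mass h" "\<theta> \<in> skew_matrices" "\<psi> \<in> skew_matrices" "a \<in> Abar \<theta>"
  shows "norm (transfer h \<theta> \<psi> a) \<le> norm a"
  using assms(4)
proof (induction rule: Abar_induct)
  case closed
  show ?case
    by (intro closed_Collect_le continuous_intros
        bounded_linear.continuous_on[OF bounded_linear_transfer[OF assms(1)]])
next
  case (pi_rep f)
  then show ?case
    using norm_pi_rep_correl_le[OF assms(2) skew_diff[OF assms(3,2)] pi_rep assms(1)]
    by (simp add: transfer_def fourier_coeff_pi_rep assms)
qed

lemma transfer_self_adjoint:
  assumes "unit_mass h" "\<theta> \<in> skew_matrices" "\<psi> \<in> skew_matrices" "a \<in> Abar \<theta>" "is_adjoint a a"
  shows "is_adjoint (transfer h \<theta> \<psi> a) (transfer h \<theta> \<psi> a)"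
proof -
  have "star (\<lambda>p. correl h (\<psi> - \<theta>) p * fourier_coeff a p) = (\<lambda>p. correl h (\<psi> - \<theta>) p * fourier_coeff a p)"
    using star_fourier_coeff[OF assms(2,4,5)]
    by (auto simp: star_def fun_eq_iff correl_minus[OF skew_diff[OF assms(3,2)] assms(1)])
  then show ?thesis
    using pi_rep_star[OF assms(3) transfer_Cc[OF assms(1)]] by (metis transfer_def)
qed

subsection \<open>The dual action and its Lip-seminorm\<close>

lemma cinner_commute: "cinner \<eta> \<xi> = cnj (cinner \<xi> \<eta>)"
  unfolding cinner_def infsum_cnj[symmetric] by (simp add: mult.commute)

lemma cinner_add_left: "cinner (\<xi> + \<eta>) \<zeta> = cinner \<xi> \<zeta> + cinner \<eta> \<zeta>"
  unfolding cinner_def ell2_apply_simps distrib_right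
  by (rule infsum_add[OF cinner_summable cinner_summable])

lemma cinner_scaleR_left: "cinner (r *\<^sub>R \<xi>) \<eta> = of_real r * cinner \<xi> \<eta>"
  unfolding cinner_def ell2_apply_simps mult.assoc
  by (rule infsum_cmult_right[OF cinner_summable])

lemma cinner_add_right: "cinner \<zeta> (\<xi> + \<eta>) = cinner \<zeta> \<xi> + cinner \<zeta> \<eta>"
  by (metis cinner_add_left cinner_commute complex_cnj_add)

lemma cinner_scaleR_right: "cinner \<eta> (r *\<^sub>R \<xi>) = of_real r * cinner \<eta> \<xi>"
  by (metis cinner_commute cinner_scaleR_left complex_cnj_complex_of_real complex_cnj_mult)

lemma cinner_zero: "cinner 0 \<xi> = 0" "cinner \<xi> 0 = 0"
  by (simp_all add: cinner_def)

text \<open>The inner product of the type class sees only the real part; the complex Cauchy-Schwarz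
  inequality is obtained from finite sums instead.\<close>

lemma cmod_cinner_le: "cmod (cinner \<xi> \<eta>) \<le> norm \<xi> * norm \<eta>"
proof -
  have L2: "L2_set (\<lambda>p. cmod (ell2_apply \<zeta> p)) F \<le> norm \<zeta>" if "finite F" for F and \<zeta> :: "'a ell2"
    unfolding L2_set_def norm_ell2_def
    by (intro real_sqrt_le_mono finite_sum_le_infsum[OF sq_summable that]) auto
  have s: "(\<lambda>p. norm (ell2_apply \<xi> p * cnj (ell2_apply \<eta> p))) summable_on UNIV"
    by (rule prod_abs_summable[OF sq_summable sq_summable])
  have "cmod (cinner \<xi> \<eta>) \<le> (\<Sum>\<^sub>\<infinity>p. norm (ell2_apply \<xi> p * cnj (ell2_apply \<eta> p)))"
    unfolding cinner_def by (rule norm_infsum_bound[OF s])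
  also have "\<dots> \<le> norm \<xi> * norm \<eta>"
  proof (rule infsum_le_finite_sums[OF s])
    fix F :: "'a set" assume F: "finite F"
    have "(\<Sum>p\<in>F. norm (ell2_apply \<xi> p * cnj (ell2_apply \<eta> p))) \<le>
        L2_set (\<lambda>p. cmod (ell2_apply \<xi> p)) F * L2_set (\<lambda>p. cmod (ell2_apply \<eta> p)) F"
      using L2_set_mult_ineq[of "\<lambda>p. cmod (ell2_apply \<xi> p)" "\<lambda>p. cmod (ell2_apply \<eta> p)" F]
      by (simp add: norm_mult)
    also have "\<dots> \<le> norm \<xi> * norm \<eta>" by (intro mult_mono L2 F) auto
    finally show "(\<Sum>p\<in>F. norm (ell2_apply \<xi> p * cnj (ell2_apply \<eta> p))) \<le> norm \<xi> * norm \<eta>" .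
  qed
  finally show ?thesis .
qed

lemma bounded_linear_cinner_left: "bounded_linear (\<lambda>\<xi>. cinner \<xi> \<eta>)"
  by (rule bounded_linear_intro[of _ "norm \<eta>"])
    (simp_all add: cinner_add_left cinner_scaleR_left scaleR_conv_of_real cmod_cinner_le)

lemma bounded_linear_cinner_right: "bounded_linear (\<lambda>\<xi>. cinner \<eta> \<xi>)"
  by (rule bounded_linear_intro[of _ "norm \<eta>"])
    (use cmod_cinner_le[of \<eta>] in \<open>simp_all add: cinner_add_right cinner_scaleR_right scaleR_conv_of_real mult.commute\<close>)

lemma closed_self_adjoint: "closed {a :: 'i op. is_adjoint a a}"
proof -
  have "closed {a :: 'i op. cinner (a \<xi>) \<eta> = cinner \<xi> (a \<eta>)}" for \<xi> \<eta>
    by (intro closed_Collect_eq bounded_linear.continuous_on[OF bounded_linear_cinner_left]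
        bounded_linear.continuous_on[OF bounded_linear_cinner_right] continuous_intros)
  then show ?thesis unfolding is_adjoint_def by (intro closed_Collect_all)
qed

lemma subspace_self_adjoint: "subspace {a :: 'i op. is_adjoint a a}"
  by (rule subspaceI) (simp_all add: is_adjoint_def blinfun.add_left blinfun.scaleR_left
      cinner_add_left cinner_add_right cinner_scaleR_left cinner_scaleR_right cinner_zero)

lemma is_adjoint_comp: "is_adjoint a a' \<Longrightarrow> is_adjoint b b' \<Longrightarrow> is_adjoint (a o\<^sub>L b) (b' o\<^sub>L a')"
  by (simp add: is_adjoint_def)

lemma is_adjoint_id: "is_adjoint id_blinfun id_blinfun"
  by (simp add: is_adjoint_def)

text \<open>Conjugation by the diagonal unitary with entries \<open>pairing p x\<close> is linear
  and contractive on all bounded operators. It acts as required on \<open>Cc\<close>, so by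
  uniqueness of the continuous extension it is the dual action on
  \<open>Abar \<theta>\<close>.\<close>

lemma ex_dual_action:
  fixes \<theta> :: "real^'d^'d"
  assumes x: "x \<in> carrier torus"
  obtains D :: "(int^'d) op \<Rightarrow> (int^'d) op" where "bounded_linear D" "\<And>a. norm (D a) \<le> norm a"
    "\<And>a p. fourier_coeff (D a) p = pairing p x * fourier_coeff a p"
    "\<And>f. f \<in> Cc \<Longrightarrow> D (pi_rep \<theta> f) = pi_rep \<theta> (dual_action_Cc x f)"
    "\<And>a. a \<in> Abar \<theta> \<Longrightarrow> dual_action \<theta> x a = D a"
proof -
  have ex: "\<exists>U :: (int^'d) op. norm U \<le> 1 \<and> (\<forall>\<xi> p. ell2_apply (blinfun_apply U \<xi>) p = w p * ell2_apply \<xi> p)"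
    if w: "\<And>p. cmod (w p) = 1" for w :: "int^'d \<Rightarrow> complex"
  proof -
    have "\<exists>U :: (int^'d) op. \<forall>\<xi> p. ell2_apply (U \<xi>) p = w p * ell2_apply \<xi> (id p)"
      by (rule weighted_shift[of _ 1]) (simp_all add: w bij_id[unfolded id_def])
    then obtain U :: "(int^'d) op" where U: "\<And>\<xi> p. ell2_apply (blinfun_apply U \<xi>) p = w p * ell2_apply \<xi> p" by auto
    have "norm U \<le> 1"
    proof (rule norm_blinfun_bound)
      fix \<xi>
      have "(norm (U \<xi>))\<^sup>2 = (norm \<xi>)\<^sup>2" by (simp add: norm_ell2_sq U norm_mult w)
      then show "norm (U \<xi>) \<le> 1 * norm \<xi>" by (simp add: power2_eq_imp_eq)
    qed simp
    then show ?thesis using U by blast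
  qed
  obtain U :: "(int^'d) op" where nU: "norm (U :: (int^'d) op) \<le> 1" and U: "\<And>\<xi> p. ell2_apply (blinfun_apply U \<xi>) p = pairing p x * ell2_apply \<xi> p"
    using ex[of "\<lambda>p. pairing p x", OF cmod_pairing[OF x]] by auto
  have "cmod (cnj (pairing p x)) = 1" for p by (simp add: cmod_pairing[OF x])
  then obtain V :: "(int^'d) op" where nV: "norm (V :: (int^'d) op) \<le> 1" and V: "\<And>\<xi> p. ell2_apply (blinfun_apply V \<xi>) p = cnj (pairing p x) * ell2_apply \<xi> p"
    using ex[of "\<lambda>p. cnj (pairing p x)"] by auto
  define D where "D a = U o\<^sub>L (a o\<^sub>L V)" for a
  have blD: "bounded_linear D" unfolding D_def
    by (intro bounded_linear_compose[OF bounded_bilinear.bounded_linear_right[OF bounded_bilinear_blinfun_compose]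
          bounded_bilinear.bounded_linear_left[OF bounded_bilinear_blinfun_compose]])
  have nD: "norm (D a) \<le> norm a" for a
  proof -
    have "norm (D a) \<le> norm U * norm (a o\<^sub>L V)" unfolding D_def by (rule norm_blinfun_compose)
    also have "\<dots> \<le> 1 * (norm a * norm V)" by (intro mult_mono norm_blinfun_compose nU) auto
    also have "\<dots> \<le> 1 * (norm a * 1)" by (intro mult_left_mono nV) auto
    finally show ?thesis by simp
  qed
  have "V (point_vec 0) = point_vec 0"
    by (rule ell2_eqI) (simp add: V pairing_def)
  then have cD: "fourier_coeff (D a) p = pairing p x * fourier_coeff a p" for a p
    by (simp add: fourier_coeff_def D_def U)
  have pD: "D (pi_rep \<theta> f) = pi_rep \<theta> (dual_action_Cc x f)" if "f \<in> Cc" for f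
  proof (intro blinfun_eqI ell2_eqI)
    fix \<xi> p
    have nz: "pairing q x \<noteq> 0" for q using cmod_pairing[OF x, of q] by auto
    have "ell2_apply (D (pi_rep \<theta> f) \<xi>) p =
        (\<Sum>q | f q \<noteq> 0. (pairing p x * cnj (pairing (p - q) x)) * f q * ell2_apply \<xi> (p - q) * bichar \<theta> q p)"
      by (simp add: D_def U pi_rep_apply twisted_conv_def V sum_distrib_left mult_ac)
    then show "ell2_apply (D (pi_rep \<theta> f) \<xi>) p = ell2_apply (pi_rep \<theta> (dual_action_Cc x f) \<xi>) p"
      unfolding pairing_diff[OF x] by (simp add: pi_rep_apply twisted_conv_def dual_action_Cc_def nz)
  qed
  have "dual_action \<theta> x = restrict D (Abar \<theta>)"
    unfolding dual_action_def
  proof (rule the1_equality[OF ex1_dual_action[OF x]], intro conjI ballI)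
    show "continuous_on (Abar \<theta>) (restrict D (Abar \<theta>))"
      using linear_continuous_on[OF blD] by (rule continuous_on_eq) simp
    show "restrict D (Abar \<theta>) (pi_rep \<theta> f) = pi_rep \<theta> (dual_action_Cc x f)" if "f \<in> Cc" for f
      using that by (simp add: pi_rep_in_Abar pD)
  qed simp
  then have "dual_action \<theta> x a = D a" if "a \<in> Abar \<theta>" for a using that by simp
  then show thesis using that blD nD cD pD by blast
qed

lemma dual_action_Cc_in_Cc: "f \<in> Cc \<Longrightarrow> dual_action_Cc x f \<in> Cc"
  unfolding dual_action_Cc_def[abs_def] by (rule Cc_mult2)

lemma dual_action_linear:
  assumes "x \<in> carrier torus" "a \<in> Abar \<theta>" "b \<in> Abar \<theta>"
  shows "dual_action \<theta> x (a + b) = dual_action \<theta> x a + dual_action \<theta> x b"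
    "dual_action \<theta> x (a - b) = dual_action \<theta> x a - dual_action \<theta> x b"
    "dual_action \<theta> x (r *\<^sub>R a) = r *\<^sub>R dual_action \<theta> x a"
proof -
  obtain D where D: "bounded_linear D" "\<And>a. a \<in> Abar \<theta> \<Longrightarrow> dual_action \<theta> x a = D a"
    using ex_dual_action[OF assms(1), where \<theta> = \<theta>] by metis
  have l: "linear D" using D(1) by (rule bounded_linear.linear)
  show "dual_action \<theta> x (a + b) = dual_action \<theta> x a + dual_action \<theta> x b"
    "dual_action \<theta> x (a - b) = dual_action \<theta> x a - dual_action \<theta> x b"
    "dual_action \<theta> x (r *\<^sub>R a) = r *\<^sub>R dual_action \<theta> x a"
    using assms subspace_Abar[of \<theta>]
    by (simp_all add: D(2) subspace_add subspace_diff subspace_scale linear_add[OF l] linear_diff[OF l] linear_cmul[OF l])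
qed

lemma norm_dual_action_le:
  assumes "x \<in> carrier torus" "a \<in> Abar \<theta>"
  shows "norm (dual_action \<theta> x a) \<le> norm a"
  using assms by (metis ex_dual_action)

lemma dual_action_in_Abar:
  assumes "x \<in> carrier torus" "a \<in> Abar \<theta>"
  shows "dual_action \<theta> x a \<in> Abar \<theta>"
proof -
  obtain D where D: "bounded_linear D" "\<And>f. f \<in> Cc \<Longrightarrow> D (pi_rep \<theta> f) = pi_rep \<theta> (dual_action_Cc x f)"
    "\<And>a. a \<in> Abar \<theta> \<Longrightarrow> dual_action \<theta> x a = D a"
    using ex_dual_action[OF assms(1), where \<theta> = \<theta>] by metis
  have "D a \<in> Abar \<theta>" using assms(2)
  proof (induction rule: Abar_induct)
    case closed
    show ?case using continuous_closed_vimage[OF closed_Abar[of \<theta>], of D] linear_continuous_at[OF D(1)]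
      by (simp add: vimage_def)
  qed (simp add: D pi_rep_in_Abar dual_action_Cc_in_Cc)
  then show ?thesis using D assms by simp
qed

lemma fourier_coeff_dual_action:
  assumes "x \<in> carrier torus" "a \<in> Abar \<theta>"
  shows "fourier_coeff (dual_action \<theta> x a) p = pairing p x * fourier_coeff a p"
  using assms by (metis ex_dual_action)

lemma dual_action_pi_rep:
  assumes "x \<in> carrier torus" "f \<in> Cc"
  shows "dual_action \<theta> x (pi_rep \<theta> f) = pi_rep \<theta> (dual_action_Cc x f)"
  using assms by (metis ex_dual_action pi_rep_in_Abar)

lemma torus_one: "\<one>\<^bsub>torus\<^esub> = (\<chi> i. 1)" "(\<chi> i. 1) \<in> carrier torus"
  by (simp_all add: torus_def)

lemma dual_action_one:
  assumes "a \<in> Abar \<theta>"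
  shows "dual_action \<theta> (\<chi> i. 1) a = a"
proof -
  obtain D where D: "bounded_linear D" "\<And>f. f \<in> Cc \<Longrightarrow> D (pi_rep \<theta> f) = pi_rep \<theta> (dual_action_Cc (\<chi> i. 1) f)"
    "\<And>a. a \<in> Abar \<theta> \<Longrightarrow> dual_action \<theta> (\<chi> i. 1) a = D a"
    using ex_dual_action[OF torus_one(2), where \<theta> = \<theta>] by metis
  have "D a = a" using assms
  proof (induction rule: Abar_induct)
    case closed
    show ?case by (intro closed_Collect_eq continuous_intros linear_continuous_on D)
  next
    case (pi_rep f)
    have "dual_action_Cc (\<chi> i. 1) f = f" by (simp add: fun_eq_iff dual_action_Cc_def pairing_def)
    then show ?case using pi_rep D by simp
  qed
  then show ?thesis using D assms by simp
qed

lemma transfer_dual_action: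
  assumes "unit_mass h" "x \<in> carrier torus" "a \<in> Abar \<theta>"
  shows "transfer h \<theta> \<psi> (dual_action \<theta> x a) = dual_action \<psi> x (transfer h \<theta> \<psi> a)"
proof -
  have "(\<lambda>p. correl h (\<psi> - \<theta>) p * fourier_coeff (dual_action \<theta> x a) p) =
      dual_action_Cc x (\<lambda>p. correl h (\<psi> - \<theta>) p * fourier_coeff a p)"
    by (simp add: fun_eq_iff fourier_coeff_dual_action[OF assms(2,3)] dual_action_Cc_def)
  then show ?thesis
    by (simp add: transfer_def dual_action_pi_rep[OF assms(2) transfer_Cc[OF assms(1)]])
qed

section \<open>The Lip-seminorm on self-adjoint elements\<close>

lemma length_functionD:
  assumes "length_function torus len"
  shows "x \<in> carrier torus \<Longrightarrow> 0 \<le> len x"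
    "x \<in> carrier torus \<Longrightarrow> len x = 0 \<longleftrightarrow> x = (\<chi> i. 1)"
  using assms by (auto simp: length_function_def torus_one)

lemma qtorus_carrier_iff:
  "a \<in> carrier (qtorus len \<theta>) \<longleftrightarrow> a \<in> Abar \<theta> \<and> is_adjoint a a \<and> qtorus_seminorm len \<theta> a < \<infinity>"
  by (simp add: qtorus_def)

lemma qtorus_seminorm_nonneg:
  fixes \<theta> :: "real^'d^'d"
  assumes "length_function torus len"
  shows "0 \<le> qtorus_seminorm len \<theta> a"
proof -
  \<comment> \<open>The supremum is taken in the extended reals, where an empty one would be
    negative infinity; a point other than the identity rules this out.\<close>
  let ?x = "(\<chi> i. - 1) :: complex^'d"
  have x: "?x \<in> carrier torus - {\<one>\<^bsub>torus\<^esub>}"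
    by (simp add: torus_def vec_eq_iff)
  have "0 \<le> norm (dual_action \<theta> ?x a - a) / len ?x"
    using length_functionD(1)[OF assms, of ?x] x by simp
  then have "0 \<le> ereal (norm (dual_action \<theta> ?x a - a) / len ?x)" by simp
  also have "\<dots> \<le> qtorus_seminorm len \<theta> a"
    unfolding qtorus_seminorm_def by (rule SUP_upper[OF x])
  finally show ?thesis .
qed

lemma qtorus_seminorm_eq_lip:
  assumes "length_function torus len" "a \<in> carrier (qtorus len \<theta>)"
  shows "qtorus_seminorm len \<theta> a = ereal (qtorus_lip len \<theta> a)"
  unfolding qtorus_lip_def
  using qtorus_seminorm_nonneg[OF assms(1), of \<theta> a] assms(2)
  by (intro ereal_real'[symmetric]) (auto simp: qtorus_carrier_iff)

lemma qtorus_lip_nonneg: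
  assumes "length_function torus len"
  shows "0 \<le> qtorus_lip len \<theta> a"
  unfolding qtorus_lip_def by (rule real_of_ereal_pos[OF qtorus_seminorm_nonneg[OF assms]])

lemma qtorus_lipD:
  assumes "length_function torus len" "a \<in> carrier (qtorus len \<theta>)" "x \<in> carrier torus"
  shows "norm (dual_action \<theta> x a - a) \<le> qtorus_lip len \<theta> a * len x"
proof (cases "x = (\<chi> i. 1)")
  case True
  then show ?thesis using assms(2) length_functionD(2)[OF assms(1,3)]
    by (simp add: dual_action_one qtorus_carrier_iff)
next
  case False
  then have l: "0 < len x" using length_functionD[OF assms(1,3)] by (simp add: less_le)
  have "ereal (norm (dual_action \<theta> x a - a) / len x) \<le> qtorus_seminorm len \<theta> a"
    unfolding qtorus_seminorm_def using False assms(3) by (intro SUP_upper) (simp add: torus_one)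
  then show ?thesis using l by (simp add: qtorus_seminorm_eq_lip[OF assms(1,2)] divide_le_eq)
qed

lemma qtorus_lipI:
  assumes "length_function torus len" "a \<in> Abar \<theta>" "is_adjoint a a"
    and le: "\<And>x. x \<in> carrier torus \<Longrightarrow> norm (dual_action \<theta> x a - a) \<le> C * len x"
  shows "a \<in> carrier (qtorus len \<theta>)" "qtorus_lip len \<theta> a \<le> C"
proof -
  have "qtorus_seminorm len \<theta> a \<le> ereal C"
    unfolding qtorus_seminorm_def
  proof (rule SUP_least)
    fix x assume "x \<in> carrier torus - {\<one>\<^bsub>torus\<^esub> :: complex^'a}"
    then have x: "x \<in> carrier torus" "x \<noteq> (\<chi> i. 1)" by (auto simp: torus_one)
    then have "0 < len x" using length_functionD[OF assms(1) x(1)] by (simp add: less_le)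
    then show "ereal (norm (dual_action \<theta> x a - a) / len x) \<le> ereal C"
      using le[OF x(1)] by (simp add: divide_le_eq)
  qed
  moreover from this show c: "a \<in> carrier (qtorus len \<theta>)"
    using assms by (auto simp: qtorus_carrier_iff)
  ultimately show "qtorus_lip len \<theta> a \<le> C"
    using qtorus_seminorm_eq_lip[OF assms(1) c] by simp
qed

lemma qtorus_lip_add:
  assumes len: "length_function torus len" and a: "a \<in> carrier (qtorus len \<theta>)" and b: "b \<in> carrier (qtorus len \<theta>)"
  shows "a + b \<in> carrier (qtorus len \<theta>)"
    "qtorus_lip len \<theta> (a + b) \<le> qtorus_lip len \<theta> a + qtorus_lip len \<theta> b"
proof -
  note ab = a b
  have A: "a \<in> Abar \<theta>" "b \<in> Abar \<theta>" using ab by (auto simp: qtorus_carrier_iff)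
  have s: "a + b \<in> Abar \<theta>" "is_adjoint (a + b) (a + b)"
    using subspace_add[OF subspace_self_adjoint] ab by (auto simp: subspace_add[OF subspace_Abar] qtorus_carrier_iff)
  have le: "norm (dual_action \<theta> x (a + b) - (a + b)) \<le> (qtorus_lip len \<theta> a + qtorus_lip len \<theta> b) * len x"
    if x: "x \<in> carrier torus" for x
  proof -
    have e: "dual_action \<theta> x (a + b) - (a + b) = (dual_action \<theta> x a - a) + (dual_action \<theta> x b - b)"
      by (simp add: dual_action_linear(1)[OF x A])
    show ?thesis unfolding e using norm_triangle_mono[OF qtorus_lipD[OF len a x] qtorus_lipD[OF len b x]]
      by (simp add: distrib_right)
  qed
  show "a + b \<in> carrier (qtorus len \<theta>)"
    "qtorus_lip len \<theta> (a + b) \<le> qtorus_lip len \<theta> a + qtorus_lip len \<theta> b"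
    using qtorus_lipI[OF len s le] by auto
qed

lemma qtorus_lip_scaleR:
  assumes len: "length_function torus len" and a: "a \<in> carrier (qtorus len \<theta>)"
  shows "r *\<^sub>R a \<in> carrier (qtorus len \<theta>)" "qtorus_lip len \<theta> (r *\<^sub>R a) = \<bar>r\<bar> * qtorus_lip len \<theta> a"
proof -
  \<comment> \<open>Only an inequality is proved directly; applied to \<open>1 / r\<close> it gives
    the reverse one.\<close>
  have 1: "r *\<^sub>R a \<in> carrier (qtorus len \<theta>) \<and> qtorus_lip len \<theta> (r *\<^sub>R a) \<le> \<bar>r\<bar> * qtorus_lip len \<theta> a"
    if a: "a \<in> carrier (qtorus len \<theta>)" for r a
  proof -
    have A: "a \<in> Abar \<theta>" using a by (auto simp: qtorus_carrier_iff)
    have s: "r *\<^sub>R a \<in> Abar \<theta>" "is_adjoint (r *\<^sub>R a) (r *\<^sub>R a)"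
      using subspace_scale[OF subspace_self_adjoint] a by (auto simp: subspace_scale[OF subspace_Abar] qtorus_carrier_iff)
    have le: "norm (dual_action \<theta> x (r *\<^sub>R a) - r *\<^sub>R a) \<le> (\<bar>r\<bar> * qtorus_lip len \<theta> a) * len x"
      if x: "x \<in> carrier torus" for x
      using mult_left_mono[OF qtorus_lipD[OF len a x] abs_ge_zero[of r]]
      by (simp add: dual_action_linear(3)[OF x A A] mult.assoc flip: scaleR_diff_right)
    show ?thesis using qtorus_lipI[OF len s le] by auto
  qed
  show c: "r *\<^sub>R a \<in> carrier (qtorus len \<theta>)" using 1 a by blast
  show "qtorus_lip len \<theta> (r *\<^sub>R a) = \<bar>r\<bar> * qtorus_lip len \<theta> a"
  proof (cases "r = 0")
    case True
    then show ?thesis using 1[OF a, of 0] qtorus_lip_nonneg[OF len, of \<theta> 0] by simp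
  next
    case False
    have "qtorus_lip len \<theta> a \<le> \<bar>1 / r\<bar> * qtorus_lip len \<theta> (r *\<^sub>R a)"
      using 1[OF c, of "1 / r"] False by simp
    then have "\<bar>r\<bar> * qtorus_lip len \<theta> a \<le> qtorus_lip len \<theta> (r *\<^sub>R a)" using False by (simp add: field_simps)
    then show ?thesis using 1[OF a, of r] by simp
  qed
qed

lemma id_in_qtorus:
  assumes len: "length_function torus len" and \<theta>: "\<theta> \<in> skew_matrices"
  shows "id_blinfun \<in> carrier (qtorus len \<theta>)" "qtorus_lip len \<theta> id_blinfun = 0"
proof -
  let ?d = "\<lambda>p :: int^'a. if p = 0 then 1 else (0 :: complex)"
  have d: "?d \<in> Cc" by (simp add: Cc_def)
  have "dual_action_Cc x ?d = ?d" for x by (auto simp: fun_eq_iff dual_action_Cc_def pairing_def)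
  then have "dual_action \<theta> x id_blinfun = id_blinfun" if "x \<in> carrier torus" for x
    using dual_action_pi_rep[OF that d, of \<theta>] by (simp add: pi_rep_unit[OF \<theta>])
  then have le: "norm (dual_action \<theta> x id_blinfun - id_blinfun) \<le> 0 * len x" if "x \<in> carrier torus" for x
    using that by simp
  show "id_blinfun \<in> carrier (qtorus len \<theta>)" "qtorus_lip len \<theta> id_blinfun = 0"
    using qtorus_lipI[OF len id_in_Abar[OF \<theta>] is_adjoint_id le] qtorus_lip_nonneg[OF len] by (auto intro: antisym)
qed

lemma subspace_qtorus:
  assumes len: "length_function torus len" and \<theta>: "\<theta> \<in> skew_matrices"
  shows "subspace (carrier (qtorus len \<theta>))"
  using qtorus_lip_scaleR(1)[OF len id_in_qtorus(1)[OF len \<theta>], of 0]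
  by (intro subspaceI) (simp_all add: qtorus_lip_add[OF len] qtorus_lip_scaleR[OF len])

lemma seminorm_on_qtorus_lip:
  assumes "length_function torus len"
  shows "seminorm_on (carrier (qtorus len \<theta>)) (qtorus_lip len \<theta>)"
  by (simp add: seminorm_on_def qtorus_lip_nonneg qtorus_lip_add(2) qtorus_lip_scaleR(2) assms)

text \<open>A translate minus the element itself is carried to the same difference for \<psi>, and
  the transfer is a contraction, so the Lipschitz constant cannot grow.\<close>

lemma transfer_lip:
  assumes len: "length_function torus len" and h: "unit_mass h"
    and \<theta>: "\<theta> \<in> skew_matrices" and \<psi>: "\<psi> \<in> skew_matrices" and a: "a \<in> carrier (qtorus len \<theta>)"
  shows "transfer h \<theta> \<psi> a \<in> carrier (qtorus len \<psi>)"
    "qtorus_lip len \<psi> (transfer h \<theta> \<psi> a) \<le> qtorus_lip len \<theta> a"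
proof -
  have A: "a \<in> Abar \<theta>" "is_adjoint a a" using a by (auto simp: qtorus_carrier_iff)
  have le: "norm (dual_action \<psi> x (transfer h \<theta> \<psi> a) - transfer h \<theta> \<psi> a) \<le> qtorus_lip len \<theta> a * len x"
    if x: "x \<in> carrier torus" for x
  proof -
    have "dual_action \<psi> x (transfer h \<theta> \<psi> a) - transfer h \<theta> \<psi> a = transfer h \<theta> \<psi> (dual_action \<theta> x a - a)"
      by (simp add: transfer_diff[OF h] transfer_dual_action[OF h x A(1)])
    also have "norm \<dots> \<le> norm (dual_action \<theta> x a - a)"
      by (intro norm_transfer_le[OF h \<theta> \<psi>] subspace_diff[OF subspace_Abar] dual_action_in_Abar[OF x A(1)] A(1))
    finally show ?thesis using qtorus_lipD[OF len a x] by simp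
  qed
  show "transfer h \<theta> \<psi> a \<in> carrier (qtorus len \<psi>)"
    "qtorus_lip len \<psi> (transfer h \<theta> \<psi> a) \<le> qtorus_lip len \<theta> a"
    using qtorus_lipI[OF len transfer_in_Abar[OF h] transfer_self_adjoint[OF h \<theta> \<psi> A] le] by auto
qed

subsection \<open>Averages against Fejer kernels\<close>

definition root_point :: "nat \<Rightarrow> ('d \<Rightarrow> nat) \<Rightarrow> complex^'d" where
  "root_point n k = (\<chi> i. cis (2 * pi * real (k i) / real n))"

definition root_index :: "nat \<Rightarrow> ('d::finite \<Rightarrow> nat) set" where
  "root_index n = Pi\<^sub>E UNIV (\<lambda>_. {..<n})"

lemma root_point_in_torus: "root_point n k \<in> carrier torus"
  by (simp add: root_point_def torus_def)

lemma finite_root_index [simp]: "finite (root_index n)"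
  unfolding root_index_def by (rule finite_PiE) auto

text \<open>A geometric sum over an \<open>n\<close>-th root of unity; the bound on \<open>m\<close>
  keeps this root different from 1.\<close>

lemma sum_cis_power:
  assumes "0 < n" "\<bar>m\<bar> < int n" "m \<noteq> 0"
  shows "(\<Sum>j<n. cis (2 * pi * of_int m / real n) ^ j) = 0"
proof -
  let ?z = "cis (2 * pi * of_int m / real n)"
  have "?z \<noteq> 1"
  proof
    assume "?z = 1"
    then have "cos (2 * pi * of_int m / real n) = 1" by (metis cis.simps(1) one_complex.simps(1))
    then obtain l :: int where "2 * pi * of_int m / real n = of_int l * 2 * pi"
      unfolding cos_one_2pi_int by blast
    then have "real_of_int m = real_of_int (l * int n)" using assms(1) by (simp add: field_simps)
    then have m: "m = l * int n" unfolding of_int_eq_iff .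
    then have "int n dvd m" by simp
    then show False using assms(2,3) zdvd_not_zless[of "\<bar>m\<bar>" "int n"] by simp
  qed
  moreover have "?z ^ n = 1"
  proof -
    have "?z ^ n = cis (2 * pi * of_int m)" unfolding Complex.DeMoivre using assms(1) by simp
    also have "\<dots> = 1" by (rule cis_multiple_2pi) simp
    finally show ?thesis .
  qed
  ultimately show ?thesis by (simp add: geometric_sum)
qed

text \<open>Orthogonality of characters on the group of \<open>n\<close>-th roots, one coordinate at
  a time. The bound on the entries of \<open>p\<close> prevents aliasing.\<close>

lemma sum_pairing_root_point:
  fixes p :: "int^'d"
  assumes "0 < n" "\<And>i. \<bar>p $ i\<bar> < int n"
  shows "(\<Sum>k\<in>root_index n. pairing p (root_point n k)) = (if p = 0 then of_nat (n ^ CARD('d)) else 0)"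
proof -
  have "(\<Sum>k\<in>root_index n. pairing p (root_point n k)) =
      (\<Sum>k\<in>root_index n. \<Prod>i\<in>UNIV. cis (2 * pi * of_int (p $ i) / real n) ^ k i)"
    unfolding pairing_def root_point_def
    by (intro sum.cong prod.cong refl) (simp only: vec_lambda_beta cis_power_int Complex.DeMoivre, simp add: mult_ac)
  also have "\<dots> = (\<Prod>i\<in>UNIV. \<Sum>j<n. cis (2 * pi * of_int (p $ i) / real n) ^ j)"
    unfolding root_index_def by (rule prod_sum_PiE[symmetric]) auto
  also have "\<dots> = (if p = 0 then of_nat (n ^ CARD('d)) else 0)"
  proof (cases "p = 0")
    case True then show ?thesis by simp
  next
    case False
    then obtain i where "p $ i \<noteq> 0" by (auto simp: vec_eq_iff)
    then have "(\<Sum>j<n. cis (2 * pi * of_int (p $ i) / real n) ^ j) = 0"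
      by (rule sum_cis_power[OF assms])
    then show ?thesis using False by (subst prod_zero) auto
  qed
  finally show ?thesis .
qed

lemma pairing_0 [simp]: "pairing 0 x = 1"
  by (simp add: pairing_def)

lemma pairing_diff_cnj:
  assumes "x \<in> carrier torus"
  shows "pairing (p - q) x = pairing p x * cnj (pairing q x)"
proof -
  have "pairing p x * cnj (pairing q x) = pairing (p - q) x"
    using pairing_diff[OF assms, of p "p - q"] by simp
  then show ?thesis by simp
qed

text \<open>
  The sum equals \<open>\<Sum>\<^sub>u \<bar>\<Sum>\<^sub>s h s h (s + u) bichar \<Delta> s u cnj (pairing s x)\<bar>\<^sup>2\<close>.
\<close>

lemma fejer_nonneg:
  fixes h :: "int^'d \<Rightarrow> real"
  assumes \<Delta>: "\<Delta> \<in> skew_matrices" and h: "unit_mass h" and x: "x \<in> carrier torus"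
  shows "\<exists>c\<ge>0. (\<Sum>r | correl h \<Delta> r \<noteq> 0.
    correl h \<Delta> r * cnj (correl h \<Delta> r) * cnj (pairing r x)) = of_real c"
proof -
  define H where "H = {s. h s \<noteq> 0}"
  have H: "finite H" using h by (simp add: H_def unit_mass_def)
  \<comment> \<open>The difference set of the support. For each \<open>s\<close> in \<open>H\<close>
    every point of \<open>H\<close> has the form \<open>s + u\<close>, and also
    \<open>s - r\<close>, with \<open>u\<close> and \<open>r\<close> in \<open>S\<close>.\<close>
  define S where "S = (\<lambda>(s, t). s - t) ` (H \<times> H)"
  have S: "finite S" using H by (simp add: S_def)
  have HS: "s - t \<in> S" if "s \<in> H" "t \<in> H" for s t
    using that by (auto simp: S_def)
  have Hr: "complex_of_real (h s) = 0" if "s \<notin> H" for s using that by (simp add: H_def)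
  have co: "correl h \<Delta> r = (\<Sum>s\<in>H. of_real (h s * h (s - r)) * cnj (bichar \<Delta> r s))" for r
    by (simp add: correl_def H_def)
  have supp: "{r. correl h \<Delta> r \<noteq> 0} \<subseteq> S"
  proof (rule subsetI, rule ccontr)
    fix r assume r: "r \<in> {r. correl h \<Delta> r \<noteq> 0}" "r \<notin> S"
    have "of_real (h s * h (s - r)) * cnj (bichar \<Delta> r s) = 0" if "s \<in> H" for s
      using HS[OF that, of "s - r"] r(2) by (auto simp: H_def)
    then have "correl h \<Delta> r = 0" unfolding co by (rule sum.neutral[rule_format])
    then show False using r by simp
  qed
  have shift1: "(\<Sum>s'\<in>H. F s') = (\<Sum>u\<in>S. F (s + u))" if "s \<in> H" "\<And>s'. s' \<notin> H \<Longrightarrow> F s' = 0" for F :: "int^'d \<Rightarrow> complex" and s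
    by (rule sum.reindex_bij_witness_not_neutral[of "{}" "{u \<in> S. s + u \<notin> H}" _ "\<lambda>u. s + u" "\<lambda>s'. s' - s"])
      (use that H S HS in auto)
  have shift2: "(\<Sum>r\<in>S. F (s - r)) = (\<Sum>t\<in>H. F t)" if "s \<in> H" "\<And>s'. s' \<notin> H \<Longrightarrow> F s' = 0" for F :: "int^'d \<Rightarrow> complex" and s
    by (rule sum.reindex_bij_witness_not_neutral[of "{r \<in> S. s - r \<notin> H}" "{}" _ "\<lambda>t. s - t" "\<lambda>r. s - r"])
      (use that H S HS in auto)
  define w where "w u s = of_real (h s * h (s + u)) * bichar \<Delta> s u * cnj (pairing s x)" for u s
  have w0: "w u s = 0" if "s \<notin> H" for u s using that by (simp add: w_def H_def)
  have key: "correl h \<Delta> r * cnj (correl h \<Delta> r) * cnj (pairing r x) =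
      (\<Sum>s\<in>H. \<Sum>u\<in>S. w u s * cnj (w u (s - r)))" for r
  proof -
    have "correl h \<Delta> r * cnj (correl h \<Delta> r) * cnj (pairing r x) =
        (\<Sum>s\<in>H. \<Sum>s'\<in>H. of_real (h s * h (s - r)) * cnj (bichar \<Delta> r s) *
          (of_real (h s' * h (s' - r)) * bichar \<Delta> r s') * cnj (pairing r x))"
      unfolding co cnj_sum unfolding sum_product unfolding sum_distrib_right by (intro sum.cong refl) simp
    also have "\<dots> = (\<Sum>s\<in>H. \<Sum>u\<in>S. of_real (h s * h (s - r)) * cnj (bichar \<Delta> r s) *
          (of_real (h (s + u) * h (s + u - r)) * bichar \<Delta> r (s + u)) * cnj (pairing r x))"
      by (rule sum.cong[OF refl], rule shift1) (auto simp: H_def)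
    also have "\<dots> = (\<Sum>s\<in>H. \<Sum>u\<in>S. w u s * cnj (w u (s - r)))"
    proof (intro sum.cong refl)
      fix s u
      have p: "cnj (pairing r x) = cnj (pairing s x) * pairing (s - r) x"
        using pairing_diff_cnj[OF x, of s "s - r"] by simp
      \<comment> \<open>Both sides equal \<open>bichar \<Delta> r u\<close>; the right one separates
        \<open>s\<close> from \<open>s - r\<close>.\<close>
      have b: "cnj (bichar \<Delta> r s) * bichar \<Delta> r (s + u) = bichar \<Delta> s u * cnj (bichar \<Delta> (s - r) u)"
        using bichar_mult_cnj(1)[of \<Delta> r s] bichar_mult_cnj(1)[of \<Delta> s u]
        by (simp add: bichar_add_right bichar_diff_left mult_ac)
      have e: "s - r + u = s + u - r" by simp
      show "of_real (h s * h (s - r)) * cnj (bichar \<Delta> r s) *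
          (of_real (h (s + u) * h (s + u - r)) * bichar \<Delta> r (s + u)) * cnj (pairing r x) =
          w u s * cnj (w u (s - r))"
      proof -
        have "of_real (h s * h (s - r)) * cnj (bichar \<Delta> r s) *
          (of_real (h (s + u) * h (s + u - r)) * bichar \<Delta> r (s + u)) * cnj (pairing r x) =
          of_real (h s * h (s - r) * (h (s + u) * h (s + u - r))) *
          (cnj (bichar \<Delta> r s) * bichar \<Delta> r (s + u)) * cnj (pairing r x)" by (simp add: mult_ac)
        also have "\<dots> = w u s * cnj (w u (s - r))"
          unfolding b p w_def e by (simp add: mult_ac)
        finally show ?thesis .
      qed
    qed
    finally show ?thesis .
  qed
  have "(\<Sum>r | correl h \<Delta> r \<noteq> 0. correl h \<Delta> r * cnj (correl h \<Delta> r) * cnj (pairing r x)) =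
      (\<Sum>r\<in>S. correl h \<Delta> r * cnj (correl h \<Delta> r) * cnj (pairing r x))"
    by (rule sum.mono_neutral_left[OF S supp]) auto
  also have "\<dots> = (\<Sum>s\<in>H. \<Sum>u\<in>S. \<Sum>r\<in>S. w u s * cnj (w u (s - r)))"
    unfolding key by (subst sum.swap, rule sum.cong[OF refl], rule sum.swap)
  \<comment> \<open>For fixed \<open>s\<close> and \<open>u\<close> the point
    \<open>t = s - r\<close> covers the support, whatever \<open>s\<close> is; this completes the
    square.\<close>
  also have "\<dots> = (\<Sum>s\<in>H. \<Sum>u\<in>S. \<Sum>t\<in>H. w u s * cnj (w u t))"
  proof (rule sum.cong[OF refl], rule sum.cong[OF refl])
    fix s u assume "s \<in> H"
    then show "(\<Sum>r\<in>S. w u s * cnj (w u (s - r))) = (\<Sum>t\<in>H. w u s * cnj (w u t))"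
      by (rule shift2) (simp add: w0)
  qed
  also have "\<dots> = (\<Sum>u\<in>S. \<Sum>s\<in>H. \<Sum>t\<in>H. w u s * cnj (w u t))" by (rule sum.swap)
  also have "\<dots> = (\<Sum>u\<in>S. (\<Sum>s\<in>H. w u s) * cnj (\<Sum>s\<in>H. w u s))"
    by (simp add: sum_product)
  also have "\<dots> = of_real (\<Sum>u\<in>S. (cmod (\<Sum>s\<in>H. w u s))\<^sup>2)"
    by (simp only: of_real_sum complex_norm_square)
  finally show ?thesis
    by (intro exI[of _ "\<Sum>u\<in>S. (cmod (\<Sum>s\<in>H. w u s))\<^sup>2"] conjI) (simp_all only: sum_nonneg zero_le_power2)
qed

lemma obtain_root_order:
  fixes P S :: "(int^'d) set"
  assumes "finite P" "finite S"
  obtains n where "0 < n" "\<And>p r i. p \<in> P \<Longrightarrow> r \<in> S \<Longrightarrow> \<bar>(p - r) $ i\<bar> < int n"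
proof -
  let ?N = "(\<lambda>(p, r, i). nat \<bar>(p - r) $ i\<bar>) ` (P \<times> S \<times> (UNIV :: 'd set))"
  have "finite ?N" using assms by simp
  then obtain m where m: "\<And>j. j \<in> ?N \<Longrightarrow> j < m" unfolding finite_nat_set_iff_bounded by blast
  have "\<bar>(p - r) $ i\<bar> < int (Suc m)" if "p \<in> P" "r \<in> S" for p r i
  proof -
    have "nat \<bar>(p - r) $ i\<bar> \<in> ?N" using that by (intro image_eqI[where x = "(p, r, i)"]) auto
    then show ?thesis using m by fastforce
  qed
  then show thesis using that[of "Suc m"] by blast
qed

text \<open>
  For finitely many frequencies the average over the \<open>n\<close>-th roots of unity agrees with the integral
  over the torus once \<open>n\<close> is large.
\<close>

lemma fejer_average:
  fixes h :: "int^'d \<Rightarrow> real"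
  assumes \<Delta>: "\<Delta> \<in> skew_matrices" and h: "unit_mass h" and P: "finite P"
  shows "\<exists>n>0. \<exists>\<phi>. (\<forall>k. 0 \<le> \<phi> k) \<and>
    (\<forall>p\<in>P. (\<Sum>k\<in>root_index n. of_real (\<phi> k) * pairing p (root_point n k)) =
       of_nat (n ^ CARD('d)) * (cnj (correl h \<Delta> p) * correl h \<Delta> p))"
proof -
  let ?S = "{r. correl h \<Delta> r \<noteq> 0}"
  let ?m = "\<lambda>r. correl h \<Delta> r * cnj (correl h \<Delta> r)"
  have S: "finite ?S" using correl_Cc[OF h] by (simp add: Cc_def)
  obtain n where n: "0 < n" "\<And>p r i. p \<in> P \<Longrightarrow> r \<in> ?S \<Longrightarrow> \<bar>(p - r) $ i\<bar> < int n"
    using obtain_root_order[OF P S] by blast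
  have "\<exists>c\<ge>0. (\<Sum>r\<in>?S. ?m r * cnj (pairing r (root_point n k))) = of_real c" for k
    by (rule fejer_nonneg[OF \<Delta> h root_point_in_torus])
  then obtain \<phi> where \<phi>: "\<And>k. 0 \<le> \<phi> k" "\<And>k. (\<Sum>r\<in>?S. ?m r * cnj (pairing r (root_point n k))) = of_real (\<phi> k)"
    by metis
  have "(\<Sum>k\<in>root_index n. of_real (\<phi> k) * pairing p (root_point n k)) =
      of_nat (n ^ CARD('d)) * (cnj (correl h \<Delta> p) * correl h \<Delta> p)" if p: "p \<in> P" for p
  proof -
    have "(\<Sum>k\<in>root_index n. of_real (\<phi> k) * pairing p (root_point n k)) =
        (\<Sum>k\<in>root_index n. \<Sum>r\<in>?S. ?m r * pairing (p - r) (root_point n k))"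
      unfolding \<phi>(2)[symmetric] sum_distrib_right
      by (intro sum.cong refl) (simp add: pairing_diff_cnj[OF root_point_in_torus] mult_ac)
    also have "\<dots> = (\<Sum>r\<in>?S. ?m r * (\<Sum>k\<in>root_index n. pairing (p - r) (root_point n k)))"
      by (subst sum.swap) (simp only: sum_distrib_left)
    also have "\<dots> = (\<Sum>r\<in>?S. if r = p then ?m p * of_nat (n ^ CARD('d)) else 0)"
      by (intro sum.cong refl, subst sum_pairing_root_point[OF n(1) n(2)[OF p]]) auto
    also have "\<dots> = of_nat (n ^ CARD('d)) * (cnj (correl h \<Delta> p) * correl h \<Delta> p)"
      using S by (simp add: mult_ac)
    finally show ?thesis .
  qed
  then show ?thesis using n(1) \<phi>(1) by blast
qed

text \<open>In this form the average of the squared distance to the identity depends only on the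
  moments at the basis vectors.\<close>

lemma norm_torus_minus_one:
  assumes "x \<in> carrier torus"
  shows "(norm (x - (\<chi> i. 1)))\<^sup>2 = (\<Sum>i\<in>UNIV. 2 * (1 - Re (pairing (axis i 1) x)))"
proof -
  have "pairing (axis i 1) x = x $ i" for i
  proof -
    have "pairing (axis i 1) x = (\<Prod>j\<in>UNIV. if j = i then x $ j else 1)"
      unfolding pairing_def by (rule prod.cong) (auto simp: axis_def)
    then show ?thesis by simp
  qed
  moreover have "(cmod (x $ i - 1))\<^sup>2 = 2 * (1 - Re (x $ i))" for i
  proof -
    have "(Re (x $ i))\<^sup>2 + (Im (x $ i))\<^sup>2 = 1"
      using assms by (simp add: torus_def flip: cmod_power2)
    then show ?thesis by (simp add: cmod_power2 power2_diff)
  qed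
  moreover have "(norm (x - (\<chi> i. 1)))\<^sup>2 = (\<Sum>i\<in>UNIV. (cmod (x $ i - 1))\<^sup>2)"
    by (simp add: norm_vec_def L2_set_def sum_nonneg)
  ultimately show ?thesis by simp
qed

text \<open>The round trip averages translates with nonnegative weights, so its defect is an average
  of differences, each bounded by the Lip-seminorm times \<open>len x\<close>. The assumed bound on
  \<open>len\<close> converts the average of \<open>len\<close> into the moments at the basis
  vectors.\<close>

lemma norm_transfer_transfer_le:
  fixes h :: "int^'d \<Rightarrow> real"
  assumes len: "length_function torus len" and C: "0 \<le> C"
    and bound: "\<And>x. x \<in> carrier torus \<Longrightarrow> len x \<le> \<eta> + C * (norm (x - (\<chi> i. 1)))\<^sup>2"
    and h: "unit_mass h" and \<theta>: "\<theta> \<in> skew_matrices" and \<psi>: "\<psi> \<in> skew_matrices"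
    and a: "a \<in> carrier (qtorus len \<theta>)"
  shows "norm (a - transfer h \<psi> \<theta> (transfer h \<theta> \<psi> a)) \<le> qtorus_lip len \<theta> a *
    (\<eta> + C * (\<Sum>i\<in>UNIV. 2 * (1 - (cmod (correl h (\<psi> - \<theta>) (axis i 1)))\<^sup>2)))"
    (is "_ \<le> _ * ?X")
proof (rule field_le_epsilon)
  fix e :: real assume e: "0 < e"
  let ?L = "qtorus_lip len \<theta> a" and ?\<Delta> = "\<psi> - \<theta>"
  let ?m = "\<lambda>p. cnj (correl h ?\<Delta> p) * correl h ?\<Delta> p"
  define Q where "Q a = transfer h \<psi> \<theta> (transfer h \<theta> \<psi> a)" for a
  have \<Delta>: "?\<Delta> \<in> skew_matrices" by (rule skew_diff[OF \<psi> \<theta>])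
  have A: "a \<in> Abar \<theta>" using a by (simp add: qtorus_carrier_iff)
  \<comment> \<open>A root average is exact for finitely many frequencies only, so a trigonometric
    polynomial \<open>b\<close> stands in for \<open>a\<close>. Two errors \<open>e / 4\<close>
    enter the estimate for \<open>b\<close>, two more the return to \<open>a\<close>.\<close>
  obtain f where f: "f \<in> Cc" "norm (a - pi_rep \<theta> f) < e / 4"
    using Abar_approx[OF A, of "e / 4"] e by auto
  define b where "b = pi_rep \<theta> f"
  have B: "b \<in> Abar \<theta>" using f by (simp add: b_def pi_rep_in_Abar)
  have ab: "a - b \<in> Abar \<theta>" by (rule subspace_diff[OF subspace_Abar A B])
  have Qd: "Q (a - b) = Q a - Q b" by (simp add: Q_def transfer_diff[OF h])
  have nQ: "norm (Q (a - b)) \<le> norm (a - b)"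
    unfolding Q_def
    by (rule order_trans[OF norm_transfer_le[OF h \<psi> \<theta> transfer_in_Abar[OF h]] norm_transfer_le[OF h \<theta> \<psi> ab]])
  have mf: "(\<lambda>p. ?m p * f p) \<in> Cc" by (rule Cc_mult2[OF f(1)])
  have "correl h (\<theta> - \<psi>) p = cnj (correl h ?\<Delta> p)" for p
    using correl_uminus_matrix[of h ?\<Delta> p] by simp
  then have Qb: "Q b = pi_rep \<theta> (\<lambda>p. ?m p * f p)"
    unfolding Q_def b_def transfer_def[of h \<psi> \<theta>] fourier_coeff_transfer[OF h \<psi>]
    by (simp add: fourier_coeff_pi_rep[OF \<theta> f(1)] mult.assoc)
  \<comment> \<open>Frequency 0 yields the total mass, the basis vectors the moments, and the
    support of \<open>f\<close> the round trip of \<open>b\<close>.\<close>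
  define P where "P = insert 0 ({p. f p \<noteq> 0} \<union> range (\<lambda>i :: 'd. axis i 1))"
  have P: "finite P" using f by (simp add: P_def Cc_def)
  obtain n \<phi> where n: "0 < n" and \<phi>: "\<And>k. 0 \<le> \<phi> k"
    and avg: "\<And>p. p \<in> P \<Longrightarrow> (\<Sum>k\<in>root_index n. of_real (\<phi> k) * pairing p (root_point n k)) =
       of_nat (n ^ CARD('d)) * ?m p"
    using fejer_average[OF \<Delta> h P] by blast
  let ?K = "root_index n :: ('d \<Rightarrow> nat) set" and ?x = "root_point n :: ('d \<Rightarrow> nat) \<Rightarrow> complex^'d"
  let ?N = "real (n ^ CARD('d))"
  have N: "0 < ?N" using n by simp
  have mass: "(\<Sum>k\<in>?K. \<phi> k) = ?N"
  proof -
    have "(\<Sum>k\<in>?K. complex_of_real (\<phi> k)) = of_real ?N"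
      using avg[of 0] by (simp add: P_def correl_0[OF h])
    then show ?thesis unfolding of_real_sum[symmetric] of_real_eq_iff .
  qed
  have mom: "(\<Sum>k\<in>?K. \<phi> k * Re (pairing (axis i 1) (?x k))) = ?N * (cmod (correl h ?\<Delta> (axis i 1)))\<^sup>2" for i
  proof -
    have "axis i 1 \<in> P" by (simp add: P_def)
    note av = avg[OF this]
    have "?m (axis i 1) = of_real ((cmod (correl h ?\<Delta> (axis i 1)))\<^sup>2)"
      by (simp only: complex_norm_square mult.commute)
    with arg_cong[OF av, of Re] show ?thesis by (simp add: Re_sum del: of_real_power)
  qed
  have sumlen: "(\<Sum>k\<in>?K. \<phi> k * len (?x k)) \<le> ?N * ?X"
  proof -
    have "(\<Sum>k\<in>?K. \<phi> k * len (?x k)) \<le>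
        (\<Sum>k\<in>?K. \<phi> k * (\<eta> + C * (\<Sum>i\<in>UNIV. 2 * (1 - Re (pairing (axis i 1) (?x k))))))"
      using bound[OF root_point_in_torus] \<phi>
      by (intro sum_mono mult_left_mono) (simp_all add: norm_torus_minus_one[OF root_point_in_torus])
    also have "\<dots> = \<eta> * (\<Sum>k\<in>?K. \<phi> k) +
        C * (\<Sum>i\<in>UNIV. \<Sum>k\<in>?K. 2 * (\<phi> k - \<phi> k * Re (pairing (axis i 1) (?x k))))"
      unfolding sum.swap[of _ ?K UNIV] sum_distrib_left sum.distrib[symmetric]
      by (intro sum.cong refl) (simp add: algebra_simps sum_distrib_left)
    also have "(\<lambda>i. \<Sum>k\<in>?K. 2 * (\<phi> k - \<phi> k * Re (pairing (axis i 1) (?x k)))) =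
        (\<lambda>i. ?N * (2 * (1 - (cmod (correl h ?\<Delta> (axis i 1)))\<^sup>2)))"
      unfolding sum_distrib_left[symmetric] sum_subtractf mass mom by (simp add: algebra_simps)
    also have "\<eta> * (\<Sum>k\<in>?K. \<phi> k) + C * (\<Sum>i\<in>UNIV. ?N * (2 * (1 - (cmod (correl h ?\<Delta> (axis i 1)))\<^sup>2))) = ?N * ?X"
      unfolding sum_distrib_left[symmetric] mass by (simp add: algebra_simps)
    finally show ?thesis .
  qed
  have "?N *\<^sub>R (b - Q b) = (\<Sum>k\<in>?K. \<phi> k *\<^sub>R (b - dual_action \<theta> (?x k) b))"
  proof -
    have "?N *\<^sub>R Q b = pi_rep \<theta> (\<lambda>p. of_real ?N * (?m p * f p))"
      unfolding Qb by (rule pi_rep_scaleR[OF mf, symmetric])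
    also have "(\<lambda>p. of_real ?N * (?m p * f p)) =
        (\<lambda>p. \<Sum>k\<in>?K. of_real (\<phi> k) * dual_action_Cc (?x k) f p)"
    proof
      fix p
      show "of_real ?N * (?m p * f p) = (\<Sum>k\<in>?K. of_real (\<phi> k) * dual_action_Cc (?x k) f p)"
      proof (cases "f p = 0")
        case False
        then have "p \<in> P" by (simp add: P_def)
        from avg[OF this] have "of_real ?N * ?m p * f p = (\<Sum>k\<in>?K. of_real (\<phi> k) * pairing p (?x k)) * f p"
          by simp
        then show ?thesis by (simp add: dual_action_Cc_def sum_distrib_right mult.assoc)
      qed (simp add: dual_action_Cc_def)
    qed
    also have "pi_rep \<theta> \<dots> = (\<Sum>k\<in>?K. pi_rep \<theta> (\<lambda>p. of_real (\<phi> k) * dual_action_Cc (?x k) f p))"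
      by (intro pi_rep_sum Cc_mult2 dual_action_Cc_in_Cc f)
    also have "\<dots> = (\<Sum>k\<in>?K. \<phi> k *\<^sub>R dual_action \<theta> (?x k) b)"
      by (simp add: pi_rep_scaleR dual_action_Cc_in_Cc f b_def dual_action_pi_rep root_point_in_torus)
    finally show ?thesis
      unfolding scaleR_diff_right sum_subtractf mass[symmetric] scaleR_sum_left by simp
  qed
  then have "?N * norm (b - Q b) = norm (\<Sum>k\<in>?K. \<phi> k *\<^sub>R (b - dual_action \<theta> (?x k) b))"
    using N by (metis abs_of_pos norm_scaleR)
  also have "\<dots> \<le> (\<Sum>k\<in>?K. \<phi> k * (?L * len (?x k) + e / 2))"
  proof (rule sum_norm_le)
    fix k
    \<comment> \<open>The Lip-seminorm of the approximant \<open>b\<close> is not controlled, so its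
      difference is compared with that of \<open>a\<close>.\<close>
    have "b - dual_action \<theta> (?x k) b = (dual_action \<theta> (?x k) (a - b) - (a - b)) - (dual_action \<theta> (?x k) a - a)"
      by (simp add: dual_action_linear(2)[OF root_point_in_torus A B])
    also have "norm \<dots> \<le> (norm (dual_action \<theta> (?x k) (a - b)) + norm (a - b)) + norm (dual_action \<theta> (?x k) a - a)"
      by (meson norm_triangle_ineq4 order_trans add_right_mono)
    also have "\<dots> \<le> (norm (a - b) + norm (a - b)) + ?L * len (?x k)"
      by (intro add_mono norm_dual_action_le[OF root_point_in_torus ab] order_refl qtorus_lipD[OF len a root_point_in_torus])
    also have "\<dots> \<le> ?L * len (?x k) + e / 2" using f(2) by (simp add: b_def)
    finally show "norm (\<phi> k *\<^sub>R (b - dual_action \<theta> (?x k) b)) \<le> \<phi> k * (?L * len (?x k) + e / 2)"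
      using \<phi>[of k] by (simp add: mult_left_mono)
  qed
  also have "\<dots> = ?L * (\<Sum>k\<in>?K. \<phi> k * len (?x k)) + (\<Sum>k\<in>?K. \<phi> k) * (e / 2)"
    unfolding sum_distrib_left sum_distrib_right sum.distrib[symmetric]
    by (intro sum.cong refl) (simp add: algebra_simps)
  also have "\<dots> \<le> ?L * (?N * ?X) + ?N * (e / 2)"
    using sumlen by (simp add: mass mult_left_mono qtorus_lip_nonneg[OF len])
  also have "\<dots> = ?N * (?L * ?X + e / 2)" by (simp only: distrib_left mult.left_commute)
  finally have bQ: "norm (b - Q b) \<le> ?L * ?X + e / 2"
    using N by (simp only: mult_le_cancel_left_pos)
  have "a - Q a = (a - b) + (b - Q b) - Q (a - b)" by (simp add: Qd)
  also have "norm \<dots> \<le> (norm (a - b) + norm (b - Q b)) + norm (Q (a - b))"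
    by (meson norm_triangle_ineq norm_triangle_ineq4 order_trans add_right_mono)
  also have "\<dots> \<le> ?L * ?X + e" using bQ nQ f(2) by (simp add: b_def)
  finally show "norm (a - transfer h \<psi> \<theta> (transfer h \<theta> \<psi> a)) \<le> ?L * ?X + e" by (simp add: Q_def)
qed

subsection \<open>The order-unit norm of a quantum torus\<close>

lemma bounded_linear_compose_left: "bounded_linear (\<lambda>a :: 'i op. a o\<^sub>L b)"
  by (rule bounded_bilinear.bounded_linear_left[OF bounded_bilinear_blinfun_compose])

lemma bounded_linear_compose_right: "bounded_linear (\<lambda>b :: 'i op. a o\<^sub>L b)"
  by (rule bounded_bilinear.bounded_linear_right[OF bounded_bilinear_blinfun_compose])

lemma Abar_compose:
  assumes \<theta>: "\<theta> \<in> skew_matrices" and a: "a \<in> Abar \<theta>" and b: "b \<in> Abar \<theta>"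
  shows "a o\<^sub>L b \<in> Abar \<theta>"
  using a
proof (induction rule: Abar_induct)
  case closed
  show ?case
    using continuous_closed_vimage[OF closed_Abar[of \<theta>] linear_continuous_at[OF bounded_linear_compose_left[of b]]]
    by (simp add: vimage_def)
next
  case (pi_rep f)
  show ?case using b
  proof (induction rule: Abar_induct)
    case closed
    show ?case
      using continuous_closed_vimage[OF closed_Abar[of \<theta>] linear_continuous_at[OF bounded_linear_compose_right[of "pi_rep \<theta> f"]]]
      by (simp add: vimage_def)
  next
    case (pi_rep g)
    then show ?case
      using \<open>f \<in> Cc\<close> by (simp add: pi_rep_in_Abar twisted_conv_Cc flip: pi_rep_twisted_conv[OF \<theta>])
  qed
qed

lemma self_adjoint_closed:
  assumes "is_adjoint a a" "is_adjoint b b"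
  shows "is_adjoint (a + b) (a + b)" "is_adjoint (a - b) (a - b)" "is_adjoint (r *\<^sub>R a) (r *\<^sub>R a)"
    "is_adjoint (- a) (- a)"
  using subspace_add[OF subspace_self_adjoint] subspace_diff[OF subspace_self_adjoint]
    subspace_scale[OF subspace_self_adjoint] subspace_neg[OF subspace_self_adjoint] assms by blast+

text \<open>The square root of \<open>1 - x\<close> is \<open>1 - y\<close> for the fixed point \<open>y = (x + y\<^sup>2) / 2\<close>.\<close>

lemma ex_sqrt:
  assumes \<theta>: "\<theta> \<in> skew_matrices" and x: "x \<in> Abar \<theta>" "is_adjoint x x" "norm x < 1"
  shows "\<exists>c\<in>Abar \<theta>. is_adjoint c c \<and> id_blinfun - x = c o\<^sub>L c"
proof -
  let ?s = "Abar \<theta> \<inter> {y. is_adjoint y y} \<inter> cball 0 (norm x)"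
  define T where "T y = (1 / 2) *\<^sub>R (x + (y o\<^sub>L y))" for y
  \<comment> \<open>This factoring does not need \<open>y\<close> and \<open>z\<close> to commute;
    on the ball of radius \<open>norm x\<close> it gives the Lipschitz constant
    \<open>norm x\<close>.\<close>
  have diff: "T y - T z = (1 / 2) *\<^sub>R ((y o\<^sub>L (y - z)) + ((y - z) o\<^sub>L z))" for y z
    by (rule blinfun_eqI) (simp add: T_def blinfun.bilinear_simps scaleR_diff_right scaleR_add_right)
  have "\<exists>!y\<in>?s. T y = y"
  proof (rule Banach_fix[of ?s "norm x"])
    show "complete ?s"
      unfolding complete_eq_closed by (intro closed_Int closed_Abar closed_self_adjoint closed_cball)
    show "?s \<noteq> {}" using x by auto
    show "T ` ?s \<subseteq> ?s"
    proof (rule image_subsetI, intro IntI)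
      fix y assume y: "y \<in> ?s"
      show "T y \<in> Abar \<theta>" unfolding T_def
        using x y \<theta> by (intro subspace_scale[OF subspace_Abar] subspace_add[OF subspace_Abar] Abar_compose) auto
      have "is_adjoint (x + (y o\<^sub>L y)) (x + (y o\<^sub>L y))"
        using x y by (intro self_adjoint_closed(1) is_adjoint_comp) auto
      then show "T y \<in> {y. is_adjoint y y}" unfolding T_def using self_adjoint_closed(3) by blast
      have "norm (x + (y o\<^sub>L y)) \<le> norm x + norm y * norm y"
        by (intro norm_triangle_mono norm_blinfun_compose order_refl)
      also have "norm y * norm y \<le> norm x * 1" using x y by (intro mult_mono) auto
      finally show "T y \<in> cball 0 (norm x)" by (simp add: T_def)
    qed
    show "dist (T y) (T z) \<le> norm x * dist y z" if "y \<in> ?s" "z \<in> ?s" for y z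
    proof -
      have "norm ((y o\<^sub>L (y - z)) + ((y - z) o\<^sub>L z)) \<le> norm y * norm (y - z) + norm (y - z) * norm z"
        by (intro norm_triangle_mono norm_blinfun_compose)
      also have "\<dots> \<le> norm x * norm (y - z) + norm (y - z) * norm x"
        using that by (intro add_mono mult_right_mono mult_left_mono) auto
      finally show ?thesis by (simp add: dist_norm diff mult.commute)
    qed
  qed (use x in auto)
  then obtain y where y: "y \<in> Abar \<theta>" "is_adjoint y y" "T y = y" by auto
  have "2 *\<^sub>R T y = x + (y o\<^sub>L y)" by (simp add: T_def)
  then have "y + y = x + (y o\<^sub>L y)" using y(3) by (simp add: scaleR_2)
  then have x': "x = y + y - (y o\<^sub>L y)" by (simp add: algebra_simps)
  have "id_blinfun - x = (id_blinfun - y) o\<^sub>L (id_blinfun - y)"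
    unfolding x' by (rule blinfun_eqI) (simp add: blinfun.bilinear_simps)
  moreover have "id_blinfun - y \<in> Abar \<theta>" by (rule subspace_diff[OF subspace_Abar id_in_Abar[OF \<theta>] y(1)])
  ultimately show ?thesis using self_adjoint_closed(2)[OF is_adjoint_id y(2)] by blast
qed

text \<open>Rescaling reduces this to the square root of \<open>1 - a / r\<close>, which the fixed
  point argument supplies for \<open>norm a < r\<close>; hence the strict comparison in
  \<open>order_norm\<close>.\<close>

lemma Abar_pos_if_norm_less:
  assumes \<theta>: "\<theta> \<in> skew_matrices" and a: "a \<in> Abar \<theta>" "is_adjoint a a" "norm a < r"
  shows "r *\<^sub>R id_blinfun - a \<in> Abar_pos \<theta>"
proof -
  have r: "0 < r" using a(3) norm_ge_zero[of a] by linarith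
  have "(1 / r) *\<^sub>R a \<in> Abar \<theta>" "is_adjoint ((1 / r) *\<^sub>R a) ((1 / r) *\<^sub>R a)" "norm ((1 / r) *\<^sub>R a) < 1"
    using r a self_adjoint_closed(3) by (auto simp: subspace_scale[OF subspace_Abar])
  from ex_sqrt[OF \<theta> this] obtain c where c: "c \<in> Abar \<theta>" "is_adjoint c c"
    "id_blinfun - (1 / r) *\<^sub>R a = c o\<^sub>L c" by blast
  have "r *\<^sub>R id_blinfun - a = r *\<^sub>R (id_blinfun - (1 / r) *\<^sub>R a)"
    using r by (simp add: scaleR_diff_right)
  also have "\<dots> = (sqrt r *\<^sub>R c) o\<^sub>L (sqrt r *\<^sub>R c)"
    unfolding c(3) using r by (intro blinfun_eqI) (simp add: blinfun.bilinear_simps)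
  finally show ?thesis
    unfolding Abar_pos_def using self_adjoint_closed(3)[OF c(2,2)] subspace_scale[OF subspace_Abar c(1)] by blast
qed

lemma Abar_pos_inner:
  assumes "a \<in> Abar_pos \<theta>"
  shows "0 \<le> inner \<xi> (a \<xi>)"
proof -
  obtain c c' where c: "is_adjoint c c'" "a = c' o\<^sub>L c" using assms by (auto simp: Abar_pos_def)
  have "inner \<xi> (a \<xi>) = inner (c \<xi>) (c \<xi>)"
    using c(1) by (simp add: inner_ell2_def is_adjoint_def c(2))
  then show ?thesis by simp
qed

text \<open>Polarization bounds the mixed terms of a self-adjoint operator by its quadratic
  form.\<close>

lemma norm_le_if_quadratic_form_le:
  fixes a :: "'i op"
  assumes adj: "is_adjoint a a" and r: "0 \<le> r" and q: "\<And>\<xi>. \<bar>inner \<xi> (a \<xi>)\<bar> \<le> r * (norm \<xi>)\<^sup>2"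
  shows "norm a \<le> r"
proof (rule norm_blinfun_bound[OF r])
  fix \<xi>
  have sym: "inner (a \<xi>) \<eta> = inner \<xi> (a \<eta>)" for \<xi> \<eta> using adj by (simp add: inner_ell2_def is_adjoint_def)
  have polar: "2 * inner \<eta> (a \<xi>) \<le> r * ((norm \<xi>)\<^sup>2 + (norm \<eta>)\<^sup>2)" for \<xi> \<eta>
  proof -
    have "4 * inner \<eta> (a \<xi>) = inner (\<xi> + \<eta>) (a (\<xi> + \<eta>)) - inner (\<xi> - \<eta>) (a (\<xi> - \<eta>))"
      using sym[of \<xi> \<eta>]
      by (simp add: blinfun.bilinear_simps inner_add_left inner_add_right inner_diff_left inner_diff_right inner_commute)
    also have "\<dots> \<le> r * (norm (\<xi> + \<eta>))\<^sup>2 + r * (norm (\<xi> - \<eta>))\<^sup>2"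
      using q[of "\<xi> + \<eta>"] q[of "\<xi> - \<eta>"] by linarith
    also have "\<dots> = 2 * (r * ((norm \<xi>)\<^sup>2 + (norm \<eta>)\<^sup>2))"
      by (simp add: power2_norm_eq_inner inner_add_left inner_add_right inner_diff_left inner_diff_right
          inner_commute algebra_simps)
    finally show ?thesis by simp
  qed
  show "norm (a \<xi>) \<le> r * norm \<xi>"
  proof (cases "a \<xi> = 0 \<or> \<xi> = 0")
    case True then show ?thesis using r by auto
  next
    case False
    \<comment> \<open>Parallel to \<open>a \<xi>\<close> and as long as \<xi>, which balances the
      two squares in \<open>polar\<close>.\<close>
    define \<eta> where "\<eta> = (norm \<xi> / norm (a \<xi>)) *\<^sub>R a \<xi>"
    have "inner \<eta> (a \<xi>) = norm \<xi> * norm (a \<xi>)"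
      using False by (simp add: \<eta>_def power2_norm_eq_inner[symmetric] power2_eq_square)
    moreover have "norm \<eta> = norm \<xi>" using False by (simp add: \<eta>_def)
    ultimately have "norm \<xi> * norm (a \<xi>) \<le> norm \<xi> * (r * norm \<xi>)"
      using polar[of \<eta> \<xi>] by (simp add: power2_eq_square mult_ac)
    then show ?thesis using False by simp
  qed
qed

lemma norm_id_blinfun_ell2: "norm (id_blinfun :: 'i op) = 1"
proof (rule antisym)
  show "norm (id_blinfun :: 'i op) \<le> 1" by (rule norm_blinfun_bound) auto
  \<comment> \<open>The index type is arbitrary; \<open>undefined\<close> merely names one of its
    elements.\<close>
  define \<delta> :: "'i ell2" where "\<delta> = Abs_ell2 (\<lambda>p. if p = undefined then 1 else 0)"
  have ap: "ell2_apply \<delta> = (\<lambda>p. if p = undefined then 1 else 0)"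
    unfolding \<delta>_def by (rule ell2_apply_Abs_ell2) auto
  have "(norm \<delta>)\<^sup>2 = 1" by (subst norm_ell2_fs[of "{undefined}"]) (auto simp: ap)
  then have "norm \<delta> = 1" using power2_eq_imp_eq[of "norm \<delta>" 1] by simp
  then show "1 \<le> norm (id_blinfun :: 'i op)" using norm_blinfun[of "id_blinfun :: 'i op" \<delta>] by simp
qed

text \<open>Positive elements have nonnegative quadratic forms, so order bounds limit the norm;
  conversely, square roots turn norm bounds into order bounds.\<close>

lemma order_norm_qtorus:
  assumes len: "length_function torus len" and \<theta>: "\<theta> \<in> skew_matrices"
  shows "order_norm (qtorus len \<theta>) norm"
  unfolding order_norm_def
proof (intro conjI ballI allI impI)
  let ?A = "qtorus len \<theta>"
  have u: "ou_unit ?A = id_blinfun" and le: "ou_le ?A a b \<longleftrightarrow> b - a \<in> Abar_pos \<theta>" for a b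
    by (simp_all add: qtorus_def)
  show "subspace (carrier ?A)" by (rule subspace_qtorus[OF len \<theta>])
  show "ou_unit ?A \<in> carrier ?A" using id_in_qtorus[OF len \<theta>] by (simp add: u)
  show "norm (ou_unit ?A) = 1" by (simp add: u norm_id_blinfun_ell2)
  show "seminorm_on (carrier ?A) norm" by (simp add: seminorm_on_def norm_triangle_ineq)
  fix a assume a: "a \<in> carrier ?A"
  then have a: "a \<in> Abar \<theta>" "is_adjoint a a" by (simp_all add: qtorus_carrier_iff)
  show "norm a \<le> r" if "ou_le ?A (- (r *\<^sub>R ou_unit ?A)) a \<and> ou_le ?A a (r *\<^sub>R ou_unit ?A)" for r
  proof -
    have q: "\<bar>inner \<xi> (a \<xi>)\<bar> \<le> r * (norm \<xi>)\<^sup>2" for \<xi>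
      using that Abar_pos_inner[of "a - - (r *\<^sub>R id_blinfun)" \<theta> \<xi>] Abar_pos_inner[of "r *\<^sub>R id_blinfun - a" \<theta> \<xi>]
      by (simp add: le u blinfun.bilinear_simps inner_add_right inner_diff_right power2_norm_eq_inner abs_le_iff)
    have "0 \<le> r * (norm (point_vec 0 :: (int^'a) ell2))\<^sup>2"
      using q[of "point_vec 0"] by (meson abs_ge_zero order_trans)
    then have "0 \<le> r" by (simp add: norm_point_vec)
    then show ?thesis by (rule norm_le_if_quadratic_form_le[OF a(2) _ q])
  qed
  show "ou_le ?A (- (r *\<^sub>R ou_unit ?A)) a" if "norm a < r" for r
    using Abar_pos_if_norm_less[OF \<theta> subspace_neg[OF subspace_Abar a(1)] self_adjoint_closed(4)[OF a(2,2)], of r] that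
    by (simp add: le u add.commute)
  show "ou_le ?A a (r *\<^sub>R ou_unit ?A)" if "norm a < r" for r
    using Abar_pos_if_norm_less[OF \<theta> a that] by (simp add: le u)
qed

subsection \<open>Uniform estimates\<close>

lemma compact_torus: "compact (carrier torus :: (complex^'d) set)"
proof -
  have "carrier torus = {x :: complex^'d. \<forall>i. cmod (x $ i) = 1}" by (simp add: torus_def)
  moreover have "closed {x :: complex^'d. \<forall>i. cmod (x $ i) = 1}"
    by (intro closed_Collect_all closed_Collect_eq continuous_intros)
  moreover have "bounded {x :: complex^'d. \<forall>i. cmod (x $ i) = 1}"
  proof (rule boundedI)
    fix x :: "complex^'d" assume x: "x \<in> {x. \<forall>i. cmod (x $ i) = 1}"
    have "norm x \<le> (\<Sum>i\<in>UNIV. cmod (x $ i))" unfolding norm_vec_def by (rule L2_set_le_sum) simp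
    then show "norm x \<le> real CARD('d)" using x by simp
  qed
  ultimately show ?thesis by (simp add: compact_eq_bounded_closed)
qed

text \<open>Near the identity continuity gives \<eta>; at distance \<tau> or more the quadratic term
  with \<open>C = K / \<tau>\<^sup>2\<close> reaches the bound \<open>K\<close> of
  \<open>len\<close>.\<close>

lemma length_function_le:
  fixes len :: "complex^'d \<Rightarrow> real"
  assumes len: "length_function torus len" and cont: "continuous_on (carrier torus) len" and \<eta>: "0 < \<eta>"
  obtains C where "0 \<le> C" "\<And>x. x \<in> carrier torus \<Longrightarrow> len x \<le> \<eta> + C * (norm (x - (\<chi> i. 1)))\<^sup>2"
proof -
  let ?one = "(\<chi> i. 1) :: complex^'d"
  have "compact (len ` carrier torus)" by (rule compact_continuous_image[OF cont compact_torus])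
  then obtain K where K: "\<And>x. x \<in> carrier torus \<Longrightarrow> \<bar>len x\<bar> \<le> K"
    using compact_imp_bounded[of "len ` carrier torus"] unfolding bounded_iff by auto
  have K0: "0 \<le> K" using K[OF torus_one(2)] by linarith
  have l1: "len ?one = 0" using length_functionD(2)[OF len torus_one(2)] by simp
  obtain \<tau> where \<tau>: "0 < \<tau>" "\<And>x. x \<in> carrier torus \<Longrightarrow> dist x ?one < \<tau> \<Longrightarrow> dist (len x) (len ?one) < \<eta>"
    using cont torus_one(2) \<eta> unfolding continuous_on_iff by metis
  have "len x \<le> \<eta> + K / \<tau>\<^sup>2 * (norm (x - ?one))\<^sup>2" if x: "x \<in> carrier torus" for x
  proof (cases "norm (x - ?one) < \<tau>")
    case True
    then have "len x < \<eta>" using \<tau>(2)[OF x] l1 by (simp add: dist_norm)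
    moreover have "0 \<le> K / \<tau>\<^sup>2 * (norm (x - ?one))\<^sup>2" using K0 by simp
    ultimately show ?thesis by linarith
  next
    case False
    then have "\<tau>\<^sup>2 \<le> (norm (x - ?one))\<^sup>2" using \<tau>(1) by (intro power_mono) auto
    then have "K * 1 \<le> K * ((norm (x - ?one))\<^sup>2 / \<tau>\<^sup>2)"
      using K0 \<tau>(1) by (intro mult_left_mono) (auto simp: divide_simps)
    then show ?thesis using K[OF x] \<eta> by simp
  qed
  then show thesis using that[of "K / \<tau>\<^sup>2"] K0 by simp
qed

lemma ex_pairing_minus_one:
  fixes p :: "int^'d"
  assumes "p \<noteq> 0"
  obtains x where "x \<in> carrier torus" "pairing p x = - 1"
proof -
  obtain i where i: "p $ i \<noteq> 0" using assms by (auto simp: vec_eq_iff)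
  define x :: "complex^'d" where "x = (\<chi> j. if j = i then cis (pi / of_int (p $ i)) else 1)"
  have "pairing p x = (\<Prod>j\<in>UNIV. if j = i then cis (pi / of_int (p $ i)) powi (p $ i) else 1)"
    unfolding pairing_def x_def by (rule prod.cong) auto
  also have "\<dots> = cis (pi / of_int (p $ i)) powi (p $ i)" by simp
  also have "\<dots> = - 1" unfolding cis_power_int using i by simp
  finally show thesis using that[of x] by (simp add: x_def torus_def)
qed

text \<open>Where the character of \<open>p\<close> equals -1, translating \<open>a\<close> and
  subtracting \<open>a\<close> multiplies its coefficient at \<open>p\<close> by -2. The point is
  chosen from \<open>p\<close> alone, so one \<open>B\<close> serves all \<theta> and
  \<open>a\<close>.\<close>

lemma fourier_coeff_bound:
  assumes "p \<noteq> 0"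
  obtains B where "\<And>(\<theta> :: real^'d^'d) a. a \<in> carrier (qtorus len \<theta>) \<Longrightarrow> length_function torus len \<Longrightarrow>
    cmod (fourier_coeff a p) \<le> B * qtorus_lip len \<theta> a"
proof -
  obtain x :: "complex^'d" where x: "x \<in> carrier torus" "pairing p x = - 1"
    using ex_pairing_minus_one[OF assms] by blast
  have "cmod (fourier_coeff a p) \<le> (len x / 2) * qtorus_lip len \<theta> a"
    if a: "a \<in> carrier (qtorus len \<theta>)" and len: "length_function torus len" for \<theta> :: "real^'d^'d" and a
  proof -
    have "fourier_coeff (dual_action \<theta> x a - a) p = - 2 * fourier_coeff a p"
      using a x by (simp add: fourier_coeff_dual_action qtorus_carrier_iff)
    then have "2 * cmod (fourier_coeff a p) = cmod (fourier_coeff (dual_action \<theta> x a - a) p)"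
      by (simp only: norm_mult) simp
    also have "\<dots> \<le> qtorus_lip len \<theta> a * len x"
      by (rule order_trans[OF cmod_fourier_coeff_le qtorus_lipD[OF len a x(1)]])
    finally show ?thesis by (simp add: mult.commute)
  qed
  then show thesis by (rule that)
qed

lemma fourier_coeff_0_real:
  assumes "\<theta> \<in> skew_matrices" "a \<in> carrier (qtorus len \<theta>)"
  shows "fourier_coeff a 0 = of_real (Re (fourier_coeff a 0))"
proof -
  have "cnj (fourier_coeff a 0) = fourier_coeff a 0"
    using fun_cong[OF star_fourier_coeff[of \<theta> a], of 0] assms
    by (simp add: star_def qtorus_carrier_iff)
  then show ?thesis by (metis complex_cnj_cancel_iff Reals_cnj_iff of_real_Re)
qed

text \<open>The \<open>M\<close> translates of the slice along axis \<open>i\<close> are disjoint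
  and stay in the box.\<close>

lemma card_box_slice:
  fixes M :: nat and i :: "'d::finite"
  defines "B \<equiv> {s :: int^'d. \<forall>j. s $ j \<in> {0..<int M}}"
  shows "finite B" "M * card {s \<in> B. s $ i = 0} \<le> card B"
proof -
  have "B \<subseteq> (\<lambda>f. \<chi> j. f j) ` (Pi\<^sub>E UNIV (\<lambda>_. {0..<int M}))"
  proof
    fix s assume "s \<in> B"
    then show "s \<in> (\<lambda>f. \<chi> j. f j) ` (Pi\<^sub>E UNIV (\<lambda>_. {0..<int M}))"
      by (intro image_eqI[of _ _ "\<lambda>j. s $ j"]) (auto simp: B_def)
  qed
  moreover have "finite (Pi\<^sub>E (UNIV :: 'd set) (\<lambda>_. {0..<int M}))" by (rule finite_PiE) auto
  ultimately show B: "finite B" using finite_surj by blast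
  let ?f = "\<lambda>(s :: int^'d, j). s + axis i (int j)"
  have "card ({s \<in> B. s $ i = 0} \<times> {..<M}) \<le> card B"
  proof (rule card_inj_on_le[of ?f])
    show "inj_on ?f ({s \<in> B. s $ i = 0} \<times> {..<M})"
    proof (rule inj_onI, clarify)
      fix s t :: "int^'d" and j k
      assume s: "s $ i = 0" "t $ i = 0" and e: "s + axis i (int j) = t + axis i (int k)"
      have "(s + axis i (int j)) $ i = (t + axis i (int k)) $ i" using e by simp
      then have "j = k" using s by (simp add: axis_def)
      then show "s = t \<and> j = k" using e by simp
    qed
    show "?f ` ({s \<in> B. s $ i = 0} \<times> {..<M}) \<subseteq> B"
      by (auto simp: B_def axis_def)
  qed (rule B)
  then show "M * card {s \<in> B. s $ i = 0} \<le> card B" by (simp add: card_cartesian_product mult.commute)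
qed

text \<open>Shifting a box by a basis vector loses one face, a fraction \<open>z \<le> 1 / M\<close>
  of its points. So \<open>correl\<close> equals \<open>1 - z\<close> there, and
  \<open>1 - (1 - z)\<^sup>2 \<le> 2 * z\<close>.\<close>

lemma ex_box_mass:
  fixes M :: nat
  assumes M: "0 < M"
  obtains h :: "int^'d \<Rightarrow> real" where "unit_mass h"
    "\<And>i. 1 - (cmod (correl h 0 (axis i 1)))\<^sup>2 \<le> 2 / real M"
proof -
  define B where "B = {s :: int^'d. \<forall>j. s $ j \<in> {0..<int M}}"
  have B: "finite B" unfolding B_def by (rule card_box_slice)
  have "0 \<in> B" using M by (simp add: B_def)
  then have ne: "B \<noteq> {}" by blast
  then have c: "0 < card B" using B card_gt_0_iff by blast
  define h where "h s = (if s \<in> B then 1 / sqrt (card B) else 0)" for s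
  have supp: "{s. h s \<noteq> 0} = B" using ne B by (auto simp: h_def)
  have um: "unit_mass h"
    unfolding unit_mass_def supp using B c ne by (simp add: h_def power_divide)
  have "1 - (cmod (correl h 0 (axis i 1)))\<^sup>2 \<le> 2 / real M" for i
  proof -
    let ?Z = "{s \<in> B. s $ i = 0}"
    have Z: "real (card ?Z) / real (card B) \<le> 1 / real M"
    proof -
      have "M * card ?Z \<le> card B" unfolding B_def by (rule card_box_slice)
      then have "real M * real (card ?Z) \<le> real (card B)" by (metis of_nat_le_iff of_nat_mult)
      then show ?thesis using c M by (simp add: field_simps)
    qed
    have mem: "s - axis i 1 \<in> B \<longleftrightarrow> s $ i \<noteq> 0" if "s \<in> B" for s
    proof
      assume "s - axis i 1 \<in> B"
      then have "\<forall>j. (s - axis i 1) $ j \<in> {0..<int M}" unfolding B_def by (rule CollectD)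
      from spec[OF this, of i] have "0 \<le> (s - axis i 1) $ i" by simp
      then show "s $ i \<noteq> 0" by (simp add: axis_def)
    next
      assume n: "s $ i \<noteq> 0"
      show "s - axis i 1 \<in> B" unfolding B_def
      proof (intro CollectI allI)
        fix j
        have "s $ j \<in> {0..<int M}" using that by (simp add: B_def)
        then show "(s - axis i 1) $ j \<in> {0..<int M}" using n by (auto simp: axis_def)
      qed
    qed
    have b0: "bichar 0 p q = 1" for p q :: "int^'d" by (simp add: bichar_def)
    have "correl h 0 (axis i 1) = (\<Sum>s\<in>B. of_real (h s * h (s - axis i 1)))"
      by (simp add: correl_def supp b0)
    also have "\<dots> = (\<Sum>s\<in>B - ?Z. of_real (h s * h (s - axis i 1)))"
      by (rule sum.mono_neutral_right) (use B mem in \<open>auto simp: h_def\<close>)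
    also have "\<dots> = (\<Sum>s\<in>B - ?Z. of_real (1 / card B))"
      by (rule sum.cong) (use mem in \<open>auto simp: h_def\<close>)
    also have "\<dots> = of_real (1 - card ?Z / card B)"
      using c B ne by (simp add: card_Diff_subset card_mono of_nat_diff diff_divide_distrib)
    finally have g: "correl h 0 (axis i 1) = of_real (1 - card ?Z / card B)" .
    have z0: "0 \<le> (card ?Z / card B)\<^sup>2" by simp
    have "1 - (cmod (correl h 0 (axis i 1)))\<^sup>2 = 1 - (1 - card ?Z / card B)\<^sup>2"
      unfolding g norm_of_real by simp
    also have "\<dots> \<le> 2 * (card ?Z / card B)" using z0 by (simp add: power2_diff)
    finally show ?thesis using Z by simp
  qed
  then show thesis using that um by blast
qed

lemma continuous_correl: "continuous_on UNIV (\<lambda>\<Delta> :: real^'d^'d. correl h \<Delta> r)"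
  unfolding correl_def bichar_def inner_vec_def matrix_vector_mult_def
  by (intro continuous_intros)

text \<open>The box is fixed first, by the case \<open>\<Delta> = 0\<close>; for this
  \<open>h\<close>, continuity of finitely many values in \<Delta> then gives \<delta>.\<close>

lemma ex_unit_mass:
  assumes \<kappa>: "0 < \<kappa>"
  obtains h :: "int^'d \<Rightarrow> real" and \<delta> where "unit_mass h" "0 < \<delta>"
    "\<And>\<Delta> i. norm \<Delta> < \<delta> \<Longrightarrow> 1 - (cmod (correl h \<Delta> (axis i 1)))\<^sup>2 < \<kappa>"
proof -
  obtain M :: nat where M: "0 < M" "2 / \<kappa> < real M"
    using reals_Archimedean2[of "2 / \<kappa>"] \<kappa> by (metis divide_pos_pos of_nat_0_less_iff order_less_trans zero_less_numeral)
  obtain h :: "int^'d \<Rightarrow> real" where h: "unit_mass h" "\<And>i. 1 - (cmod (correl h 0 (axis i 1)))\<^sup>2 \<le> 2 / real M"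
    using ex_box_mass[OF M(1)] by blast
  let ?U = "{\<Delta>. \<forall>i. 1 - (cmod (correl h \<Delta> (axis i 1)))\<^sup>2 < \<kappa>}"
  have "?U = (\<Inter>i\<in>UNIV. {\<Delta>. 1 - (cmod (correl h \<Delta> (axis i 1)))\<^sup>2 < \<kappa>})" by auto
  then have "open ?U"
    by (simp only:) (intro open_INT ballI finite open_Collect_less continuous_intros continuous_correl)
  moreover have "2 / real M < \<kappa>" using M \<kappa> by (simp add: field_simps)
  then have "0 \<in> ?U" using h(2) by (auto intro: le_less_trans)
  ultimately obtain \<delta> where "0 < \<delta>" "ball 0 \<delta> \<subseteq> ?U" unfolding open_contains_ball by blast
  then show thesis using that[of h \<delta>] h(1) by (auto simp: subset_iff)
qed

text \<open>Equivalence of norms in finite dimension, for a norm that is given on a subspace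
  only.\<close>

lemma norm_on_skew:
  fixes N :: "real^'d^'d \<Rightarrow> real"
  assumes N: "norm_on skew_matrices N" and e: "0 < e"
  obtains \<delta> where "0 < \<delta>" "\<And>\<Delta>. \<Delta> \<in> skew_matrices \<Longrightarrow> N \<Delta> < \<delta> \<Longrightarrow> norm \<Delta> < e"
proof -
  have sN: "seminorm_on skew_matrices N" and pos: "\<And>a. a \<in> skew_matrices \<Longrightarrow> N a = 0 \<Longrightarrow> a = 0"
    using N by (auto simp: norm_on_def)
  \<comment> \<open>The standard basis matrices are not skew; projecting them to their skew parts
    makes them usable for bounding \<open>N\<close>.\<close>
  define P :: "real^'d^'d \<Rightarrow> real^'d^'d" where "P X = (1 / 2) *\<^sub>R (X - transpose X)" for X
  have P: "P X \<in> skew_matrices" for X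
    by (simp add: P_def skew_matrices_def transpose_def vec_eq_iff field_simps)
  have Pid: "P X = X" if "X \<in> skew_matrices" for X
    using that by (simp add: P_def skew_matrices_def flip: scaleR_2)
  have lP: "linear P"
    by (rule linearI) (simp_all add: P_def transpose_def vec_eq_iff algebra_simps)
  define C where "C = (\<Sum>b\<in>Basis. N (P b))"
  have bound: "N (P X) \<le> C * norm X" for X
  proof -
    have "P X = (\<Sum>b\<in>Basis. (X \<bullet> b) *\<^sub>R P b)"
      using arg_cong[OF euclidean_representation[of X], of P]
      by (simp add: linear_sum[OF lP] linear_cmul[OF lP])
    moreover have "N (\<Sum>b\<in>F. (X \<bullet> b) *\<^sub>R P b) \<le> (\<Sum>b\<in>F. \<bar>X \<bullet> b\<bar> * N (P b))" if "finite F" for F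
      using that
    proof induction
      case empty
      then show ?case using seminorm_onD(2)[OF sN subspace_0[OF subspace_skew], of 0] by simp
    next
      case (insert b F)
      have "N ((X \<bullet> b) *\<^sub>R P b + (\<Sum>b\<in>F. (X \<bullet> b) *\<^sub>R P b)) \<le>
          N ((X \<bullet> b) *\<^sub>R P b) + N (\<Sum>b\<in>F. (X \<bullet> b) *\<^sub>R P b)"
        by (intro seminorm_onD(3)[OF sN] subspace_scale[OF subspace_skew] subspace_sum[OF subspace_skew] P)
      then show ?case using insert by (simp add: seminorm_onD(2)[OF sN P])
    qed
    ultimately have "N (P X) \<le> (\<Sum>b\<in>Basis. \<bar>X \<bullet> b\<bar> * N (P b))" by simp
    also have "\<dots> \<le> (\<Sum>b\<in>Basis. norm X * N (P b))"
      by (intro sum_mono mult_right_mono Basis_le_norm seminorm_onD(1)[OF sN P])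
    finally show ?thesis by (simp add: C_def sum_distrib_left mult.commute)
  qed
  have C0: "0 \<le> C" unfolding C_def by (intro sum_nonneg seminorm_onD(1)[OF sN P])
  have lip: "\<bar>N X - N Y\<bar> \<le> C * norm (X - Y)" if XY: "X \<in> skew_matrices" "Y \<in> skew_matrices" for X Y
  proof -
    have d: "X - Y \<in> skew_matrices" "Y - X \<in> skew_matrices" using XY subspace_diff[OF subspace_skew] by auto
    have "N X \<le> N (X - Y) + N Y" using seminorm_onD(3)[OF sN d(1) XY(2)] by simp
    moreover have "N Y \<le> N (Y - X) + N X" using seminorm_onD(3)[OF sN d(2) XY(1)] by simp
    moreover have "N (X - Y) \<le> C * norm (X - Y)" "N (Y - X) \<le> C * norm (X - Y)"
      using bound[of "X - Y"] bound[of "Y - X"] d by (simp_all add: Pid norm_minus_commute)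
    ultimately show ?thesis by linarith
  qed
  let ?S = "skew_matrices \<inter> sphere 0 1 :: (real^'d^'d) set"
  have "compact ?S" by (intro closed_Int_compact closed_subspace subspace_skew compact_sphere)
  moreover have "continuous_on ?S N"
  proof (rule continuous_on_iff[THEN iffD2], intro ballI allI impI)
    fix X and \<eta> :: real assume X: "X \<in> ?S" and \<eta>: "0 < \<eta>"
    have "dist (N Y) (N X) < \<eta>" if "Y \<in> ?S" "dist Y X < \<eta> / (C + 1)" for Y
    proof -
      have "\<bar>N Y - N X\<bar> \<le> C * norm (Y - X)" using X that by (intro lip) auto
      also have "\<dots> \<le> (C + 1) * norm (Y - X)" by (intro mult_right_mono) auto
      also have "\<dots> < \<eta>" using that(2) C0 by (simp add: dist_norm field_simps)
      finally show ?thesis by (simp add: dist_real_def)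
    qed
    then show "\<exists>d>0. \<forall>Y\<in>?S. dist Y X < d \<longrightarrow> dist (N Y) (N X) < \<eta>"
      using \<eta> C0 by (intro exI[of _ "\<eta> / (C + 1)"]) auto
  qed
  ultimately have "\<exists>c>0. \<forall>X\<in>?S. c \<le> N X"
  proof (cases "?S = {}")
    case False
    assume "compact ?S" "continuous_on ?S N"
    from continuous_attains_inf[OF this(1) False this(2)] obtain X where X: "X \<in> ?S" "\<forall>Y\<in>?S. N X \<le> N Y" by blast
    have "N X \<noteq> 0" using pos[of X] X(1) by auto
    then have "0 < N X" using seminorm_onD(1)[OF sN, of X] X(1) by auto
    then show ?thesis using X(2) by blast
  \<comment> \<open>The sphere is empty for \<open>d = 1\<close>, where zero is the only skew
    matrix.\<close>
  qed (auto intro: exI[of _ 1])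
  then obtain c where c: "0 < c" "\<And>X. X \<in> ?S \<Longrightarrow> c \<le> N X" by blast
  have "norm \<Delta> < e" if \<Delta>: "\<Delta> \<in> skew_matrices" "N \<Delta> < c * e" for \<Delta>
  proof (cases "\<Delta> = 0")
    case False
    have "(1 / norm \<Delta>) *\<^sub>R \<Delta> \<in> ?S" using \<Delta> False by (simp add: subspace_scale[OF subspace_skew])
    from c(2)[OF this] have "c * norm \<Delta> \<le> N \<Delta>"
      using False by (simp add: seminorm_onD(2)[OF sN \<Delta>(1)] field_simps)
    then have "c * norm \<Delta> < c * e" using \<Delta>(2) by linarith
    then show ?thesis using c(1) by simp
  qed (use e in simp)
  then show thesis using that[of "c * e"] c(1) e by simp
qed

text \<open>Together with a round trip close to the identity, this stands in for the injectivity of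
  Fourier coefficients on the completion.\<close>

lemma transfer_eqI:
  "(\<And>p. fourier_coeff a p = fourier_coeff b p) \<Longrightarrow> transfer h \<theta> \<psi> a = transfer h \<theta> \<psi> b"
  by (simp add: transfer_def)

text \<open>The round trip estimate sees \<theta> and \<psi> only through their difference, so
  \<open>h\<close> and \<delta> can be chosen from \<open>len\<close> and \<open>e\<close> alone;
  this is the uniformity.\<close>

lemma ex_near_identity:
  fixes len :: "complex^'d \<Rightarrow> real"
  assumes len: "length_function torus len" and cont: "continuous_on (carrier torus) len" and e: "0 < e"
  obtains h :: "int^'d \<Rightarrow> real" and \<delta> where "unit_mass h" "0 < \<delta>"
    "\<And>\<theta> \<psi> a. \<theta> \<in> skew_matrices \<Longrightarrow> \<psi> \<in> skew_matrices \<Longrightarrow> norm (\<psi> - \<theta>) < \<delta> \<Longrightarrow>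
      a \<in> carrier (qtorus len \<theta>) \<Longrightarrow>
      norm (a - transfer h \<psi> \<theta> (transfer h \<theta> \<psi> a)) \<le> e * qtorus_lip len \<theta> a"
proof -
  obtain C where C: "0 \<le> C" "\<And>x. x \<in> carrier torus \<Longrightarrow> len x \<le> e / 2 + C * (norm (x - (\<chi> i. 1)))\<^sup>2"
    using length_function_le[OF len cont, of "e / 2"] e by auto
  \<comment> \<open>Chosen so that \<open>(C + 1) * d * 2 * \<kappa> = e / 2\<close>;
    \<open>C + 1\<close> guards against \<open>C = 0\<close>.\<close>
  define \<kappa> where "\<kappa> = e / (4 * real CARD('d) * (C + 1))"
  have \<kappa>: "0 < \<kappa>" using e C(1) by (simp add: \<kappa>_def)
  obtain h :: "int^'d \<Rightarrow> real" and \<delta> where h: "unit_mass h" "0 < \<delta>"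
    "\<And>\<Delta> i. norm \<Delta> < \<delta> \<Longrightarrow> 1 - (cmod (correl h \<Delta> (axis i 1)))\<^sup>2 < \<kappa>"
    using ex_unit_mass[OF \<kappa>] by blast
  have cancel: "D * (n * (2 * (e / (4 * n * D)))) = e / 2" if "D \<noteq> 0" "n \<noteq> 0" for D n
    using that by (simp add: field_simps)
  show thesis
  proof (rule that[OF h(1,2)])
    fix \<theta> \<psi> :: "real^'d^'d" and a
    assume *: "\<theta> \<in> skew_matrices" "\<psi> \<in> skew_matrices" "norm (\<psi> - \<theta>) < \<delta>" and a: "a \<in> carrier (qtorus len \<theta>)"
    let ?X = "\<Sum>i\<in>UNIV. 2 * (1 - (cmod (correl h (\<psi> - \<theta>) (axis i 1)))\<^sup>2)"
    have "?X \<le> (\<Sum>i\<in>(UNIV :: 'd set). 2 * \<kappa>)"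
      using h(3)[OF *(3)] by (intro sum_mono mult_left_mono) (auto intro: less_imp_le)
    then have "C * ?X \<le> C * (real CARD('d) * (2 * \<kappa>))" using C(1) by (intro mult_left_mono) auto
    also have "\<dots> \<le> (C + 1) * (real CARD('d) * (2 * \<kappa>))" using \<kappa> by (intro mult_right_mono) auto
    also have "\<dots> = e / 2" unfolding \<kappa>_def by (rule cancel) (use C(1) in auto)
    finally have "e / 2 + C * ?X \<le> e" by simp
    then have "qtorus_lip len \<theta> a * (e / 2 + C * ?X) \<le> qtorus_lip len \<theta> a * e"
      by (rule mult_left_mono[OF _ qtorus_lip_nonneg[OF len]])
    with norm_transfer_transfer_le[OF len C h(1) *(1,2) a]
    show "norm (a - transfer h \<psi> \<theta> (transfer h \<theta> \<psi> a)) \<le> e * qtorus_lip len \<theta> a"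
      by (simp add: mult.commute)
  qed
qed

lemma qtorus_lip_eq_0_iff:
  fixes len :: "complex^'d \<Rightarrow> real"
  assumes len: "length_function torus len" and cont: "continuous_on (carrier torus) len"
    and \<theta>: "\<theta> \<in> skew_matrices" and a: "a \<in> carrier (qtorus len \<theta>)"
  shows "qtorus_lip len \<theta> a = 0 \<longleftrightarrow> (\<exists>r. a = r *\<^sub>R ou_unit (qtorus len \<theta>))"
proof
  assume L0: "qtorus_lip len \<theta> a = 0"
  \<comment> \<open>For \<open>\<psi> = \<theta>\<close> a vanishing seminorm makes \<open>a\<close>
    its own round trip, which depends only on Fourier coefficients.\<close>
  obtain h :: "int^'d \<Rightarrow> real" where h: "unit_mass h"
    "norm (a - transfer h \<theta> \<theta> (transfer h \<theta> \<theta> a)) \<le> 1 * qtorus_lip len \<theta> a"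
    using ex_near_identity[OF len cont zero_less_one] \<theta> a by (metis diff_self norm_zero)
  define r where "r = Re (fourier_coeff a 0)"
  have "fourier_coeff a p = fourier_coeff (r *\<^sub>R id_blinfun) p" for p
  proof (cases "p = 0")
    case True then show ?thesis using fourier_coeff_0_real[OF \<theta> a] by (simp add: r_def)
  next
    case False
    then obtain B where "cmod (fourier_coeff a p) \<le> B * qtorus_lip len \<theta> a"
      using fourier_coeff_bound[OF False] a len by metis
    then show ?thesis using L0 False by simp
  qed
  then have "transfer h \<theta> \<theta> a = transfer h \<theta> \<theta> (r *\<^sub>R id_blinfun)" by (rule transfer_eqI)
  then have "a = r *\<^sub>R id_blinfun"
    using h L0 by (simp add: transfer_scaleR[OF h(1)] transfer_unit[OF h(1) \<theta>])
  then show "\<exists>r. a = r *\<^sub>R ou_unit (qtorus len \<theta>)" by (auto simp: qtorus_def)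
next
  assume "\<exists>r. a = r *\<^sub>R ou_unit (qtorus len \<theta>)"
  then obtain r where "a = r *\<^sub>R id_blinfun" by (auto simp: qtorus_def)
  then show "qtorus_lip len \<theta> a = 0"
    using qtorus_lip_scaleR(2)[OF len id_in_qtorus(1)[OF len \<theta>]] id_in_qtorus(2)[OF len \<theta>] by simp
qed

text \<open>Coefficients confined to discs give a Minkowski sum of compact sets, one for each
  frequency.\<close>

lemma pi_rep_single_compact:
  fixes \<theta> :: "real^'d^'d"
  assumes "finite S"
  shows "\<exists>K. compact K \<and> (\<forall>c. (\<forall>p\<in>S. cmod (c p) \<le> B p) \<longrightarrow>
    (\<Sum>p\<in>S. pi_rep \<theta> (\<lambda>r. if r = p then c p else 0)) \<in> K)"
  using assms
proof induction
  case empty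
  then show ?case by (intro exI[of _ "{0}"]) simp
next
  case (insert q S)
  obtain K where K: "compact K" "\<And>c. (\<forall>p\<in>S. cmod (c p) \<le> B p) \<Longrightarrow>
      (\<Sum>p\<in>S. pi_rep \<theta> (\<lambda>r. if r = p then c p else 0)) \<in> K"
    using insert.IH by blast
  let ?g = "\<lambda>z. pi_rep \<theta> (\<lambda>r. if r = q then z else 0)"
  have Cc: "(\<lambda>r. if r = q then z else 0) \<in> Cc" for z :: complex
    unfolding Cc_def by (simp add: finite_subset[of _ "{q}"])
  have "bounded_linear ?g"
  proof (rule bounded_linear_intro[of _ 1])
    fix z w :: complex and r :: real
    show "?g (z + w) = ?g z + ?g w"
      unfolding pi_rep_add[OF Cc Cc, symmetric] by (rule arg_cong[where f = "pi_rep \<theta>"]) auto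
    show "?g (r *\<^sub>R z) = r *\<^sub>R ?g z"
      unfolding pi_rep_scaleR[OF Cc, symmetric] by (rule arg_cong[where f = "pi_rep \<theta>"]) (auto simp: scaleR_conv_of_real)
    show "norm (?g z) \<le> norm z * 1" using norm_pi_rep_single[of \<theta> q z] by simp
  qed
  then have "compact (?g ` cball 0 (B q))"
    by (intro compact_continuous_image linear_continuous_on compact_cball)
  then have "compact {x + y | x y. x \<in> ?g ` cball 0 (B q) \<and> y \<in> K}" using K(1) by (rule compact_sums)
  then show ?case
    by (intro exI[of _ "{x + y | x y. x \<in> ?g ` cball 0 (B q) \<and> y \<in> K}"] conjI)
      (use insert.hyps K(2) in \<open>fastforce+\<close>)
qed

text \<open>The round trip with \<open>\<psi> = \<theta>\<close> moves the unit ball of the seminorm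
  by at most \<open>\<eta> / 3\<close> and keeps finitely many frequencies, so modulo scalars its
  image lies in a compact set.\<close>

lemma lip_precompact_qtorus:
  fixes len :: "complex^'d \<Rightarrow> real"
  assumes len: "length_function torus len" and cont: "continuous_on (carrier torus) len"
    and \<theta>: "\<theta> \<in> skew_matrices"
  shows "lip_precompact (qtorus len \<theta>) norm (qtorus_lip len \<theta>)"
  unfolding lip_precompact_def
proof (intro allI impI)
  fix \<eta> :: real assume "0 < \<eta>"
  then have \<eta>: "0 < \<eta> / 3" by simp
  let ?X = "{a \<in> carrier (qtorus len \<theta>). qtorus_lip len \<theta> a \<le> 1}"
  obtain h :: "int^'d \<Rightarrow> real" where h: "unit_mass h"
    and near: "\<And>a. a \<in> carrier (qtorus len \<theta>) \<Longrightarrow>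
      norm (a - transfer h \<theta> \<theta> (transfer h \<theta> \<theta> a)) \<le> \<eta> / 3 * qtorus_lip len \<theta> a"
    using ex_near_identity[OF len cont \<eta>] \<theta> by (metis diff_self norm_zero)
  define Q where "Q a = transfer h \<theta> \<theta> (transfer h \<theta> \<theta> a)" for a
  define g where "g = correl h (0 :: real^'d^'d)"
  \<comment> \<open>Frequency 0 is split off: its coefficient is not bounded by the Lip-seminorm but
    contributes only a scalar.\<close>
  define S where "S = {p. g p \<noteq> 0} - {0}"
  have gC: "g \<in> Cc" unfolding g_def by (rule correl_Cc[OF h])
  have S: "finite S" using gC by (simp add: S_def Cc_def)
  have "\<exists>B. \<forall>a\<in>carrier (qtorus len \<theta>). cmod (fourier_coeff a p) \<le> B * qtorus_lip len \<theta> a" if "p \<in> S" for p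
  proof -
    have "p \<noteq> 0" using that by (simp add: S_def)
    then show ?thesis by (rule fourier_coeff_bound) (use len in blast)
  qed
  then obtain B where B: "\<And>p a. p \<in> S \<Longrightarrow> a \<in> carrier (qtorus len \<theta>) \<Longrightarrow>
      cmod (fourier_coeff a p) \<le> B p * qtorus_lip len \<theta> a" by metis
  define c where "c a p = g p * (g p * fourier_coeff a p)" for a p
  define G where "G a = (\<Sum>p\<in>S. pi_rep \<theta> (\<lambda>r. if r = p then c a p else 0))" for a
  obtain K where K: "compact K" "\<And>c. (\<forall>p\<in>S. cmod (c p) \<le> cmod (g p * g p) * \<bar>B p\<bar>) \<Longrightarrow>
      (\<Sum>p\<in>S. pi_rep \<theta> (\<lambda>r. if r = p then c p else 0)) \<in> K"
    using pi_rep_single_compact[OF S, of "\<lambda>p. cmod (g p * g p) * \<bar>B p\<bar>" \<theta>] by blast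
  have GK: "G ` ?X \<subseteq> K"
  proof (rule image_subsetI, unfold G_def, rule K(2), intro ballI)
    fix a p assume a: "a \<in> ?X" and p: "p \<in> S"
    have "cmod (fourier_coeff a p) \<le> B p * qtorus_lip len \<theta> a" using B[OF p] a by blast
    also have "\<dots> \<le> \<bar>B p\<bar> * 1" using a qtorus_lip_nonneg[OF len, of \<theta> a] by (intro mult_mono) auto
    finally show "cmod (c a p) \<le> cmod (g p * g p) * \<bar>B p\<bar>"
      by (simp add: c_def norm_mult mult.assoc mult_left_mono)
  qed
  have QG: "Q a = Re (fourier_coeff a 0) *\<^sub>R id_blinfun + G a" if a: "a \<in> carrier (qtorus len \<theta>)" for a
  proof -
    let ?d = "\<lambda>q r. if r = q then c a q else (0 :: complex)"
    have S0: "0 \<notin> S" by (simp add: S_def)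
    have Cc: "?d q \<in> Cc" for q unfolding Cc_def by (simp add: finite_subset[of _ "{q}"])
    have g0: "g 0 = 1" unfolding g_def by (rule correl_0[OF h])
    have c0: "c a p = 0" if "p \<notin> insert 0 S" for p using that by (auto simp: S_def c_def)
    have "Q a = pi_rep \<theta> (c a)"
      unfolding Q_def transfer_def[of h \<theta> \<theta> "transfer h \<theta> \<theta> a"] fourier_coeff_transfer[OF h \<theta>]
      by (simp add: c_def[abs_def] g_def)
    also have "c a = (\<lambda>p. \<Sum>q\<in>insert 0 S. ?d q p)"
      using S c0 by (auto simp: fun_eq_iff)
    also have "pi_rep \<theta> \<dots> = (\<Sum>q\<in>insert 0 S. pi_rep \<theta> (?d q))" by (rule pi_rep_sum[OF Cc])
    also have "\<dots> = pi_rep \<theta> (?d 0) + G a" using S S0 by (simp add: G_def)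
    also have "?d 0 = (\<lambda>p. of_real (Re (fourier_coeff a 0)) * (if p = 0 then 1 else 0))"
      using fourier_coeff_0_real[OF \<theta> a] by (auto simp: c_def g0)
    also have "pi_rep \<theta> \<dots> = Re (fourier_coeff a 0) *\<^sub>R id_blinfun"
      by (subst pi_rep_scaleR) (simp_all add: pi_rep_unit[OF \<theta>] Cc_def)
    finally show ?thesis .
  qed
  have "compact (closure (G ` ?X))"
    using compact_Int_closed[OF K(1) closed_closure, of "G ` ?X"] closure_minimal[OF GK compact_imp_closed[OF K(1)]]
    by (simp add: inf.absorb2)
  moreover have "closure (G ` ?X) \<subseteq> (\<Union>a\<in>?X. ball (G a) (\<eta> / 3))"
  proof
    fix y assume "y \<in> closure (G ` ?X)"
    then obtain a where "a \<in> ?X" "dist (G a) y < \<eta> / 3" using \<eta> unfolding closure_approachable by blast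
    then show "y \<in> (\<Union>a\<in>?X. ball (G a) (\<eta> / 3))" by auto
  qed
  ultimately obtain F where F: "F \<subseteq> ?X" "finite F" "closure (G ` ?X) \<subseteq> (\<Union>a\<in>F. ball (G a) (\<eta> / 3))"
    using compactE_image[of "closure (G ` ?X)" ?X "\<lambda>a. ball (G a) (\<eta> / 3)"] by auto
  have "\<exists>f\<in>F. \<exists>t. norm (a - (f + t *\<^sub>R ou_unit (qtorus len \<theta>))) < \<eta>"
    if a: "a \<in> carrier (qtorus len \<theta>)" "qtorus_lip len \<theta> a \<le> 1" for a
  proof -
    have "G a \<in> closure (G ` ?X)" using a by (intro subsetD[OF closure_subset]) auto
    then obtain f where f: "f \<in> F" "norm (G a - G f) < \<eta> / 3"
      using F(3) by (fastforce simp: dist_norm norm_minus_commute)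
    have nQ: "norm (x - Q x) \<le> \<eta> / 3" if "x \<in> ?X" for x
    proof -
      have "norm (x - Q x) \<le> \<eta> / 3 * qtorus_lip len \<theta> x" using near that by (simp add: Q_def)
      also have "\<dots> \<le> \<eta> / 3 * 1" using that \<eta> by (intro mult_left_mono) auto
      finally show ?thesis by simp
    qed
    have fX: "f \<in> ?X" using f F by blast
    \<comment> \<open>The scalar parts of \<open>a\<close> and \<open>f\<close> are matched exactly,
      which leaves three errors of size \<open>\<eta> / 3\<close>, the middle one strict.\<close>
    define t where "t = Re (fourier_coeff a 0) - Re (fourier_coeff f 0)"
    have "a - (f + t *\<^sub>R id_blinfun) = (a - Q a) + (G a - G f) - (f - Q f)"
      using fX a by (simp add: QG t_def scaleR_diff_left algebra_simps)
    also have "norm \<dots> \<le> norm (a - Q a) + norm (G a - G f) + norm (f - Q f)"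
      by (meson norm_triangle_ineq norm_triangle_ineq4 order_trans add_right_mono)
    also have "\<dots> < \<eta>" using nQ[of a] nQ[OF fX] a f(2) by simp
    finally show ?thesis using f(1) by (auto simp: qtorus_def)
  qed
  then show "\<exists>F. finite F \<and> F \<subseteq> carrier (qtorus len \<theta>) \<and> (\<forall>a\<in>carrier (qtorus len \<theta>).
      qtorus_lip len \<theta> a \<le> 1 \<longrightarrow> (\<exists>f\<in>F. \<exists>t. norm (a - (f + t *\<^sub>R ou_unit (qtorus len \<theta>))) < \<eta>))"
    using F(1,2) by (intro exI[of _ F]) auto
qed

lemma lip_contraction_transfer:
  assumes len: "length_function torus len" and h: "unit_mass h"
    and \<theta>: "\<theta> \<in> skew_matrices" and \<psi>: "\<psi> \<in> skew_matrices"
  shows "lip_contraction (qtorus len \<theta>) norm (qtorus_lip len \<theta>)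
    (qtorus len \<psi>) norm (qtorus_lip len \<psi>) (transfer h \<theta> \<psi>)"
  unfolding lip_contraction_def
proof (intro conjI ballI allI)
  show "transfer h \<theta> \<psi> (ou_unit (qtorus len \<theta>)) = ou_unit (qtorus len \<psi>)"
    by (simp add: qtorus_def transfer_unit[OF h \<psi>])
  show "norm (transfer h \<theta> \<psi> a) \<le> norm a" if "a \<in> carrier (qtorus len \<theta>)" for a
    using that by (intro norm_transfer_le[OF h \<theta> \<psi>]) (simp add: qtorus_carrier_iff)
qed (simp_all add: transfer_lip[OF len h \<theta> \<psi>] transfer_add[OF h] transfer_scaleR[OF h])

theorem theorem9p2:
  fixes N :: "real^'d^'d \<Rightarrow> real" and len :: "complex^'d \<Rightarrow> real" and \<epsilon> :: real
  assumes "norm_on skew_matrices N"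
    and "length_function torus len"
    and "continuous_on (carrier torus) len"
    and "0 < \<epsilon>"
  shows "\<exists>\<delta>>0. \<forall>\<theta>\<in>skew_matrices. \<forall>\<psi>\<in>skew_matrices. N (\<theta> - \<psi>) < \<delta> \<longrightarrow>
    dist_q (qtorus len \<theta>) (qtorus_lip len \<theta>) (qtorus len \<psi>) (qtorus_lip len \<psi>) < ereal \<epsilon>"
proof -
  note len = assms(2) and cont = assms(3)
  \<comment> \<open>\<open>dist_q_le\<close> returns twice its parameter, so
    \<open>\<epsilon> / 3\<close> leaves room for the strict inequality.\<close>
  have e: "0 < \<epsilon> / 3" using assms(4) by simp
  obtain h :: "int^'d \<Rightarrow> real" and \<delta>' where h: "unit_mass h" "0 < \<delta>'"
    and near: "\<And>\<theta> \<psi> a. \<theta> \<in> skew_matrices \<Longrightarrow> \<psi> \<in> skew_matrices \<Longrightarrow> norm (\<psi> - \<theta>) < \<delta>' \<Longrightarrow>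
      a \<in> carrier (qtorus len \<theta>) \<Longrightarrow>
      norm (a - transfer h \<psi> \<theta> (transfer h \<theta> \<psi> a)) \<le> \<epsilon> / 3 * qtorus_lip len \<theta> a"
    using ex_near_identity[OF len cont e] by blast
  obtain \<delta> where \<delta>: "0 < \<delta>" "\<And>\<Delta>. \<Delta> \<in> skew_matrices \<Longrightarrow> N \<Delta> < \<delta> \<Longrightarrow> norm \<Delta> < \<delta>'"
    using norm_on_skew[OF assms(1) h(2)] by blast
  have "dist_q (qtorus len \<theta>) (qtorus_lip len \<theta>) (qtorus len \<psi>) (qtorus_lip len \<psi>) < ereal \<epsilon>"
    if \<theta>: "\<theta> \<in> skew_matrices" and \<psi>: "\<psi> \<in> skew_matrices" and N: "N (\<theta> - \<psi>) < \<delta>" for \<theta> \<psi>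
  proof -
    have n: "norm (\<theta> - \<psi>) < \<delta>'" "norm (\<psi> - \<theta>) < \<delta>'"
      using \<delta>(2)[OF skew_diff[OF \<theta> \<psi>] N] by (simp_all add: norm_minus_commute)
    have "dist_q (qtorus len \<theta>) (qtorus_lip len \<theta>) (qtorus len \<psi>) (qtorus_lip len \<psi>) \<le> ereal (2 * (\<epsilon> / 3))"
      by (rule dist_q_le[OF order_norm_qtorus[OF len \<theta>] order_norm_qtorus[OF len \<psi>]
            seminorm_on_qtorus_lip[OF len] seminorm_on_qtorus_lip[OF len]
            qtorus_lip_eq_0_iff[OF len cont \<theta>] qtorus_lip_eq_0_iff[OF len cont \<psi>]
            lip_precompact_qtorus[OF len cont \<theta>] lip_precompact_qtorus[OF len cont \<psi>]
            lip_contraction_transfer[OF len h(1) \<theta> \<psi>] lip_contraction_transfer[OF len h(1) \<psi> \<theta>] e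
            near[OF \<theta> \<psi> n(2)] near[OF \<psi> \<theta> n(1)]])
    also have "\<dots> < ereal \<epsilon>" using assms(4) by simp
    finally show ?thesis .
  qed
  then show ?thesis using \<delta>(1) by blast
qed

end
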